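(* Let $N\ge 1$, let $B$ be the unit ball of $\mathbb{R}^N$, and let $f\in C^1(\mathbb{R})$. Assume that there exists $a\in\mathbb{R}$ such that $f(a)>0$ and $f(t)\ge 0$ for all $t>a$, and, with $F(t)=\int_a^t f(s)\,ds$, that $\int^{+\infty}\frac{dt}{\sqrt{F(t)}}<+\infty$. Let $\lambda_1=\lambda_1(-\Delta;B)>0$ be the principal eigenvalue of $-\Delta$ in $B$ with homogeneous Dirichlet boundary condition, and assume that the function $\tilde f$ defined by $f(t)=\tilde f(t)-\lambda_1 t$, $t\in\mathbb{R}$, is nondecreasing. Then there exists a unique large solution of $\Delta u=f(u)$ in $B$.
   Context: A large solution of $\Delta u=f(u)$ in $B$ is a classical solution $u$ of $\Delta u=f(u)$ in $B$ such that $\lim_{x\to x_0,\,x\in B}u(x)=+\infty$ for every $x_0\in\partial B$. *)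

theory Defs
  imports "HOL-Analysis.Analysis"
begin

definition partial_deriv :: "'a::euclidean_space \<Rightarrow> ('a \<Rightarrow> real) \<Rightarrow> 'a \<Rightarrow> real" where
  "partial_deriv b u x = frechet_derivative u (at x) b"

text \<open>\<open>C1_on\<close> and \<open>C2_on\<close> are meant for open sets \<open>\<Omega>\<close>.\<close>

definition C1_on :: "'a::euclidean_space set \<Rightarrow> ('a \<Rightarrow> real) \<Rightarrow> bool" where
  "C1_on \<Omega> u \<longleftrightarrow>
     (\<forall>x\<in>\<Omega>. u differentiable (at x)) \<and>
     (\<forall>b\<in>Basis. continuous_on \<Omega> (partial_deriv b u))"

definition C2_on :: "'a::euclidean_space set \<Rightarrow> ('a \<Rightarrow> real) \<Rightarrow> bool" where
  "C2_on \<Omega> u \<longleftrightarrow> C1_on \<Omega> u \<and> (\<forall>b\<in>Basis. C1_on \<Omega> (partial_deriv b u))"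

definition laplacian :: "('a::euclidean_space \<Rightarrow> real) \<Rightarrow> 'a \<Rightarrow> real" where
  "laplacian u x = (\<Sum>b\<in>Basis. partial_deriv b (partial_deriv b u) x)"

definition dirichlet_eigenvalue :: "'a::euclidean_space set \<Rightarrow> real \<Rightarrow> bool" where
  "dirichlet_eigenvalue \<Omega> \<mu> \<longleftrightarrow>
     (\<exists>\<phi>. C2_on \<Omega> \<phi> \<and> continuous_on (closure \<Omega>) \<phi> \<and>
          (\<forall>x\<in>\<Omega>. - laplacian \<phi> x = \<mu> * \<phi> x) \<and>
          (\<forall>x\<in>frontier \<Omega>. \<phi> x = 0) \<and>
          (\<exists>x\<in>\<Omega>. \<phi> x \<noteq> 0))"

text \<open>The principal eigenvalue is the smallest Dirichlet eigenvalue of \<open>-\<Delta>\<close>. Eigenfunctions are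
  taken in the classical sense, which loses nothing on domains with regular boundary.\<close>

definition principal_eigenvalue :: "'a::euclidean_space set \<Rightarrow> real" where
  "principal_eigenvalue \<Omega> = (LEAST \<mu>. dirichlet_eigenvalue \<Omega> \<mu>)"

text \<open>Only the values of \<open>u\<close> on the open set \<open>\<Omega>\<close> matter here.\<close>

definition large_solution ::
    "'a::euclidean_space set \<Rightarrow> (real \<Rightarrow> real) \<Rightarrow> ('a \<Rightarrow> real) \<Rightarrow> bool" where
  "large_solution \<Omega> f u \<longleftrightarrow>
     C2_on \<Omega> u \<and>
     (\<forall>x\<in>\<Omega>. laplacian u x = f (u x)) \<and>
     (\<forall>x\<^sub>0\<in>frontier \<Omega>. filterlim u at_top (at x\<^sub>0 within \<Omega>))"

text \<open>Convergence of \<open>\<integral> dt / sqrt (F t)\<close> at \<open>+\<infinity>\<close>, with \<open>F t = \<integral>\<^sub>a\<^sup>t f\<close>. The lower limit \<open>T\<close> must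
  exceed \<open>a\<close> because \<open>F\<close> is given by \<open>integral {a..t} f\<close> only for \<open>t \<ge> a\<close>; when \<open>F > 0\<close> on
  \<open>{a<..}\<close> its choice is irrelevant.\<close>

definition keller_osserman :: "real \<Rightarrow> (real \<Rightarrow> real) \<Rightarrow> bool" where
  "keller_osserman a f \<longleftrightarrow>
     (\<exists>T>a. set_integrable lborel {T..} (\<lambda>t. 1 / sqrt (integral {a..t} f)))"

end

theory Submission
  imports Defs "HOL-Real_Asymp.Real_Asymp"
begin

text \<open>
  Write \<open>\<phi>\<close> for the radial first Dirichlet eigenfunction of the ball. Because \<open>f t + \<lambda>\<^sub>1 t\<close> is
  nondecreasing, sub- and supersolutions can be compared on every ball of radius less than one: the
  eigenfunction of a slightly larger ball is a positive strict supersolution of the linearised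
  problem. Hence radial solutions that exist beyond radius one lie below every large solution,
  and radial solutions that blow up before radius one lie above every large solution.

  The Keller--Osserman condition and the monotonicity of \<open>f t + \<lambda>\<^sub>1 t\<close> make \<open>f\<close> superlinear, so a
  radial solution that becomes large blows up soon afterwards. The supremum \<open>b\<^sub>0\<close> of the initial
  values whose solution exists on the closed unit ball is therefore finite, and its solution is large
  on the unit ball. That such initial values exist is the place where \<open>\<lambda>\<^sub>1\<close> is critical.

  It remains to see that \<open>b\<^sub>0\<close> is the only initial value whose solution blows up exactly at radius one.
  If \<open>u < v\<close> are two such solutions, an energy estimate for the lag between the radii at which they
  reach the same level shows that \<open>v - u\<close> tends to zero at the boundary. Its Wronskian with \<open>\<phi>\<close> is
  nondecreasing, so it must vanish, which forces \<open>f t + \<lambda>\<^sub>1 t\<close> to take equal values at \<open>u\<close> and \<open>v\<close>;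
  but this function is unbounded. Letting the initial value tend to \<open>b\<^sub>0\<close> from both sides, every large
  solution coincides with the radial one.
\<close>

section \<open>Radial solutions\<close>

text \<open>As only \<open>f t + \<lambda>\<^sub>1 t\<close> is monotone, comparison on the full
  unit ball degenerates: the natural positive supersolution there, the eigenfunction, vanishes on
  the boundary, exactly where two large solutions are both infinite. Hence every comparison is
  arranged so that the order near the boundary is known beforehand, and ties at radius one are
  settled by ordinary differential equations alone. Neither monotonicity nor convexity of
  \<open>f\<close> is at hand for the usual boundary asymptotics. What remains is that the flux
  \<open>r\<^sup>n u'\<close> increases wherever \<open>f\<close> is nonnegative, so two solutions
  are compared at equal levels rather than at equal radii. For existence, a zero of \<open>f\<close>
  would supply a constant solution to start from. If \<open>f\<close> is positive everywhere, the
  only upper bound at negative levels is \<open>f t \<le> f 0 - \<lambda>\<^sub>1 t\<close>, the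
  resonant growth. The constant forcing \<open>f 0\<close> then decides where the solution crosses
  zero, and the linear vanishing of the eigenfunction at the boundary makes the steepness there and
  the remaining distance cancel.\<close>

text \<open>The radial form of \<open>\<Delta>u = f(u)\<close> in dimension \<open>n + 1\<close>, written with \<open>h r = u' r / r\<close> and the flux
  \<open>r\<^sup>n u' = r\<^sup>n\<^sup>+\<^sup>1 h\<close> so that nothing is singular at \<open>r = 0\<close>.\<close>

definition radial :: "nat \<Rightarrow> (real \<Rightarrow> real) \<Rightarrow> real \<Rightarrow> (real \<Rightarrow> real) \<Rightarrow> (real \<Rightarrow> real) \<Rightarrow> bool" where
  "radial n f X u h \<longleftrightarrow>
     continuous_on {0..<X} u \<and> continuous_on {0..<X} h \<and>
     (\<forall>r. 0 < r \<longrightarrow> r < X \<longrightarrow>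
        (u has_real_derivative r * h r) (at r) \<and>
        ((\<lambda>s. s ^ Suc n * h s) has_real_derivative r ^ n * f (u r)) (at r))"

lemma radialD:
  assumes "radial n f X u h"
  shows "continuous_on {0..<X} u" "continuous_on {0..<X} h"
    "\<And>r. 0 < r \<Longrightarrow> r < X \<Longrightarrow> (u has_real_derivative r * h r) (at r)"
    "\<And>r. 0 < r \<Longrightarrow> r < X \<Longrightarrow>
       ((\<lambda>s. s ^ Suc n * h s) has_real_derivative r ^ n * f (u r)) (at r)"
  using assms unfolding radial_def by auto

lemma radial_mono:
  assumes "radial n f X u h" "Y \<le> X"
  shows "radial n f Y u h"
  using assms unfolding radial_def
  by (auto intro: continuous_on_subset)

lemma radial_cong_rhs:
  assumes "radial n f X u h" "\<And>r. 0 < r \<Longrightarrow> r < X \<Longrightarrow> f (u r) = g (u r)"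
  shows "radial n g X u h"
  using assms unfolding radial_def by auto

lemma radial_transfer:
  assumes rad: "radial n f X u h"
    and eq: "\<And>r. 0 \<le> r \<Longrightarrow> r < X \<Longrightarrow> u r = v r" "\<And>r. 0 \<le> r \<Longrightarrow> r < X \<Longrightarrow> h r = k r"
  shows "radial n f X v k"
  unfolding radial_def
proof (intro conjI allI impI)
  show "continuous_on {0..<X} v" "continuous_on {0..<X} k"
    by (rule continuous_on_eq[OF radialD(1)[OF rad]] continuous_on_eq[OF radialD(2)[OF rad]], use eq in force)+
next
  fix r :: real assume r: "0 < r" "r < X"
  have op: "open {0<..<X}" "r \<in> {0<..<X}" using r by auto
  show "(v has_real_derivative r * k r) (at r)"
    using has_field_derivative_transform_within_open[OF radialD(3)[OF rad r] op, of v] eq r by auto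
  show "((\<lambda>s. s ^ Suc n * k s) has_real_derivative r ^ n * f (v r)) (at r)"
    using has_field_derivative_transform_within_open[OF radialD(4)[OF rad r] op, of "\<lambda>s. s ^ Suc n * k s"]
      eq r by auto
qed

lemma radial_locally:
  assumes "\<And>Y. 0 < Y \<Longrightarrow> Y < X \<Longrightarrow> radial n f Y u h"
  shows "radial n f X u h"
proof -
  have c: "continuous_on {0..<X} w" if w: "\<And>Y. 0 < Y \<Longrightarrow> Y < X \<Longrightarrow> continuous_on {0..<Y} w" for w :: "real \<Rightarrow> real"
    unfolding continuous_on_eq_continuous_within
  proof
    fix r assume r: "r \<in> {0..<X}"
    define Y where "Y = (r + X) / 2"
    have Y: "0 < Y" "Y < X" "r < Y" using r by (auto simp: Y_def)
    have "continuous (at r within {0..<Y}) w"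
      using w[OF Y(1,2)] r Y by (auto simp: continuous_on_eq_continuous_within)
    moreover have "at r within {0..<Y} = at r within {0..<X}"
      by (rule at_within_nhd[of _ "{..<Y}"]) (use Y r in auto)
    ultimately show "continuous (at r within {0..<X}) w" by simp
  qed
  show ?thesis
    unfolding radial_def
  proof (intro conjI allI impI)
    show "continuous_on {0..<X} u" "continuous_on {0..<X} h"
      using c assms radialD(1,2) by blast+
  next
    fix r :: real assume r: "0 < r" "r < X"
    define Y where "Y = (r + X) / 2"
    have Y: "0 < Y" "Y < X" "r < Y" using r by (auto simp: Y_def)
    show "(u has_real_derivative r * h r) (at r)"
      "((\<lambda>s. s ^ Suc n * h s) has_real_derivative r ^ n * f (u r)) (at r)"
      using radialD(3,4)[OF assms[OF Y(1,2)] r(1) Y(3)] by auto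
  qed
qed

text \<open>The function \<open>s ^ Suc n * (h s - h r)\<close> vanishes at both ends of
  \<open>{0..r}\<close>, so its derivative has a zero inside. This stands in for the integral
  formula expressing \<open>h r\<close> as a weighted mean of \<open>G / (n + 1)\<close>, and lets
  signs and bounds pass from the right-hand side to \<open>h\<close>.\<close>

lemma average_mvt:
  fixes h :: "real \<Rightarrow> real"
  assumes "0 < r" and cont: "continuous_on {0..r} h"
    and der: "\<And>s. 0 < s \<Longrightarrow> s < r \<Longrightarrow> ((\<lambda>s. s ^ Suc n * h s) has_real_derivative s ^ n * G s) (at s)"
  shows "\<exists>\<xi>. 0 < \<xi> \<and> \<xi> < r \<and> h r = G \<xi> / real (Suc n)"
proof -
  define k where "k s = s ^ Suc n * h s - h r * s ^ Suc n" for s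
  have dk: "(k has_real_derivative s ^ n * (G s - real (Suc n) * h r)) (at s)" if "0 < s" "s < r" for s
    unfolding k_def
    by (rule derivative_eq_intros der[OF that] refl | simp)+ (simp add: algebra_simps)
  have "\<exists>l z. 0 < z \<and> z < r \<and> (k has_real_derivative l) (at z) \<and> k r - k 0 = (r - 0) * l"
    by (rule MVT) (use assms(1) cont dk in \<open>auto simp: k_def real_differentiable_def intro!: continuous_intros\<close>)
  then obtain z l where z: "0 < z" "z < r" "(k has_real_derivative l) (at z)" "k r - k 0 = (r - 0) * l"
    by auto
  have "l = z ^ n * (G z - real (Suc n) * h r)"
    using DERIV_unique[OF z(3) dk[OF z(1,2)]] .
  moreover have "k r - k 0 = 0" by (simp add: k_def)
  ultimately have "G z - real (Suc n) * h r = 0" using z assms(1) by simp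
  then have "h r = G z / real (Suc n)" by (simp add: field_simps)
  then show ?thesis using z by blast
qed

lemma radial_average:
  assumes "radial n f X u h" "0 < r" "r < X"
  shows "\<exists>\<xi>. 0 < \<xi> \<and> \<xi> < r \<and> h r = f (u \<xi>) / real (Suc n)"
  by (rule average_mvt[of r h n "\<lambda>s. f (u s)"])
     (use assms radialD[OF assms(1)] in \<open>auto intro: continuous_on_subset\<close>)

text \<open>The witnesses \<xi> are squeezed to \<open>0\<close> along a sequence, so the relation
  survives in the limit. It fixes the value at the origin, where the differential equation says
  nothing.\<close>

lemma right_limit_eqI:
  fixes h g :: "real \<Rightarrow> real"
  assumes "0 < X" "continuous_on {0..<X} h" "continuous_on {0..<X} g"
    and ex: "\<And>r. 0 < r \<Longrightarrow> r < X \<Longrightarrow> \<exists>\<xi>. 0 < \<xi> \<and> \<xi> < r \<and> h r = g \<xi>"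
  shows "h 0 = g 0"
proof -
  obtain q where q: "\<And>r. 0 < r \<Longrightarrow> r < X \<Longrightarrow> 0 < q r \<and> q r < r \<and> h r = g (q r)"
    using ex by metis
  define s where "s k = X / real (k + 2)" for k
  have s: "0 < s k" "s k < X" for k using assms(1) by (auto simp: s_def field_simps add_pos_nonneg)
  have s0: "s \<longlonglongrightarrow> 0" unfolding s_def by real_asymp
  have qs0: "(\<lambda>k. q (s k)) \<longlonglongrightarrow> 0"
    by (rule tendsto_sandwich[OF _ _ tendsto_const s0])
       (use q s in \<open>auto intro!: always_eventually less_imp_le\<close>)
  have "(\<lambda>k. h (s k)) \<longlonglongrightarrow> h 0"
    by (rule continuous_on_tendsto_compose[OF assms(2) s0]) (use s assms(1) in \<open>auto simp: less_imp_le\<close>)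
  moreover have "(\<lambda>k. g (q (s k))) \<longlonglongrightarrow> g 0"
    by (rule continuous_on_tendsto_compose[OF assms(3) qs0])
       (use s q assms(1) in \<open>auto simp: less_imp_le intro!: always_eventually, meson less_trans\<close>)
  ultimately show ?thesis
    using q[OF s] by (simp add: LIMSEQ_unique)
qed

lemma radial_at_0:
  assumes "radial n f X u h" "0 < X" "continuous_on UNIV f"
  shows "h 0 = f (u 0) / real (Suc n)"
proof (rule right_limit_eqI[of X h "\<lambda>r. f (u r) / real (Suc n)"])
  show "continuous_on {0..<X} (\<lambda>r. f (u r) / real (Suc n))"
    by (intro continuous_intros continuous_on_compose2[OF assms(3) radialD(1)[OF assms(1)]]) auto
qed (use assms radialD[OF assms(1)] radial_average in auto)

lemma radial_flux_nonneg:
  assumes "radial n f X u h" "\<And>t. f t \<ge> 0" "0 < r" "r < X"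
  shows "0 \<le> h r"
  using radial_average[OF assms(1,3,4)] assms(2) by auto

lemma radial_nondecreasing:
  assumes rad: "radial n f X u h" and nonneg: "\<And>r. 0 < r \<Longrightarrow> r < X \<Longrightarrow> 0 \<le> h r"
    and "0 \<le> r" "r \<le> s" "s < X"
  shows "u r \<le> u s"
proof (cases "r = s")
  case False
  show ?thesis
  proof (rule DERIV_nonneg_imp_increasing_open[of r s u])
    show "r \<le> s" using assms by simp
    show "\<And>x. r < x \<Longrightarrow> x < s \<Longrightarrow> \<exists>y. (u has_real_derivative y) (at x) \<and> 0 \<le> y"
      using radialD(3)[OF rad] nonneg assms by (meson less_le_trans less_trans mult_nonneg_nonneg order_le_less_trans order_less_imp_le)
    show "continuous_on {r..s} u"
      using radialD(1)[OF rad] by (rule continuous_on_subset) (use assms in auto)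
  qed
qed simp

text \<open>The difference is measured in the sup norm with weight
  \<open>exp (- L * s\<^sup>2)\<close>. Integrating \<open>t * exp (L * t\<^sup>2)\<close> gains a
  factor 1/2, which is absorbed on the left and leaves the factor 2. Equal initial values give
  uniqueness.\<close>

lemma radial_dependence:
  assumes u: "radial n g X u h" and v: "radial n g X v k" and L: "L > 0"
    and lip: "\<And>s t. \<bar>g s - g t\<bar> \<le> L * \<bar>s - t\<bar>"
    and "0 \<le> r" "r < X"
  shows "\<bar>u r - v r\<bar> \<le> 2 * exp (L * r\<^sup>2) * \<bar>u 0 - v 0\<bar>"
proof -
  define w where "w s = u s - v s" for s
  have sub: "{0..r} \<subseteq> {0..<X}" using assms by auto
  have cw: "continuous_on {0..r} w"
    unfolding w_def using radialD(1)[OF u] radialD(1)[OF v] sub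
    by (intro continuous_intros) (auto intro: continuous_on_subset)
  have "continuous_on {0..r} (\<lambda>s. exp (- L * s\<^sup>2) * \<bar>w s\<bar>)"
    by (intro continuous_intros cw)
  then have "\<exists>x\<in>{0..r}. \<forall>y\<in>{0..r}. exp (- L * y\<^sup>2) * \<bar>w y\<bar> \<le> exp (- L * x\<^sup>2) * \<bar>w x\<bar>"
    by (intro continuous_attains_sup) (use assms in auto)
  then obtain r0 where r0: "r0 \<in> {0..r}"
    and max: "\<And>s. s \<in> {0..r} \<Longrightarrow> exp (- L * s\<^sup>2) * \<bar>w s\<bar> \<le> exp (- L * r0\<^sup>2) * \<bar>w r0\<bar>"
    by blast
  define m where "m = exp (- L * r0\<^sup>2) * \<bar>w r0\<bar>"
  have m0: "0 \<le> m" by (simp add: m_def)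
  have wm: "\<bar>w s\<bar> \<le> m * exp (L * s\<^sup>2)" if "s \<in> {0..r}" for s
    using max[OF that] unfolding m_def[symmetric] by (simp add: exp_minus field_simps)
  have key: "\<bar>w s - w 0\<bar> \<le> m / 2 * (exp (L * s\<^sup>2) - 1)" if s: "0 < s" "s \<le> r" for s
  proof -
    have hk: "\<bar>h t - k t\<bar> \<le> L * m * exp (L * t\<^sup>2)" if t: "0 < t" "t < s" for t
    proof -
      have "\<exists>\<xi>. 0 < \<xi> \<and> \<xi> < t \<and> h t - k t = (g (u \<xi>) - g (v \<xi>)) / real (Suc n)"
      proof (rule average_mvt)
        show "continuous_on {0..t} (\<lambda>s. h s - k s)"
          using radialD(2)[OF u] radialD(2)[OF v] sub t s
          by (intro continuous_intros) (auto intro!: continuous_on_subset[of "{0..<X}"])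
        show "((\<lambda>s. s ^ Suc n * (h s - k s)) has_real_derivative x ^ n * (g (u x) - g (v x))) (at x)"
          if "0 < x" "x < t" for x
          using DERIV_diff[OF radialD(4)[OF u] radialD(4)[OF v], of x] that t s assms
          by (simp add: algebra_simps)
      qed (use t in auto)
      then obtain \<xi> where \<xi>: "0 < \<xi>" "\<xi> < t" "h t - k t = (g (u \<xi>) - g (v \<xi>)) / real (Suc n)" by auto
      have "\<bar>h t - k t\<bar> = \<bar>g (u \<xi>) - g (v \<xi>)\<bar> / real (Suc n)" using \<xi> by (simp add: abs_divide)
      also have "\<dots> \<le> \<bar>g (u \<xi>) - g (v \<xi>)\<bar> / 1" by (rule divide_left_mono) auto
      also have "\<dots> \<le> L * \<bar>w \<xi>\<bar>" using lip unfolding w_def by simp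
      also have "\<dots> \<le> L * (m * exp (L * \<xi>\<^sup>2))" using wm[of \<xi>] \<xi> t s L by (intro mult_left_mono) auto
      also have "\<dots> \<le> L * (m * exp (L * t\<^sup>2))"
        using \<xi> L m0 by (intro mult_left_mono) (auto intro!: power_mono)
      finally show ?thesis by simp
    qed
    have cont: "continuous_on {0..s} w" using cw s by (auto intro: continuous_on_subset)
    have dw: "(w has_real_derivative t * (h t - k t)) (at t)" if "0 < t" "t < s" for t
      unfolding w_def using DERIV_diff[OF radialD(3)[OF u] radialD(3)[OF v], of t] that s assms
      by (simp add: algebra_simps)
    have bound: "e * (w s - w 0) \<le> m / 2 * (exp (L * s\<^sup>2) - 1)" if e: "\<bar>e\<bar> = 1" for e
    proof -
      have "m / 2 * exp (L * 0\<^sup>2) - e * w 0 \<le> m / 2 * exp (L * s\<^sup>2) - e * w s"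
      proof (rule DERIV_nonneg_imp_increasing_open[of 0 s "\<lambda>s. m / 2 * exp (L * s\<^sup>2) - e * w s"])
        fix t assume t: "0 < t" "t < s"
        have "((\<lambda>s. m / 2 * exp (L * s\<^sup>2) - e * w s) has_real_derivative
            t * (L * m * exp (L * t\<^sup>2) - e * (h t - k t))) (at t)"
          by (rule derivative_eq_intros dw[OF t] refl | simp)+ (simp add: algebra_simps)
        moreover have "e * (h t - k t) \<le> L * m * exp (L * t\<^sup>2)"
          using hk[OF t] abs_le_D1[of "e * (h t - k t)"] e by (simp add: abs_mult)
        ultimately show "\<exists>y. ((\<lambda>s. m / 2 * exp (L * s\<^sup>2) - e * w s) has_real_derivative y) (at t) \<and> 0 \<le> y"
          using t by (intro exI conjI) auto
      qed (use s cont in \<open>auto intro!: continuous_intros\<close>)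
      then show ?thesis by (simp add: algebra_simps)
    qed
    show ?thesis using bound[of 1] bound[of "-1"] unfolding abs_le_iff by simp
  qed
  have "m \<le> 2 * \<bar>w 0\<bar>"
  proof (cases "r0 = 0")
    case True then show ?thesis by (simp add: m_def)
  next
    case False
    then have "\<bar>w r0 - w 0\<bar> \<le> m / 2 * (exp (L * r0\<^sup>2) - 1)" using key r0 by auto
    then have "\<bar>w r0\<bar> \<le> \<bar>w 0\<bar> + m / 2 * exp (L * r0\<^sup>2)"
      using m0 abs_triangle_ineq2[of "w r0" "w 0"] by (simp add: algebra_simps)
    then have "exp (- L * r0\<^sup>2) * \<bar>w r0\<bar> \<le> exp (- L * r0\<^sup>2) * (\<bar>w 0\<bar> + m / 2 * exp (L * r0\<^sup>2))"
      by (intro mult_left_mono) auto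
    also have "\<dots> = exp (- L * r0\<^sup>2) * \<bar>w 0\<bar> + m / 2"
      by (simp add: algebra_simps flip: exp_add)
    also have "\<dots> \<le> \<bar>w 0\<bar> + m / 2" using L by (simp add: mult_left_le_one_le)
    finally show ?thesis by (simp add: m_def)
  qed
  then have "m * exp (L * r\<^sup>2) \<le> 2 * \<bar>w 0\<bar> * exp (L * r\<^sup>2)" by (rule mult_right_mono) simp
  with wm[of r] assms(5) have "\<bar>w r\<bar> \<le> 2 * \<bar>w 0\<bar> * exp (L * r\<^sup>2)"
    by (meson atLeastAtMost_iff order.refl order_trans)
  then show ?thesis by (simp add: w_def mult_ac)
qed

section \<open>The radial initial value problem\<close>

text \<open>By the substitution \<open>s = r * \<tau>\<close> the expression is the integral of
  \<open>s ^ n * G s\<close> over \<open>{0..r}\<close>. Over the fixed interval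
  \<open>{0..1}\<close> the average itself makes sense, and is continuous, through
  \<open>r = 0\<close>.\<close>

lemma scaled_average_derivative:
  fixes G :: "real \<Rightarrow> real"
  assumes G: "continuous_on UNIV G" and r: "0 < r"
  shows "((\<lambda>r. r ^ Suc n * integral {0..1} (\<lambda>\<tau>. \<tau> ^ n * G (r * \<tau>))) has_real_derivative r ^ n * G r) (at r)"
proof -
  \<comment> \<open>The interval exceeds \<open>{0..r}\<close> so that the primitive has two-sided
    derivatives at \<open>0\<close> and at \<open>r\<close>.\<close>
  have cont: "continuous_on {-1..r + 1} (\<lambda>s. s ^ n * G s)"
    using G by (auto intro!: continuous_intros continuous_on_subset[OF G])
  obtain \<Phi> where \<Phi>: "\<And>x. x \<in> {-1..r+1} \<Longrightarrow> (\<Phi> has_vector_derivative x ^ n * G x) (at x within {-1..r+1})"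
    using antiderivative_continuous[OF cont] by blast
  have d\<Phi>: "(\<Phi> has_real_derivative x ^ n * G x) (at x)" if "-1 < x" "x < r + 1" for x
    using \<Phi>[of x] that at_within_Icc_at[of "-1" x "r+1"]
    by (simp add: has_real_derivative_iff_has_vector_derivative)
  have eq: "s ^ Suc n * integral {0..1} (\<lambda>\<tau>. \<tau> ^ n * G (s * \<tau>)) = \<Phi> s - \<Phi> 0" if s: "0 < s" "s < r + 1" for s
  proof -
    have "((\<lambda>\<tau>. s ^ Suc n * (\<tau> ^ n * G (s * \<tau>))) has_integral \<Phi> (s * 1) - \<Phi> (s * 0)) {0..1}"
    proof (rule fundamental_theorem_of_calculus)
      fix \<tau> :: real assume \<tau>: "\<tau> \<in> {0..1}"
      have "s * \<tau> \<le> s" using \<tau> s by (auto intro!: mult_left_le)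
      moreover have "0 \<le> s * \<tau>" using \<tau> s by auto
      ultimately have "-1 < s * \<tau>" "s * \<tau> < r + 1" using s by linarith+
      then have "(\<Phi> has_real_derivative (s * \<tau>) ^ n * G (s * \<tau>)) (at (s * \<tau>))"
        by (rule d\<Phi>)
      then have "((\<lambda>\<tau>. \<Phi> (s * \<tau>)) has_real_derivative s ^ Suc n * (\<tau> ^ n * G (s * \<tau>))) (at \<tau>)"
        by (rule DERIV_cong[OF DERIV_chain2]) (auto intro!: derivative_eq_intros simp: power_mult_distrib)
      then show "((\<lambda>\<tau>. \<Phi> (s * \<tau>)) has_vector_derivative s ^ Suc n * (\<tau> ^ n * G (s * \<tau>))) (at \<tau> within {0..1})"
        using has_field_derivative_at_within by (auto simp flip: has_real_derivative_iff_has_vector_derivative)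
    qed simp
    then show ?thesis by (simp add: integral_unique flip: integral_mult_right)
  qed
  have "((\<lambda>s. \<Phi> s - \<Phi> 0) has_real_derivative r ^ n * G r) (at r)"
    using d\<Phi>[of r] r by (auto intro!: derivative_eq_intros)
  then show ?thesis
    by (rule has_field_derivative_transform_within_open[where S = "{0<..<r+1}"]) (use r eq in auto)
qed

lemma scaled_average_continuous:
  fixes G :: "real \<Rightarrow> real"
  assumes G: "continuous_on UNIV G"
  shows "continuous_on UNIV (\<lambda>r. integral {0..1} (\<lambda>\<tau>. \<tau> ^ n * G (r * \<tau>)))"
proof -
  have "continuous_on (UNIV \<times> cbox 0 1) (\<lambda>(r, \<tau>). \<tau> ^ n * G (r * \<tau>))"
    unfolding case_prod_beta
    by (intro continuous_intros continuous_on_compose2[OF G]) auto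
  from integral_continuous_on_param[OF this] show ?thesis by simp
qed

lemma scaled_average_bound:
  fixes G :: "real \<Rightarrow> real"
  assumes G: "continuous_on UNIV G" and B: "\<And>\<tau>. 0 \<le> \<tau> \<Longrightarrow> \<tau> \<le> 1 \<Longrightarrow> \<bar>G (r * \<tau>)\<bar> \<le> B"
  shows "\<bar>integral {0..1} (\<lambda>\<tau>. \<tau> ^ n * G (r * \<tau>))\<bar> \<le> B"
proof -
  have "norm (integral {0..1} (\<lambda>\<tau>. \<tau> ^ n * G (r * \<tau>))) \<le> integral {0..1} (\<lambda>\<tau>::real. B)"
  proof (rule integral_norm_bound_integral)
    show "(\<lambda>\<tau>. \<tau> ^ n * G (r * \<tau>)) integrable_on {0..1}"
      by (intro integrable_continuous_real continuous_intros continuous_on_compose2[OF G]) auto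
    fix \<tau> :: real assume \<tau>: "\<tau> \<in> {0..1}"
    have "\<tau> ^ n * \<bar>G (r * \<tau>)\<bar> \<le> 1 * B"
      using \<tau> B[of \<tau>] by (intro mult_mono) (auto intro: power_le_one)
    then show "norm (\<tau> ^ n * G (r * \<tau>)) \<le> B" using \<tau> by (simp add: abs_mult)
  qed auto
  then show ?thesis by simp
qed

lemma scaled_gaussian_integral:
  fixes r L :: real
  assumes L: "0 < L"
  shows "((\<lambda>\<sigma>. r\<^sup>2 * (\<sigma> * exp (L * (r * \<sigma>)\<^sup>2))) has_integral (exp (L * r\<^sup>2) - 1) / (2 * L)) {0..1}"
proof -
  have "((\<lambda>\<sigma>. r\<^sup>2 * (\<sigma> * exp (L * (r * \<sigma>)\<^sup>2))) has_integral
      exp (L * (r * 1)\<^sup>2) / (2 * L) - exp (L * (r * 0)\<^sup>2) / (2 * L)) {0..1}"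
  proof (rule fundamental_theorem_of_calculus)
    fix x :: real
    have "((\<lambda>\<sigma>. exp (L * (r * \<sigma>)\<^sup>2) / (2 * L)) has_real_derivative r\<^sup>2 * (x * exp (L * (r * x)\<^sup>2))) (at x)"
      using L by (auto intro!: derivative_eq_intros simp: field_simps power2_eq_square)
    then show "((\<lambda>\<sigma>. exp (L * (r * \<sigma>)\<^sup>2) / (2 * L)) has_vector_derivative r\<^sup>2 * (x * exp (L * (r * x)\<^sup>2))) (at x within {0..1})"
      using has_field_derivative_at_within by (auto simp flip: has_real_derivative_iff_has_vector_derivative)
  qed simp
  then show ?thesis by (simp add: diff_divide_distrib)
qed

text \<open>Picard iteration in the weighted sup norm \<open>sup \<bar>u r\<bar> exp (- L r\<^sup>2)\<close>; since
  \<open>\<integral>\<^sub>0\<^sup>r s exp (L s\<^sup>2) ds \<le> exp (L r\<^sup>2) / (2 L)\<close>, it is a contraction on the whole line.\<close>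

lemma radial_exists_lipschitz:
  fixes g :: "real \<Rightarrow> real"
  assumes L: "L > 0" and lip: "\<And>s t. \<bar>g s - g t\<bar> \<le> L * \<bar>s - t\<bar>"
  shows "\<exists>u h. u 0 = b \<and> (\<forall>X. radial n g X u h)"
proof -
  define wt :: "real \<Rightarrow> real" where "wt r = exp (L * r\<^sup>2)" for r
  have wt: "1 \<le> wt r" "0 < wt r" for r using L by (simp_all add: wt_def)
  have wt_mono: "wt (r * \<tau>) \<le> wt r" if "0 \<le> \<tau>" "\<tau> \<le> 1" for r \<tau>
    unfolding wt_def using L that
    by (auto simp: power_mult_distrib intro!: mult_left_mono mult_left_le power_le_one)
  have wtc: "continuous_on A wt" for A unfolding wt_def by (intro continuous_intros)
  have "L-lipschitz_on UNIV g"
    using lip L by (intro lipschitz_onI) (auto simp: dist_real_def)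
  then have gc: "continuous_on UNIV g" by (rule lipschitz_on_continuous_on)
  \<comment> \<open>The unknown is \<open>v = u / wt\<close>, which lies in the space of bounded
    continuous functions although \<open>u\<close> itself may be unbounded; \<open>G v\<close> is
    \<open>g\<close> applied to \<open>u\<close>.\<close>
  define G :: "(real \<Rightarrow>\<^sub>C real) \<Rightarrow> real \<Rightarrow> real" where "G v s = g (wt s * apply_bcontfun v s)" for v s
  have Gc: "continuous_on UNIV (G v)" for v
    unfolding G_def
    by (intro continuous_on_compose2[OF gc] continuous_intros wtc) (auto intro: continuous_on_apply_bcontfun)
  define H where "H v s = integral {0..1} (\<lambda>\<tau>. \<tau> ^ n * G v (s * \<tau>))" for v s
  have Hc: "continuous_on UNIV (H v)" for v
    unfolding H_def by (rule scaled_average_continuous[OF Gc])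
  \<comment> \<open>The averaging operator with exponent one integrates \<open>s * H v s\<close>,
    which is the equation \<open>u' = r * h\<close>.\<close>
  define U where "U v r = b + r\<^sup>2 * integral {0..1} (\<lambda>\<sigma>. \<sigma> ^ 1 * H v (r * \<sigma>))" for v r
  have Uc: "continuous_on UNIV (U v)" for v
    unfolding U_def by (intro continuous_intros scaled_average_continuous[OF Hc])
  have int1: "(\<lambda>\<sigma>. r\<^sup>2 * (\<sigma> * F (r * \<sigma>))) integrable_on {0..1}"
    if "continuous_on UNIV F" for F :: "real \<Rightarrow> real" and r
    by (intro integrable_continuous_real continuous_intros continuous_on_compose2[OF that]) auto
  have intb: "\<bar>r\<^sup>2 * integral {0..1} (\<lambda>\<sigma>. \<sigma> * F (r * \<sigma>))\<bar> \<le> K / (2 * L) * wt r"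
    if F: "continuous_on UNIV F" and K: "0 \<le> K" and b: "\<And>s. \<bar>F s\<bar> \<le> K * wt s" for F r K
  proof -
    have "norm (integral {0..1} (\<lambda>\<sigma>. r\<^sup>2 * (\<sigma> * F (r * \<sigma>)))) \<le>
        integral {0..1} (\<lambda>\<sigma>. K * (r\<^sup>2 * (\<sigma> * exp (L * (r * \<sigma>)\<^sup>2))))"
    proof (rule integral_norm_bound_integral)
      show "(\<lambda>\<sigma>. K * (r\<^sup>2 * (\<sigma> * exp (L * (r * \<sigma>)\<^sup>2)))) integrable_on {0..1}"
        by (intro integrable_continuous_real continuous_intros)
      fix \<sigma> :: real assume "\<sigma> \<in> {0..1}"
      then have "r\<^sup>2 * (\<sigma> * \<bar>F (r * \<sigma>)\<bar>) \<le> r\<^sup>2 * (\<sigma> * (K * wt (r * \<sigma>)))"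
        using b by (intro mult_left_mono) auto
      then show "norm (r\<^sup>2 * (\<sigma> * F (r * \<sigma>))) \<le> K * (r\<^sup>2 * (\<sigma> * exp (L * (r * \<sigma>)\<^sup>2)))"
        using \<open>\<sigma> \<in> {0..1}\<close> by (simp add: abs_mult wt_def algebra_simps)
    qed (rule int1[OF F])
    also have "\<dots> = K * ((wt r - 1) / (2 * L))"
      using integral_unique[OF scaled_gaussian_integral[OF L, of r]] by (simp add: wt_def)
    also have "\<dots> \<le> K / (2 * L) * wt r" using K L by (simp add: field_simps)
    finally show ?thesis by simp
  qed
  have Gb: "\<bar>G v s\<bar> \<le> (\<bar>g 0\<bar> + L * norm v) * wt s" for v s
  proof -
    have "\<bar>G v s\<bar> \<le> \<bar>g 0\<bar> + L * \<bar>wt s * apply_bcontfun v s\<bar>"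
      using lip[of "wt s * apply_bcontfun v s" 0] by (simp add: G_def)
    also have "\<dots> \<le> \<bar>g 0\<bar> * wt s + L * (wt s * norm v)"
      using wt[of s] L norm_bounded[of v s]
      by (intro add_mono mult_left_mono) (auto simp: abs_mult mult_left_mono mult_le_cancel_left1)
    finally show ?thesis by (simp add: algebra_simps)
  qed
  have Gd: "\<bar>G v s - G v' s\<bar> \<le> L * dist v v' * wt s" for v v' s
  proof -
    have "\<bar>G v s - G v' s\<bar> \<le> L * \<bar>wt s * (apply_bcontfun v s - apply_bcontfun v' s)\<bar>"
      using lip[of "wt s * apply_bcontfun v s" "wt s * apply_bcontfun v' s"] by (simp add: G_def algebra_simps)
    also have "\<dots> \<le> L * (wt s * dist v v')"
      using wt[of s] L dist_bounded[of v s v'] by (auto simp: abs_mult dist_real_def)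
    finally show ?thesis by (simp add: algebra_simps)
  qed
  have avg: "\<bar>integral {0..1} (\<lambda>\<tau>. \<tau> ^ n * F (s * \<tau>))\<bar> \<le> K * wt s"
    if "continuous_on UNIV F" "0 \<le> K" "\<And>s. \<bar>F s\<bar> \<le> K * wt s" for F K s
  proof (rule scaled_average_bound[OF that(1)])
    fix \<tau> :: real assume "0 \<le> \<tau>" "\<tau> \<le> 1"
    then show "\<bar>F (s * \<tau>)\<bar> \<le> K * wt s"
      using that(3)[of "s * \<tau>"] mult_left_mono[OF wt_mono that(2), of \<tau> s] by linarith
  qed
  have Hb: "\<bar>H v s\<bar> \<le> (\<bar>g 0\<bar> + L * norm v) * wt s" for v s
    unfolding H_def using L by (intro avg Gc Gb) auto
  have Hd: "\<bar>H v s - H v' s\<bar> \<le> L * dist v v' * wt s" for v v' s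
  proof -
    have i: "(\<lambda>\<tau>. \<tau> ^ n * G v (s * \<tau>)) integrable_on {0..1}" for v
      by (intro integrable_continuous_real continuous_intros continuous_on_compose2[OF Gc]) auto
    have "H v s - H v' s = integral {0..1} (\<lambda>\<tau>. \<tau> ^ n * (G v (s * \<tau>) - G v' (s * \<tau>)))"
      unfolding H_def by (subst Henstock_Kurzweil_Integration.integral_diff[symmetric, OF i i]) (simp add: algebra_simps)
    moreover have "\<bar>\<dots>\<bar> \<le> L * dist v v' * wt s"
      by (rule avg[of "\<lambda>s. G v s - G v' s"]) (use L Gc Gd in \<open>auto intro!: continuous_intros\<close>)
    ultimately show ?thesis by simp
  qed
  have Ub: "\<bar>U v r / wt r\<bar> \<le> \<bar>b\<bar> + (\<bar>g 0\<bar> + L * norm v) / (2 * L)" for v r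
  proof -
    have "\<bar>U v r\<bar> \<le> \<bar>b\<bar> + (\<bar>g 0\<bar> + L * norm v) / (2 * L) * wt r"
      using intb[OF Hc _ Hb, of v r] L unfolding U_def by simp
    also have "\<dots> \<le> \<bar>b\<bar> * wt r + (\<bar>g 0\<bar> + L * norm v) / (2 * L) * wt r"
      using wt[of r] by (intro add_mono) (auto simp: mult_le_cancel_left1)
    finally show ?thesis using wt[of r] by (simp add: abs_divide field_simps)
  qed
  define T where "T v = Bcontfun (\<lambda>r. U v r / wt r)" for v
  have T: "apply_bcontfun (T v) r = U v r / wt r" for v r
  proof -
    have "(\<lambda>r. U v r / wt r) \<in> bcontfun"
    proof (rule bcontfun_normI)
      show "continuous_on UNIV (\<lambda>r. U v r / wt r)"
        using wt(2) by (intro continuous_intros Uc wtc) (metis less_irrefl)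
      show "norm (U v r / wt r) \<le> \<bar>b\<bar> + (\<bar>g 0\<bar> + L * norm v) / (2 * L)" for r
        using Ub by simp
    qed
    then show ?thesis by (simp add: T_def Bcontfun_inverse)
  qed
  have "\<exists>!v. T v = v"
  proof (rule banach_fix_type)
    \<comment> \<open>The contraction factor 1/2 is the Lipschitz constant \<open>L\<close> times
      the bound \<open>1 / (2 * L)\<close> in \<open>intb\<close>.\<close>
    show "\<forall>v v'. dist (T v) (T v') \<le> 1 / 2 * dist v v'"
    proof (intro allI dist_bound)
      fix v v' r
      have i: "(\<lambda>\<sigma>. \<sigma> * H v (r * \<sigma>)) integrable_on {0..1}" for v
        by (intro integrable_continuous_real continuous_intros continuous_on_compose2[OF Hc]) auto
      have "U v r - U v' r = r\<^sup>2 * integral {0..1} (\<lambda>\<sigma>. \<sigma> * (H v (r * \<sigma>) - H v' (r * \<sigma>)))"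
        unfolding U_def right_diff_distrib Henstock_Kurzweil_Integration.integral_diff[OF i i]
        by (simp add: right_diff_distrib)
      moreover have "\<bar>\<dots>\<bar> \<le> L * dist v v' / (2 * L) * wt r"
        by (rule intb[of "\<lambda>s. H v s - H v' s"]) (use L Hc Hd in \<open>auto intro!: continuous_intros\<close>)
      ultimately have "\<bar>U v r - U v' r\<bar> \<le> 1 / 2 * dist v v' * wt r" using L by simp
      then show "dist (apply_bcontfun (T v) r) (apply_bcontfun (T v') r) \<le> 1 / 2 * dist v v'"
        using wt[of r] by (simp add: T dist_real_def abs_divide flip: diff_divide_distrib) (simp add: field_simps)
    qed
  qed auto
  then obtain v where v: "T v = v" by blast
  define u where "u = U v"
  have Gu: "G v s = g (u s)" for s
    using T[of v s] wt(2)[of s] unfolding v G_def u_def by simp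
  have guc: "continuous_on UNIV (\<lambda>s. g (u s))" using Gc[of v] by (simp add: Gu)
  have "radial n g X u (H v)" for X
    unfolding radial_def
  proof (intro conjI allI impI)
    show "continuous_on {0..<X} u" "continuous_on {0..<X} (H v)"
      unfolding u_def using Uc Hc by (auto intro: continuous_on_subset)
  next
    fix r :: real assume r: "0 < r"
    show "(u has_real_derivative r * H v r) (at r)"
      unfolding u_def U_def
      using DERIV_add[OF DERIV_const[of b] scaled_average_derivative[OF Hc r, of 1]]
      by (simp add: numeral_2_eq_2)
    show "((\<lambda>s. s ^ Suc n * H v s) has_real_derivative r ^ n * g (u r)) (at r)"
      using scaled_average_derivative[OF guc r, where n = n] unfolding H_def Gu .
  qed
  moreover have "u 0 = b" by (simp add: u_def U_def)
  ultimately show ?thesis by blast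
qed

section \<open>Radial functions and the Laplacian\<close>

text \<open>Used at the origin, where the norm is not differentiable and the chain rule for radial
  functions breaks down.\<close>

lemma has_derivative_at_0I:
  fixes F :: "'a::euclidean_space \<Rightarrow> real" and e :: "real \<Rightarrow> real"
  assumes D: "bounded_linear D" and "0 < X" and e: "continuous_on {0..<X} e" "e 0 = 0"
    and F: "\<And>x. norm x < X \<Longrightarrow> \<bar>F x - F 0 - D x\<bar> \<le> e (norm x) * norm x"
  shows "(F has_derivative D) (at 0)"
  unfolding has_derivative_at_alt
proof (intro conjI allI impI D)
  fix \<epsilon> :: real assume "\<epsilon> > 0"
  then obtain d where d: "d > 0" "\<And>r. r \<in> {0..<X} \<Longrightarrow> dist r 0 < d \<Longrightarrow> dist (e r) (e 0) < \<epsilon>"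
    using e(1) \<open>0 < X\<close> unfolding continuous_on_iff by (metis atLeastLessThan_iff order_refl)
  show "\<exists>d>0. \<forall>y. norm (y - 0) < d \<longrightarrow> norm (F y - F 0 - D (y - 0)) \<le> \<epsilon> * norm (y - 0)"
  proof (intro exI[of _ "min d X"] conjI allI impI)
    fix y :: 'a assume y: "norm (y - 0) < min d X"
    then have "\<bar>F y - F 0 - D y\<bar> \<le> e (norm y) * norm y" using F by simp
    also have "\<dots> \<le> \<epsilon> * norm y"
      using d(2)[of "norm y"] y e(2) by (intro mult_right_mono) (auto simp: dist_real_def)
    finally show "norm (F y - F 0 - D (y - 0)) \<le> \<epsilon> * norm (y - 0)" by simp
  qed (use d \<open>0 < X\<close> in auto)
qed

lemma has_derivative_comp_norm:
  fixes x :: "'a::euclidean_space"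
  assumes "x \<noteq> 0" "(k has_real_derivative D) (at (norm x))"
  shows "((\<lambda>x. k (norm x)) has_derivative (\<lambda>y. D * (y \<bullet> x / norm x))) (at x)"
  using has_derivative_compose[OF has_derivative_norm[OF assms(1)], of k "(*) D"] assms(2)
  by (simp add: has_field_derivative_def sgn_div_norm divide_inverse mult.commute inner_commute)

lemma radial_deriv_h:
  assumes rad: "radial n f X u h" and r: "0 < r" "r < X"
  shows "(h has_real_derivative (f (u r) - real (Suc n) * h r) / r) (at r)"
proof -
  have "((\<lambda>s. s ^ Suc n * h s / s ^ Suc n) has_real_derivative (f (u r) - real (Suc n) * h r) / r) (at r)"
  proof (rule DERIV_cong[OF DERIV_divide[OF radialD(4)[OF rad r] DERIV_pow]])
    show "(r ^ n * f (u r) * r ^ Suc n - r ^ Suc n * h r * (real (Suc n) * r ^ (Suc n - Suc 0)))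
        / (r ^ Suc n * r ^ Suc n) = (f (u r) - real (Suc n) * h r) / r"
      using r by (simp add: divide_simps) (simp add: algebra_simps)
  qed (use r in auto)
  then show ?thesis
    by (rule has_field_derivative_transform_within_open[where S = "{0<..<X}"]) (use r in auto)
qed

lemma radial_gradient:
  fixes x :: "'a::euclidean_space"
  assumes rad: "radial n f X u h" and x: "norm x < X"
  shows "((\<lambda>x. u (norm x)) has_derivative (\<lambda>y. h (norm x) * (y \<bullet> x))) (at x)"
proof (cases "x = 0")
  case False
  have "((\<lambda>x. u (norm x)) has_derivative (\<lambda>y. norm x * h (norm x) * (y \<bullet> x / norm x))) (at x)"
    by (rule has_derivative_comp_norm[OF False radialD(3)[OF rad]]) (use False x in auto)
  then show ?thesis using False by simp
next
  case True
  define Y where "Y = X / 2"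
  have Y: "0 < Y" "Y < X" using x True by (auto simp: Y_def)
  have "compact (h ` {0..Y})"
    by (intro compact_continuous_image continuous_on_subset[OF radialD(2)[OF rad]]) (use Y in auto)
  then have "bounded (h ` {0..Y})" by (rule compact_imp_bounded)
  then obtain M where M: "\<And>r. r \<in> {0..Y} \<Longrightarrow> \<bar>h r\<bar> \<le> M"
    unfolding bounded_iff by fastforce
  have M0: "0 \<le> M" using M[of 0] Y by auto
  have "((\<lambda>x. u (norm x)) has_derivative (\<lambda>y. 0)) (at (0::'a))"
  proof (rule has_derivative_at_0I[where X = Y and e = "\<lambda>r. M * r"])
    fix z :: 'a assume z: "norm z < Y"
    show "\<bar>u (norm z) - u (norm (0::'a)) - 0\<bar> \<le> M * norm z * norm z"
    proof (cases "z = 0")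
      case False
      have "\<exists>l \<xi>. 0 < \<xi> \<and> \<xi> < norm z \<and> (u has_real_derivative l) (at \<xi>) \<and> u (norm z) - u 0 = (norm z - 0) * l"
      proof (rule MVT)
        show "continuous_on {0..norm z} u"
          by (rule continuous_on_subset[OF radialD(1)[OF rad]]) (use z Y in auto)
        fix s assume "0 < s" "s < norm z"
        then show "u differentiable (at s)"
          using radialD(3)[OF rad, of s] z Y unfolding real_differentiable_def by auto
      qed (use False in auto)
      then obtain l \<xi> where \<xi>: "0 < \<xi>" "\<xi> < norm z" "(u has_real_derivative l) (at \<xi>)" "u (norm z) - u 0 = norm z * l"
        by auto
      have "l = \<xi> * h \<xi>" using DERIV_unique[OF \<xi>(3) radialD(3)[OF rad]] \<xi> z Y by simp
      moreover have "\<xi> * \<bar>h \<xi>\<bar> \<le> norm z * M" using M[of \<xi>] \<xi> z by (intro mult_mono) auto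
      ultimately have "\<bar>l\<bar> \<le> norm z * M" using \<xi> by (simp add: abs_mult)
      then have "norm z * \<bar>l\<bar> \<le> norm z * (norm z * M)" by (rule mult_left_mono) simp
      then show ?thesis using \<xi> by (simp add: abs_mult mult_ac)
    qed simp
  qed (use Y in \<open>auto intro!: continuous_intros\<close>)
  then show ?thesis using True by simp
qed

text \<open>The gradient is \<open>h (norm x)\<close> times \<open>x\<close>, so these are the
  second derivatives. The rank-one term carries the factor \<open>y \<bullet> x\<close>; at the
  origin it is zero and only \<open>h 0 * (b \<bullet> y)\<close> remains.\<close>

lemma radial_hessian:
  fixes x b :: "'a::euclidean_space"
  assumes rad: "radial n f X u h" and x: "norm x < X"
  shows "((\<lambda>x. h (norm x) * (b \<bullet> x)) has_derivative
    (\<lambda>y. (f (u (norm x)) - real (Suc n) * h (norm x)) / (norm x)\<^sup>2 * (y \<bullet> x) * (b \<bullet> x) + h (norm x) * (b \<bullet> y))) (at x)"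
proof (cases "x = 0")
  case False
  define D where "D = (f (u (norm x)) - real (Suc n) * h (norm x)) / norm x"
  have "(h has_real_derivative D) (at (norm x))"
    unfolding D_def by (rule radial_deriv_h[OF rad]) (use False x in auto)
  from has_derivative_comp_norm[OF False this]
  have "((\<lambda>x. h (norm x) * (b \<bullet> x)) has_derivative
      (\<lambda>y. h (norm x) * (b \<bullet> y) + D * (y \<bullet> x / norm x) * (b \<bullet> x))) (at x)"
    by (rule has_derivative_mult) (auto intro!: derivative_eq_intros)
  then show ?thesis
    by (rule has_derivative_eq_rhs) (simp add: D_def fun_eq_iff power2_eq_square mult_ac)
next
  case True
  have "((\<lambda>x. h (norm x) * (b \<bullet> x)) has_derivative (\<lambda>y. h 0 * (b \<bullet> y))) (at (0::'a))"
  proof (rule has_derivative_at_0I[where X = X and e = "\<lambda>r. \<bar>h r - h 0\<bar> * norm b"])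
    show "bounded_linear (\<lambda>y. h 0 * (b \<bullet> y))" by (intro bounded_linear_intros)
    fix z :: 'a
    have "\<bar>(h (norm z) - h 0) * (b \<bullet> z)\<bar> \<le> \<bar>h (norm z) - h 0\<bar> * (norm b * norm z)"
      unfolding abs_mult by (intro mult_left_mono Cauchy_Schwarz_ineq2) auto
    then show "\<bar>h (norm z) * (b \<bullet> z) - h (norm (0::'a)) * (b \<bullet> 0) - h 0 * (b \<bullet> z)\<bar>
        \<le> \<bar>h (norm z) - h 0\<bar> * norm b * norm z"
      by (simp add: algebra_simps)
  qed (use x True radialD(2)[OF rad] in \<open>auto intro!: continuous_intros\<close>)
  then show ?thesis using True by simp
qed

lemma partial_deriv_eqI:
  assumes "(u has_derivative D) (at x)"
  shows "partial_deriv b u x = D b"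
  unfolding partial_deriv_def using frechet_derivative_at[OF assms] by simp

text \<open>By Cauchy-Schwarz the expression is bounded by \<open>\<bar>k (norm x)\<bar>\<close> up
  to a constant, so continuity at the origin comes down to \<open>k 0 = 0\<close>, which
  \<open>radial_at_0\<close> supplies for \<open>k = f(u) - (n + 1) h\<close>.\<close>

lemma continuous_on_radial_bilinear:
  fixes b c :: "'a::euclidean_space" and k :: "real \<Rightarrow> real"
  assumes k: "continuous_on {0..<X} k" "k 0 = 0"
  shows "continuous_on (ball 0 X) (\<lambda>x. k (norm x) / (norm x)\<^sup>2 * (c \<bullet> x) * (b \<bullet> x))"
    (is "continuous_on _ ?A")
proof (rule continuous_at_imp_continuous_on, rule ballI)
  fix x :: 'a assume x: "x \<in> ball 0 X"
  have kn: "continuous_on (ball 0 X) (\<lambda>x::'a. k (norm x))"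
    by (intro continuous_on_compose2[OF k(1)] continuous_intros) auto
  show "isCont ?A x"
  proof (cases "x = 0")
    case False
    have "continuous_on (ball 0 X - {0}) ?A"
      by (intro continuous_intros continuous_on_subset[OF kn]) auto
    then show ?thesis
      by (rule continuous_on_interior) (use x False in \<open>simp add: interior_open open_Diff\<close>)
  next
    case True
    have "isCont (\<lambda>x::'a. k (norm x)) 0"
      by (rule continuous_on_interior[OF kn]) (use x True in \<open>simp add: interior_open\<close>)
    then have "((\<lambda>x::'a. k (norm x)) \<longlongrightarrow> k (norm (0::'a))) (at 0)"
      by (simp only: isCont_def)
    then have "((\<lambda>x::'a. \<bar>k (norm x)\<bar> * (norm c * norm b)) \<longlongrightarrow> 0) (at 0)"
      using k(2) by (auto intro!: tendsto_eq_intros)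
    then have "(?A \<longlongrightarrow> 0) (at 0)"
    proof (rule Lim_null_comparison[rotated])
      have "norm (?A y) \<le> \<bar>k (norm y)\<bar> * (norm c * norm b)" for y
      proof (cases "y = 0")
        case False
        have "\<bar>c \<bullet> y\<bar> * \<bar>b \<bullet> y\<bar> \<le> (norm c * norm y) * (norm b * norm y)"
          by (intro mult_mono Cauchy_Schwarz_ineq2) auto
        then have "\<bar>k (norm y)\<bar> * (\<bar>c \<bullet> y\<bar> * \<bar>b \<bullet> y\<bar>) \<le> \<bar>k (norm y)\<bar> * ((norm c * norm y) * (norm b * norm y))"
          by (intro mult_left_mono) auto
        then have "\<bar>k (norm y)\<bar> * (\<bar>c \<bullet> y\<bar> * \<bar>b \<bullet> y\<bar>) / (norm y)\<^sup>2
            \<le> \<bar>k (norm y)\<bar> * ((norm c * norm y) * (norm b * norm y)) / (norm y)\<^sup>2"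
          by (rule divide_right_mono) simp
        also have "\<dots> = \<bar>k (norm y)\<bar> * (norm c * norm b)"
          using False by (simp add: power2_eq_square)
        finally show ?thesis by (simp add: abs_mult mult.assoc)
      qed simp
      then show "\<forall>\<^sub>F y in at 0. norm (?A y) \<le> \<bar>k (norm y)\<bar> * (norm c * norm b)" by simp
    qed
    then show ?thesis using True by (simp add: isCont_def)
  qed
qed

lemma radial_C2:
  fixes f :: "real \<Rightarrow> real"
  assumes rad: "radial n f X u h" and f: "continuous_on UNIV f"
    and dim: "DIM('a::euclidean_space) = Suc n"
  shows "C2_on (ball (0::'a) X) (\<lambda>x. u (norm x))"
    and "\<And>x::'a. norm x < X \<Longrightarrow> laplacian (\<lambda>x. u (norm x)) x = f (u (norm x))"
proof -
  let ?u = "\<lambda>x::'a. u (norm x)"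
  define k where "k r = f (u r) - real (Suc n) * h r" for r
  have p1: "partial_deriv b ?u x = h (norm x) * (b \<bullet> x)" if "x \<in> ball 0 X" for b x :: 'a
    using partial_deriv_eqI[OF radial_gradient[OF rad]] that by auto
  have d2: "(partial_deriv b ?u has_derivative
      (\<lambda>y. k (norm x) / (norm x)\<^sup>2 * (y \<bullet> x) * (b \<bullet> x) + h (norm x) * (b \<bullet> y))) (at x)"
    if x: "x \<in> ball 0 X" for b x :: 'a
    using has_derivative_transform_within_open[OF radial_hessian[OF rad, of x b] open_ball x] p1 x
    by (simp add: k_def)
  have p2: "partial_deriv c (partial_deriv b ?u) x
      = k (norm x) / (norm x)\<^sup>2 * (c \<bullet> x) * (b \<bullet> x) + h (norm x) * (b \<bullet> c)"
    if x: "x \<in> ball 0 X" for b c x :: 'a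
    using partial_deriv_eqI[OF d2[OF x]] .
  have hn: "continuous_on (ball 0 X) (\<lambda>x::'a. h (norm x))"
    by (intro continuous_on_compose2[OF radialD(2)[OF rad]] continuous_intros) auto
  have k0: "k 0 = 0" if "0 < X" using radial_at_0[OF rad that f] by (simp add: k_def)
  have kc: "continuous_on {0..<X} k"
    unfolding k_def
    by (intro continuous_intros continuous_on_compose2[OF f] radialD(1,2)[OF rad]) auto
  have c1: "continuous_on (ball 0 X) (partial_deriv b ?u)" for b :: 'a
    by (rule continuous_on_eq[where f = "\<lambda>x. h (norm x) * (b \<bullet> x)"])
       (auto intro!: continuous_intros hn simp: p1)
  have c2: "continuous_on (ball 0 X) (partial_deriv c (partial_deriv b ?u))" for b c :: 'a
  proof (cases "0 < X")
    case True
    have "continuous_on (ball 0 X) (\<lambda>x. k (norm x) / (norm x)\<^sup>2 * (c \<bullet> x) * (b \<bullet> x) + h (norm x) * (b \<bullet> c))"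
      by (intro continuous_on_add continuous_on_radial_bilinear kc k0 True continuous_on_mult hn continuous_on_const)
    then show ?thesis by (rule continuous_on_eq) (simp only: p2)
  qed (simp add: ball_empty not_less)
  show "C2_on (ball 0 X) ?u"
    unfolding C2_on_def C1_on_def
  proof (intro conjI ballI c1 c2)
    show "?u differentiable at x" if "x \<in> ball 0 X" for x
      using radial_gradient[OF rad, of x] that by (auto simp: differentiable_def)
    show "partial_deriv b ?u differentiable at x" if "x \<in> ball 0 X" for b x
      using d2[OF that] by (auto simp: differentiable_def)
  qed
  fix x :: 'a assume x: "norm x < X"
  then have X: "0 < X" using norm_ge_zero[of x] by linarith
  have sq: "(\<Sum>b\<in>Basis. (b \<bullet> x) * (b \<bullet> x)) = (norm x)\<^sup>2"
    unfolding power2_norm_eq_inner euclidean_inner[of x x] by (simp add: inner_commute)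
  have "laplacian ?u x = (\<Sum>b\<in>Basis. k (norm x) / (norm x)\<^sup>2 * ((b \<bullet> x) * (b \<bullet> x)) + h (norm x))"
    unfolding laplacian_def using x by (intro sum.cong refl) (simp add: p2 inner_Basis)
  also have "\<dots> = k (norm x) / (norm x)\<^sup>2 * (norm x)\<^sup>2 + real (Suc n) * h (norm x)"
    by (simp only: sum.distrib sum_distrib_left[symmetric] sq sum_constant dim)
  also have "\<dots> = f (u (norm x))"
    using k0[OF X] by (cases "x = 0") (auto simp: k_def)
  finally show "laplacian ?u x = f (u (norm x))" .
qed

section \<open>The second-order condition at an interior maximum\<close>

lemma partial_deriv_line:
  fixes w :: "'a::euclidean_space \<Rightarrow> real"
  assumes "w differentiable (at (x + t *\<^sub>R b))"
  shows "((\<lambda>s. w (x + s *\<^sub>R b)) has_real_derivative partial_deriv b w (x + t *\<^sub>R b)) (at t)"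
proof -
  have "(w has_derivative frechet_derivative w (at (x + t *\<^sub>R b))) (at (x + t *\<^sub>R b))"
    using assms frechet_derivative_works by blast
  moreover have "((\<lambda>s. x + s *\<^sub>R b) has_derivative (\<lambda>s. s *\<^sub>R b)) (at t)"
    by (auto intro!: derivative_eq_intros)
  ultimately have "((\<lambda>s. w (x + s *\<^sub>R b)) has_derivative (\<lambda>s. frechet_derivative w (at (x + t *\<^sub>R b)) (s *\<^sub>R b))) (at t)"
    using has_derivative_compose by blast
  moreover have "linear (frechet_derivative w (at (x + t *\<^sub>R b)))"
    using assms linear_frechet_derivative by blast
  ultimately show ?thesis
    by (simp add: has_field_derivative_def partial_deriv_def linear_cmul mult.commute[of _ "frechet_derivative _ _ _"])
qed

text \<open>If \<open>D\<close> were positive, \<open>g'\<close> would be positive just to the right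
  of its zero at \<open>0\<close>, and \<open>g\<close> would rise above \<open>g 0\<close>.\<close>

lemma second_derivative_at_max:
  fixes g g' :: "real \<Rightarrow> real"
  assumes "0 < d" and g: "\<And>t. \<bar>t\<bar> < d \<Longrightarrow> (g has_real_derivative g' t) (at t)"
    and g': "(g' has_real_derivative D) (at 0)" and max: "\<And>t. \<bar>t\<bar> < d \<Longrightarrow> g t \<le> g 0"
  shows "D \<le> 0"
proof (rule ccontr)
  assume "\<not> D \<le> 0"
  then obtain e where e: "e > 0" "\<And>h. 0 < h \<Longrightarrow> h < e \<Longrightarrow> g' 0 < g' (0 + h)"
    using DERIV_pos_inc_right[OF g'] by auto
  have g0: "g' 0 = 0"
    by (rule DERIV_local_max[OF g[of 0] \<open>0 < d\<close>]) (use assms in auto)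
  define t where "t = min d e / 2"
  have t: "0 < t" "t < d" "t < e" using \<open>0 < d\<close> \<open>0 < e\<close> by (auto simp: t_def)
  have "g 0 < g t"
    by (rule DERIV_pos_imp_increasing_open[OF t(1)])
       (use t g e(2) g0 in \<open>auto 0 3 intro!: DERIV_continuous_on[of _ g g'] has_field_derivative_at_within[OF g]\<close>)
  then show False using max[of t] t by auto
qed

text \<open>Three functions with free coefficients are what touching \<open>v - u\<close> by a
  multiple of a positive profile requires. Stating the result for them keeps the combination itself
  out of \<open>C2_on\<close> and \<open>laplacian\<close>.\<close>

lemma laplacian_at_local_max:
  fixes w1 w2 w3 :: "'a::euclidean_space \<Rightarrow> real"
  assumes "open \<Omega>" "x \<in> \<Omega>" and C2: "C2_on \<Omega> w1" "C2_on \<Omega> w2" "C2_on \<Omega> w3"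
    and max: "\<And>y. y \<in> \<Omega> \<Longrightarrow> \<alpha> * w1 y + \<beta> * w2 y + \<gamma> * w3 y \<le> \<alpha> * w1 x + \<beta> * w2 x + \<gamma> * w3 x"
  shows "\<alpha> * laplacian w1 x + \<beta> * laplacian w2 x + \<gamma> * laplacian w3 x \<le> 0"
proof -
  obtain d where d: "d > 0" "ball x d \<subseteq> \<Omega>" using assms(1,2) openE by blast
  have "\<alpha> * partial_deriv b (partial_deriv b w1) x + \<beta> * partial_deriv b (partial_deriv b w2) x
      + \<gamma> * partial_deriv b (partial_deriv b w3) x \<le> 0" if b: "b \<in> Basis" for b
  proof (rule second_derivative_at_max[OF d(1)])
    have line: "((\<lambda>s. w (x + s *\<^sub>R b)) has_real_derivative partial_deriv b w (x + t *\<^sub>R b)) (at t)"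
      if "C1_on \<Omega> w" "\<bar>t\<bar> < d" for w t
    proof (rule partial_deriv_line)
      have "x + t *\<^sub>R b \<in> ball x d" using that b by (simp add: dist_norm)
      then show "w differentiable at (x + t *\<^sub>R b)" using that d(2) by (auto simp: C1_on_def)
    qed
    have C1: "C1_on \<Omega> w1" "C1_on \<Omega> w2" "C1_on \<Omega> w3"
      "C1_on \<Omega> (partial_deriv b w1)" "C1_on \<Omega> (partial_deriv b w2)" "C1_on \<Omega> (partial_deriv b w3)"
      using C2 b by (auto simp: C2_on_def)
    show "((\<lambda>t. \<alpha> * w1 (x + t *\<^sub>R b) + \<beta> * w2 (x + t *\<^sub>R b) + \<gamma> * w3 (x + t *\<^sub>R b)) has_real_derivative
        \<alpha> * partial_deriv b w1 (x + t *\<^sub>R b) + \<beta> * partial_deriv b w2 (x + t *\<^sub>R b)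
        + \<gamma> * partial_deriv b w3 (x + t *\<^sub>R b)) (at t)" if "\<bar>t\<bar> < d" for t
      using line[OF C1(1) that] line[OF C1(2) that] line[OF C1(3) that]
      by (auto intro!: derivative_eq_intros)
    show "((\<lambda>t. \<alpha> * partial_deriv b w1 (x + t *\<^sub>R b) + \<beta> * partial_deriv b w2 (x + t *\<^sub>R b)
        + \<gamma> * partial_deriv b w3 (x + t *\<^sub>R b)) has_real_derivative
        \<alpha> * partial_deriv b (partial_deriv b w1) x + \<beta> * partial_deriv b (partial_deriv b w2) x
        + \<gamma> * partial_deriv b (partial_deriv b w3) x) (at 0)"
      using line[OF C1(4), of 0] line[OF C1(5), of 0] line[OF C1(6), of 0] d
      by (auto intro!: derivative_eq_intros)
    show "\<alpha> * w1 (x + t *\<^sub>R b) + \<beta> * w2 (x + t *\<^sub>R b) + \<gamma> * w3 (x + t *\<^sub>R b)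
        \<le> \<alpha> * w1 (x + 0 *\<^sub>R b) + \<beta> * w2 (x + 0 *\<^sub>R b) + \<gamma> * w3 (x + 0 *\<^sub>R b)" if "\<bar>t\<bar> < d" for t
    proof -
      have "x + t *\<^sub>R b \<in> ball x d" using that b by (simp add: dist_norm)
      then show ?thesis using max d(2) by auto
    qed
  qed
  then have "(\<Sum>b\<in>Basis. \<alpha> * partial_deriv b (partial_deriv b w1) x + \<beta> * partial_deriv b (partial_deriv b w2) x
      + \<gamma> * partial_deriv b (partial_deriv b w3) x) \<le> 0"
    by (rule sum_nonpos)
  then show ?thesis
    by (simp add: laplacian_def sum.distrib sum_distrib_left)
qed

section \<open>The Dirichlet eigenvalue of the ball\<close>

text \<open>Dilation turns one Dirichlet profile into profiles for balls of every radius, with the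
  eigenvalue multiplied by \<open>\<kappa>\<^sup>2\<close>.\<close>

lemma radial_scale:
  assumes rad: "radial n f X u h" and \<kappa>: "0 < \<kappa>"
  shows "radial n (\<lambda>t. \<kappa>\<^sup>2 * f t) (X / \<kappa>) (\<lambda>r. u (\<kappa> * r)) (\<lambda>r. \<kappa>\<^sup>2 * h (\<kappa> * r))"
  unfolding radial_def
proof (intro conjI allI impI)
  have sub: "(\<lambda>r. \<kappa> * r) ` {0..<X / \<kappa>} \<subseteq> {0..<X}" using \<kappa> by (auto simp: field_simps)
  show "continuous_on {0..<X / \<kappa>} (\<lambda>r. u (\<kappa> * r))"
    by (rule continuous_on_compose2[OF radialD(1)[OF rad] _ sub]) (intro continuous_intros)
  show "continuous_on {0..<X / \<kappa>} (\<lambda>r. \<kappa>\<^sup>2 * h (\<kappa> * r))"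
    by (intro continuous_on_mult continuous_on_const continuous_on_compose2[OF radialD(2)[OF rad] _ sub])
       (intro continuous_intros)
next
  fix r assume r: "0 < r" "r < X / \<kappa>"
  then have \<kappa>r: "0 < \<kappa> * r" "\<kappa> * r < X" using \<kappa> by (auto simp: field_simps)
  have m: "((\<lambda>r. \<kappa> * r) has_real_derivative \<kappa>) (at r)"
    by (auto intro!: derivative_eq_intros)
  show "((\<lambda>r. u (\<kappa> * r)) has_real_derivative r * (\<kappa>\<^sup>2 * h (\<kappa> * r))) (at r)"
    using DERIV_chain2[OF radialD(3)[OF rad \<kappa>r] m] by (simp add: power2_eq_square mult_ac)
  have "((\<lambda>s. \<kappa>\<^sup>2 / \<kappa> ^ Suc n * ((\<kappa> * s) ^ Suc n * h (\<kappa> * s))) has_real_derivative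
      \<kappa>\<^sup>2 / \<kappa> ^ Suc n * ((\<kappa> * r) ^ n * f (u (\<kappa> * r)) * \<kappa>)) (at r)"
    by (rule DERIV_cmult[OF DERIV_chain2[OF radialD(4)[OF rad \<kappa>r] m]])
  then show "((\<lambda>s. s ^ Suc n * (\<kappa>\<^sup>2 * h (\<kappa> * s))) has_real_derivative r ^ n * (\<kappa>\<^sup>2 * f (u (\<kappa> * r)))) (at r)"
    using \<kappa> by (simp add: power_mult_distrib field_simps)
qed

lemma first_zero:
  fixes w :: "real \<Rightarrow> real"
  assumes w: "continuous_on {0..b} w" and "0 < w 0" "0 \<le> b" "w b \<le> 0"
  obtains s where "0 < s" "s \<le> b" "w s = 0" "\<And>r. 0 \<le> r \<Longrightarrow> r < s \<Longrightarrow> 0 < w r"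
proof -
  have ivt: "\<exists>s\<ge>0. s \<le> r \<and> w s = 0" if "0 \<le> r" "r \<le> b" "w r \<le> 0" for r
    by (rule IVT2') (use assms that in \<open>auto intro: continuous_on_subset[OF w]\<close>)
  have ne: "{0..b} \<inter> w -` {0} \<noteq> {}" using ivt[of b] assms by auto
  have "closed ({0..b} \<inter> w -` {0})" by (intro continuous_closed_preimage w) auto
  then have "compact ({0..b} \<inter> w -` {0})"
    by (meson bounded_Int bounded_closed_interval compact_eq_bounded_closed)
  from compact_attains_inf[OF this ne]
  obtain s where s: "0 \<le> s" "s \<le> b" "w s = 0" and least: "\<And>r. 0 \<le> r \<Longrightarrow> r \<le> b \<Longrightarrow> w r = 0 \<Longrightarrow> s \<le> r"
    by auto
  show ?thesis
  proof
    show "0 < s" using s assms(2) by (cases "s = 0") auto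
    fix r assume r: "0 \<le> r" "r < s"
    show "0 < w r"
    proof (rule ccontr)
      assume "\<not> 0 < w r"
      then obtain t where "0 \<le> t" "t \<le> r" "w t = 0" using ivt[of r] r s by auto
      then show False using least[of t] r s by auto
    qed
  qed (use s in auto)
qed

text \<open>The Dirichlet profile reaches zero: otherwise its Wronskian with \<open>(X\<^sup>2 - r\<^sup>2)\<^sup>2\<close>, which
  vanishes at both ends of \<open>[0, X]\<close>, would be strictly increasing when \<open>X = n + 3\<close>.\<close>

lemma radial_eigenfunction:
  "\<exists>J h j. J 0 = 1 \<and> (\<forall>X. radial n (\<lambda>t. - t) X J h) \<and> 0 < j \<and> J j = 0 \<and>
     (\<forall>r. 0 \<le> r \<longrightarrow> r < j \<longrightarrow> 0 < J r)"
proof -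
  obtain J h where J0: "J 0 = 1" and rad: "\<And>X. radial n (\<lambda>t. - t) X J h"
    using radial_exists_lipschitz[of 1 "\<lambda>t. - t" 1 n] by (auto simp: abs_minus_commute)
  define X where "X = real n + 3"
  have X: "X > 0" by (simp add: X_def)
  have Jc: "continuous_on {0..X} J" and hc: "continuous_on {0..X} h"
    using radialD(1,2)[OF rad[of "X + 1"]] by (auto intro: continuous_on_subset)
  have "\<exists>r\<in>{0..X}. J r = 0"
  proof (rule ccontr)
    assume "\<not> ?thesis"
    have pos: "J r > 0" if r: "0 \<le> r" "r \<le> X" for r
    proof (rule ccontr)
      assume neg: "\<not> J r > 0"
      have c: "continuous_on {0..r} J" using r by (auto intro: continuous_on_subset[OF Jc])
      obtain s where "0 < s" "s \<le> r" "J s = 0"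
        by (rule first_zero[OF c]) (use r J0 neg in auto)
      then show False using \<open>\<not> (\<exists>r\<in>{0..X}. J r = 0)\<close> r by auto
    qed
    define W where "W r = J r * (- 4 * r ^ Suc n * (X\<^sup>2 - r\<^sup>2)) - (X\<^sup>2 - r\<^sup>2)\<^sup>2 * (r ^ Suc n * h r)" for r
    have "W 0 < W X"
    proof (rule DERIV_pos_imp_increasing_open[OF X])
      fix r assume r: "0 < r" "r < X"
      \<comment> \<open>With \<open>t = X\<^sup>2 - r\<^sup>2\<close> the left side is
        \<open>t\<^sup>2 - 4 (n + 3) t + 8 X\<^sup>2\<close>; the choice \<open>X = n + 3\<close>
        makes the linear coefficient \<open>4 X\<close> and completes the square.\<close>
      have id: "((X\<^sup>2 - r\<^sup>2)\<^sup>2 - 4 * (real n + 1) * (X\<^sup>2 - r\<^sup>2) + 8 * r\<^sup>2) = ((X\<^sup>2 - r\<^sup>2) - 2 * X)\<^sup>2 + 4 * X\<^sup>2"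
        unfolding X_def by (simp add: power2_eq_square algebra_simps)
      have "(W has_real_derivative
          J r * r ^ n * ((X\<^sup>2 - r\<^sup>2)\<^sup>2 - 4 * (real n + 1) * (X\<^sup>2 - r\<^sup>2) + 8 * r\<^sup>2)) (at r)"
        unfolding W_def
        by (rule DERIV_cong,
            (rule DERIV_diff DERIV_mult radialD(3)[OF rad] radialD(4)[OF rad] DERIV_cmult DERIV_pow DERIV_const DERIV_power r lessI less_add_one)+)
           (simp add: algebra_simps power2_eq_square)
      moreover have "0 < J r * r ^ n * ((X\<^sup>2 - r\<^sup>2 - 2 * X)\<^sup>2 + 4 * X\<^sup>2)"
        using pos[of r] r X by (intro mult_pos_pos add_nonneg_pos) auto
      ultimately show "\<exists>y. (W has_real_derivative y) (at r) \<and> 0 < y"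
        unfolding id by blast
    qed (auto simp: W_def[abs_def] intro!: continuous_intros Jc hc)
    then show False by (simp add: W_def)
  qed
  then obtain b where b: "0 \<le> b" "b \<le> X" "J b = 0" by auto
  have c: "continuous_on {0..b} J" using b by (auto intro: continuous_on_subset[OF Jc])
  obtain j where "0 < j" "J j = 0" "\<And>r. 0 \<le> r \<Longrightarrow> r < j \<Longrightarrow> 0 < J r"
    by (rule first_zero[OF c]) (use b J0 in auto)
  then show ?thesis using J0 rad by blast
qed

lemma C2_on_subset:
  assumes "C2_on \<Omega> u" "\<Omega>' \<subseteq> \<Omega>"
  shows "C2_on \<Omega>' u"
proof -
  have "C1_on \<Omega>' w" if "C1_on \<Omega> w" for w
    using that assms(2) continuous_on_subset[of \<Omega> _ \<Omega>'] unfolding C1_on_def by blast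
  then show ?thesis using assms(1) unfolding C2_on_def by blast
qed

lemma C2_on_imp_continuous_on:
  assumes "C2_on \<Omega> u"
  shows "continuous_on \<Omega> u"
  using assms unfolding C2_on_def C1_on_def
  by (meson continuous_at_imp_continuous_on differentiable_imp_continuous_within)

text \<open>\<open>m\<close> is the maximum of \<open>w / \<phi>\<close> over the closed ball. It is
  positive because of \<open>x1\<close>, hence not attained on the sphere, where \<open>w\<close> is
  nonpositive; so \<open>m * \<phi>\<close> touches \<open>w\<close> at an interior point.\<close>

lemma touching_from_above:
  fixes w \<phi> :: "'a::euclidean_space \<Rightarrow> real"
  assumes w: "continuous_on (cball 0 \<sigma>) w" and \<phi>: "continuous_on (cball 0 \<sigma>) \<phi>"
    and pos: "\<And>x. norm x \<le> \<sigma> \<Longrightarrow> 0 < \<phi> x" and bdry: "\<And>x. norm x = \<sigma> \<Longrightarrow> w x \<le> 0"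
    and x1: "norm x1 \<le> \<sigma>" "0 < w x1"
  obtains x m where "norm x < \<sigma>" "0 < m" "w x = m * \<phi> x" "\<And>y. norm y < \<sigma> \<Longrightarrow> w y \<le> m * \<phi> y"
proof -
  have "continuous_on (cball 0 \<sigma>) (\<lambda>x. w x / \<phi> x)"
    by (intro continuous_intros w \<phi>) (use pos in force)
  moreover have "cball 0 \<sigma> \<noteq> {}" using x1(1) norm_ge_zero[of x1] by (metis cball_eq_empty not_le order_trans)
  ultimately obtain x where x: "x \<in> cball 0 \<sigma>" "\<And>y. y \<in> cball 0 \<sigma> \<Longrightarrow> w y / \<phi> y \<le> w x / \<phi> x"
    using continuous_attains_sup[OF compact_cball, of 0 \<sigma> "\<lambda>x. w x / \<phi> x"] by blast
  define m where "m = w x / \<phi> x"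
  have \<phi>x: "0 < \<phi> x" using pos x by auto
  have "0 < w x1 / \<phi> x1" using pos x1 by auto
  also have "\<dots> \<le> m" unfolding m_def using x x1 by auto
  finally have m: "0 < m" .
  then have "0 < w x" using \<phi>x by (simp add: m_def zero_less_divide_iff)
  then have "norm x \<noteq> \<sigma>" using bdry by force
  then have "norm x < \<sigma>" using x by auto
  moreover have "w x = m * \<phi> x" using \<phi>x by (simp add: m_def)
  moreover have "w y \<le> m * \<phi> y" if "norm y < \<sigma>" for y
    using x(2)[of y] pos[of y] that unfolding m_def[symmetric] by (simp add: divide_le_eq)
  ultimately show ?thesis using that m by blast
qed

locale dirichlet_profile =
  fixes n :: nat and J hJ :: "real \<Rightarrow> real" and j :: real
  assumes J0: "J 0 = 1" and radial_J: "\<And>X. radial n (\<lambda>t. - t) X J hJ"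
    and j_pos: "0 < j" and J_j: "J j = 0" and J_pos: "\<And>r. 0 \<le> r \<Longrightarrow> r < j \<Longrightarrow> 0 < J r"
begin

lemma radial_J_scaled:
  assumes "0 < \<kappa>"
  shows "radial n (\<lambda>t. - (\<kappa>\<^sup>2 * t)) X (\<lambda>r. J (\<kappa> * r)) (\<lambda>r. \<kappa>\<^sup>2 * hJ (\<kappa> * r))"
  using radial_scale[OF radial_J[of "X * \<kappa>"] assms] assms by simp

lemma J_scaled_C2:
  fixes x :: "'a::euclidean_space"
  assumes "0 < \<kappa>" "DIM('a) = Suc n"
  shows "C2_on (ball 0 X) (\<lambda>x::'a. J (\<kappa> * norm x))"
    and "laplacian (\<lambda>x::'a. J (\<kappa> * norm x)) x = - (\<kappa>\<^sup>2 * J (\<kappa> * norm x))"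
proof -
  have c: "continuous_on UNIV (\<lambda>t::real. - (\<kappa>\<^sup>2 * t))" by (intro continuous_intros)
  note r = radial_C2[OF radial_J_scaled[OF assms(1)] c assms(2)]
  show "C2_on (ball 0 X) (\<lambda>x::'a. J (\<kappa> * norm x))" by (rule r(1))
  show "laplacian (\<lambda>x::'a. J (\<kappa> * norm x)) x = - (\<kappa>\<^sup>2 * J (\<kappa> * norm x))"
    by (rule r(2)[of x "norm x + 1"]) simp
qed

lemma J_scaled_continuous:
  assumes "0 < \<kappa>" "DIM('a::euclidean_space) = Suc n"
  shows "continuous_on A (\<lambda>x::'a. J (\<kappa> * norm x))"
proof -
  have "isCont (\<lambda>x::'a. J (\<kappa> * norm x)) x" for x
    by (rule continuous_on_interior[OF C2_on_imp_continuous_on[OF J_scaled_C2(1)[OF assms, of "norm x + 1"]]])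
       (simp add: interior_open)
  then show ?thesis by (simp add: continuous_at_imp_continuous_on)
qed

text \<open>If \<open>\<mu> < j\<^sup>2\<close>, some \<open>\<kappa> < j\<close> satisfies
  \<open>\<kappa>\<^sup>2 > \<mu>\<close>, and \<open>J (\<kappa> * norm x)\<close> is positive on
  the closed unit ball. A multiple of it touches the eigenfunction from above, and comparing
  Laplacians there gives \<open>\<kappa>\<^sup>2 \<le> \<mu>\<close>.\<close>

lemma dirichlet_eigenvalue_ge:
  assumes dim: "DIM('a::euclidean_space) = Suc n"
    and ev: "dirichlet_eigenvalue (ball (0::'a) 1) \<mu>"
  shows "j\<^sup>2 \<le> \<mu>"
proof (rule ccontr)
  assume lt: "\<not> j\<^sup>2 \<le> \<mu>"
  define \<kappa> where "\<kappa> = (if \<mu> < 0 then j / 2 else (sqrt \<mu> + j) / 2)"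
  have sq: "sqrt \<mu> < j" if "\<mu> \<ge> 0" using lt j_pos that by (simp add: real_less_lsqrt)
  have \<kappa>: "0 < \<kappa>" "\<kappa> < j"
    using sq j_pos real_sqrt_ge_zero[of \<mu>] by (auto simp: \<kappa>_def not_less intro!: add_nonneg_pos)
  have \<kappa>\<mu>: "\<mu> < \<kappa>\<^sup>2"
  proof (cases "\<mu> < 0")
    case True then show ?thesis by (meson less_le_trans zero_le_power2)
  next
    case False
    then have "sqrt \<mu> < \<kappa>" using sq by (simp add: \<kappa>_def)
    then have "(sqrt \<mu>)\<^sup>2 < \<kappa>\<^sup>2" using False by (intro power_strict_mono) auto
    then show ?thesis using False by simp
  qed
  let ?\<phi> = "\<lambda>x::'a. J (\<kappa> * norm x)"
  obtain \<psi> where "C2_on (ball (0::'a) 1) \<psi> \<and> continuous_on (closure (ball 0 1)) \<psi> \<and>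
      (\<forall>x\<in>ball 0 1. - laplacian \<psi> x = \<mu> * \<psi> x) \<and> (\<forall>x\<in>frontier (ball 0 1). \<psi> x = 0) \<and>
      (\<exists>x\<in>ball 0 1. \<psi> x \<noteq> 0)"
    using ev unfolding dirichlet_eigenvalue_def by blast
  then have \<psi>: "C2_on (ball 0 1) \<psi>" "continuous_on (cball 0 1) \<psi>"
    "\<And>x. norm x < 1 \<Longrightarrow> - laplacian \<psi> x = \<mu> * \<psi> x" "\<And>x. norm x = 1 \<Longrightarrow> \<psi> x = 0"
    and nz: "\<exists>x. norm x < 1 \<and> \<psi> x \<noteq> 0"
    by auto
  \<comment> \<open>An eigenfunction may be nonpositive everywhere; the factor \<open>e\<close>
    makes \<open>e * \<psi>\<close> positive somewhere.\<close>
  obtain x1 e where x1: "norm x1 < 1" "0 < e * \<psi> x1" "e \<noteq> 0"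
    using nz by (metis mult_pos_pos mult_neg_neg linorder_neqE_linordered_idom zero_less_one neg_less_0_iff_less)
  have pos: "0 < ?\<phi> x" if "norm x \<le> 1" for x
  proof -
    have "\<kappa> * norm x \<le> \<kappa>" using that \<kappa> by (simp add: mult_left_le)
    then have "\<kappa> * norm x < j" using \<kappa> by linarith
    then show ?thesis using \<kappa> by (intro J_pos) auto
  qed
  obtain x m where x: "norm x < 1" "0 < m" "e * \<psi> x = m * ?\<phi> x"
    and max: "\<And>y. norm y < 1 \<Longrightarrow> e * \<psi> y \<le> m * ?\<phi> y"
  proof (rule touching_from_above[of 1 "\<lambda>x. e * \<psi> x" ?\<phi> x1])
    show "continuous_on (cball 0 1) ?\<phi>" by (rule J_scaled_continuous[OF \<kappa>(1) dim])
  qed (use \<psi> x1 pos in \<open>auto intro!: continuous_intros\<close>)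
  have "e * laplacian \<psi> x + (- m) * laplacian ?\<phi> x + 0 * laplacian ?\<phi> x \<le> 0"
    by (rule laplacian_at_local_max[OF open_ball, of x 0 1])
       (use x max \<psi> J_scaled_C2(1)[OF \<kappa>(1) dim] in auto)
  moreover have "laplacian \<psi> x = - (\<mu> * \<psi> x)" using \<psi>(3)[OF x(1)] by simp
  ultimately have "\<kappa>\<^sup>2 * (m * ?\<phi> x) \<le> \<mu> * (e * \<psi> x)"
    using J_scaled_C2(2)[OF \<kappa>(1) dim, of x] by (simp add: mult_ac)
  then have "\<kappa>\<^sup>2 * (m * ?\<phi> x) \<le> \<mu> * (m * ?\<phi> x)" using x(3) by simp
  moreover have "0 < m * ?\<phi> x" using x pos[of x] by simp
  ultimately show False using \<kappa>\<mu> mult_right_le_imp_le by (meson not_le)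
qed

lemma principal_eigenvalue_ball:
  assumes dim: "DIM('a::euclidean_space) = Suc n"
  shows "principal_eigenvalue (ball (0::'a) 1) = j\<^sup>2"
  unfolding principal_eigenvalue_def
proof (rule Least_equality)
  show "dirichlet_eigenvalue (ball (0::'a) 1) (j\<^sup>2)"
    unfolding dirichlet_eigenvalue_def
  proof (intro exI[of _ "\<lambda>x. J (j * norm x)"] conjI ballI bexI)
    show "continuous_on (closure (ball 0 1)) (\<lambda>x::'a. J (j * norm x))"
      by (rule J_scaled_continuous[OF j_pos dim])
    show "J (j * norm (0::'a)) \<noteq> 0" "(0::'a) \<in> ball 0 1" using J0 by auto
  qed (use J_scaled_C2[OF j_pos dim] J_j in \<open>auto simp: dist_norm\<close>)
qed (rule dirichlet_eigenvalue_ge[OF dim])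

text \<open>On a ball of radius \<open>\<sigma> < 1\<close> the profile of a slightly larger ball of radius \<open>R < 1\<close> is
  positive up to the boundary and satisfies \<open>- \<Delta>\<phi> = (j / R)\<^sup>2 \<phi> > j\<^sup>2 \<phi>\<close>, which is a strict
  supersolution of the linearised problem.\<close>

lemma comparison:
  fixes u v :: "'a::euclidean_space \<Rightarrow> real"
  assumes dim: "DIM('a) = Suc n" and \<rho>: "0 < \<rho>" "\<rho> \<le> 1"
    and u: "C2_on (ball 0 \<rho>) u" "\<And>x. norm x < \<rho> \<Longrightarrow> laplacian u x = f (u x)"
    and v: "C2_on (ball 0 \<rho>) v" "\<And>x. norm x < \<rho> \<Longrightarrow> laplacian v x = f (v x)"
    and f: "mono ft" "\<And>t. f t = ft t - j\<^sup>2 * t"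
    and \<sigma>: "\<sigma> < \<rho>" "\<And>x. \<sigma> \<le> norm x \<Longrightarrow> norm x < \<rho> \<Longrightarrow> v x \<le> u x"
    and x: "norm x < \<rho>"
  shows "v x \<le> u x"
proof (rule ccontr)
  assume "\<not> v x \<le> u x"
  then have "norm x < \<sigma>" using \<sigma>(2) x by force
  then have "0 < \<sigma>" using norm_ge_zero[of x] by linarith
  define R where "R = (\<sigma> + 1) / 2"
  have R: "\<sigma> < R" "R < 1" "0 < R" using \<sigma> \<rho> \<open>0 < \<sigma>\<close> by (auto simp: R_def)
  define \<kappa> where "\<kappa> = j / R"
  have \<kappa>: "0 < \<kappa>" "j\<^sup>2 < \<kappa>\<^sup>2"
    using R j_pos by (auto simp: \<kappa>_def field_simps intro!: power_less_one_iff[THEN iffD2])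
  let ?\<phi> = "\<lambda>x::'a. J (\<kappa> * norm x)"
  have sub: "cball (0::'a) \<sigma> \<subseteq> ball 0 \<rho>" using \<sigma> by auto
  have pos: "0 < ?\<phi> y" if "norm y \<le> \<sigma>" for y
    using that R j_pos by (intro J_pos) (auto simp: \<kappa>_def field_simps)
  obtain z m where z: "norm z < \<sigma>" "0 < m" "v z - u z = m * ?\<phi> z"
    and max: "\<And>y. norm y < \<sigma> \<Longrightarrow> v y - u y \<le> m * ?\<phi> y"
  proof (rule touching_from_above[of \<sigma> "\<lambda>x. v x - u x" ?\<phi> x])
    show "continuous_on (cball 0 \<sigma>) (\<lambda>x. v x - u x)"
      by (intro continuous_intros continuous_on_subset[OF _ sub] C2_on_imp_continuous_on u v)
    show "continuous_on (cball 0 \<sigma>) ?\<phi>" by (rule J_scaled_continuous[OF \<kappa>(1) dim])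
  qed (use \<open>norm x < \<sigma>\<close> \<open>\<not> v x \<le> u x\<close> \<sigma> pos in auto)
  have C2: "C2_on (ball 0 \<sigma>) w" if "C2_on (ball 0 \<rho>) w" for w :: "'a \<Rightarrow> real"
    by (rule C2_on_subset[OF that]) (use \<sigma>(1) in auto)
  have "1 * laplacian v z + (- 1) * laplacian u z + (- m) * laplacian ?\<phi> z \<le> 0"
    by (rule laplacian_at_local_max[OF open_ball, of z 0 \<sigma>])
       (use z max C2 u v J_scaled_C2(1)[OF \<kappa>(1) dim] in auto)
  \<comment> \<open>A decrease of \<open>f\<close> from \<open>u z\<close> to \<open>v z\<close>
    costs at most \<open>j\<^sup>2 * (v z - u z)\<close>, which is less than the gain
    \<open>\<kappa>\<^sup>2 * (v z - u z)\<close> from the profile.\<close>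
  then have "f (v z) - f (u z) + \<kappa>\<^sup>2 * (m * ?\<phi> z) \<le> 0"
    using u(2)[of z] v(2)[of z] z(1) \<sigma>(1) J_scaled_C2(2)[OF \<kappa>(1) dim, of z] by (simp add: mult_ac)
  moreover have less: "0 < v z - u z" using z pos[of z] by simp
  moreover have "ft (u z) \<le> ft (v z)" using less by (intro monoD[OF f(1)]) auto
  ultimately have "(\<kappa>\<^sup>2 - j\<^sup>2) * (v z - u z) \<le> 0"
    unfolding f(2) z(3)[symmetric] by (simp add: algebra_simps)
  then show False using \<kappa>(2) less by (simp add: mult_le_0_iff)
qed

end

section \<open>Asymptotic coincidence of radial large solutions\<close>

text \<open>A feedback argument for the lag \<open>D\<close>, the energy difference \<open>E\<close>
  and the flux \<open>P\<close>. The initial bound of order \<open>1 - r\<close> for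
  \<open>D\<close> is improved to order \<open>(1 - r) / P\<close>: near \<open>1\<close> the lag is
  at most a multiple of \<open>(1 - r) * E / P\<^sup>2\<close>, and inserted into the inequality for
  \<open>E'\<close> this makes \<open>E / P\<close> nonincreasing.\<close>

lemma lag_estimate:
  fixes P P' E E' D D' :: "real \<Rightarrow> real"
  assumes r0: "r0 < 1" and C: "1 \<le> C"
    and P: "\<And>r. r0 < r \<Longrightarrow> r < 1 \<Longrightarrow> (P has_real_derivative P' r) (at r)"
    and P': "\<And>r. r0 < r \<Longrightarrow> r < 1 \<Longrightarrow> 0 \<le> P' r" and Ppos: "\<And>r. r0 < r \<Longrightarrow> r < 1 \<Longrightarrow> 0 < P r"
    and E: "\<And>r. r0 < r \<Longrightarrow> r < 1 \<Longrightarrow> (E has_real_derivative E' r) (at r)"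
    and E': "\<And>r. r0 < r \<Longrightarrow> r < 1 \<Longrightarrow> 0 \<le> E' r" "\<And>r. r0 < r \<Longrightarrow> r < 1 \<Longrightarrow> E' r \<le> C * P r * P' r * D r"
    and D: "\<And>r. r0 < r \<Longrightarrow> r < 1 \<Longrightarrow> (D has_real_derivative D' r) (at r)"
    and D'_nonneg: "\<And>r. r0 < r \<Longrightarrow> r < 1 \<Longrightarrow> E r \<le> 0 \<Longrightarrow> 0 \<le> D' r"
    and D': "\<And>r. r0 < r \<Longrightarrow> r < 1 \<Longrightarrow> 0 < E r \<Longrightarrow> D' r \<le> 0"
      "\<And>r. r0 < r \<Longrightarrow> r < 1 \<Longrightarrow> 0 < E r \<Longrightarrow> - (C * E r / (P r)\<^sup>2) \<le> D' r"
    and Dpos: "\<And>r. r0 < r \<Longrightarrow> r < 1 \<Longrightarrow> 0 < D r" and Dle: "\<And>r. r0 < r \<Longrightarrow> r < 1 \<Longrightarrow> D r \<le> C * (1 - r)"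
  obtains c r1 where "0 \<le> c" "r0 < r1" "r1 < 1" "\<And>r. r1 \<le> r \<Longrightarrow> r < 1 \<Longrightarrow> E r \<le> c * P r"
    "\<And>r. r1 \<le> r \<Longrightarrow> r < 1 \<Longrightarrow> D r * P r \<le> c * (1 - r)"
proof -
  have cont: "continuous_on {p..q} g" if "r0 < p" "q < 1" "\<And>r. r0 < r \<Longrightarrow> r < 1 \<Longrightarrow> (g has_real_derivative g' r) (at r)"
    for p q and g g' :: "real \<Rightarrow> real"
    by (rule DERIV_continuous_on, rule has_field_derivative_at_within, rule that(3)) (use that in auto)
  have mono: "g p \<le> g q" if "r0 < p" "p \<le> q" "q < 1" "\<And>r. r0 < r \<Longrightarrow> r < 1 \<Longrightarrow> (g has_real_derivative g' r) (at r)"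
      "\<And>r. p < r \<Longrightarrow> r < q \<Longrightarrow> 0 \<le> g' r" for p q and g g' :: "real \<Rightarrow> real"
  proof (rule DERIV_nonneg_imp_increasing_open[OF that(2)])
    fix x assume x: "p < x" "x < q"
    then show "\<exists>y. (g has_real_derivative y) (at x) \<and> 0 \<le> y"
      using that(4)[of x] that(5)[of x] that by (intro exI[of _ "g' x"]) auto
  qed (rule cont[OF that(1,3,4)])
  \<comment> \<open>If \<open>E\<close> stayed nonpositive, the positive lag would be nondecreasing,
    against \<open>D r \<le> C * (1 - r)\<close>.\<close>
  have "\<exists>s. r0 < s \<and> s < 1 \<and> 0 < E s"
  proof (rule ccontr)
    assume "\<not> ?thesis"
    then have nonpos: "E r \<le> 0" if "r0 < r" "r < 1" for r using that not_less by blast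
    define m where "m = (r0 + 1) / 2"
    have m: "r0 < m" "m < 1" using r0 by (auto simp: m_def)
    define r where "r = max m (1 - D m / (2 * C))"
    have r: "m \<le> r" "r < 1" "1 - r \<le> D m / (2 * C)" using m Dpos[OF m] C by (auto simp: r_def)
    have "D m \<le> D r"
      by (rule mono[OF m(1) r(1,2) D]) (use D'_nonneg nonpos m r in auto)
    also have "\<dots> \<le> C * (1 - r)" using Dle r m by auto
    also have "\<dots> \<le> C * (D m / (2 * C))" using r C by (intro mult_left_mono) auto
    also have "\<dots> < D m" using C Dpos[OF m] by (simp add: field_simps)
    finally show False by simp
  qed
  then obtain s where s: "r0 < s" "s < 1" "0 < E s" by auto
  have Epos: "0 < E r" if "s \<le> r" "r < 1" for r
  proof -
    have "E s \<le> E r" by (rule mono[OF s(1) that E]) (use E'(1) s that in auto)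
    then show ?thesis using s by simp
  qed
  \<comment> \<open>So close to \<open>1\<close> that terms with the factor
    \<open>C\<^sup>2 * (1 - r)\<close> can be absorbed, once in the bound for \<open>D\<close> and
    once in the monotonicity of \<open>E / P\<close>.\<close>
  define s1 where "s1 = max s (1 - 1 / (2 * C\<^sup>2))"
  have s1: "s \<le> s1" "s1 < 1" "2 * C\<^sup>2 * (1 - s1) \<le> 1"
  proof -
    have "1 - s1 \<le> 1 / (2 * C\<^sup>2)" by (simp add: s1_def)
    then have "2 * C\<^sup>2 * (1 - s1) \<le> 2 * C\<^sup>2 * (1 / (2 * C\<^sup>2))" by (rule mult_left_mono) auto
    then show "2 * C\<^sup>2 * (1 - s1) \<le> 1" using C by auto
  qed (use s C in \<open>auto simp: s1_def\<close>)
  \<comment> \<open>From \<open>p\<close> on the lag does not increase, so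
    \<open>E' \<le> C * D p * P * P'\<close> integrates to a bound for \<open>E\<close>. This bounds
    \<open>- D'\<close> by the constant \<kappa>, and since the lag tends to zero at
    \<open>1\<close>, it is at most \<open>\<kappa> * (1 - p)\<close> at \<open>p\<close>; the part
    of \<kappa> containing \<open>D p\<close> is absorbed.\<close>
  have key: "D p \<le> 2 * C * (1 - p) * E p / (P p)\<^sup>2" if p: "s1 \<le> p" "p < 1" for p
  proof -
    have rp: "r0 < p" "s \<le> p" using p s s1 by auto
    define \<kappa> where "\<kappa> = C * (E p / (P p)\<^sup>2 + C / 2 * D p)"
    have \<kappa>0: "0 \<le> \<kappa>"
      unfolding \<kappa>_def using C Epos[of p] Dpos[of p] rp p by (intro mult_nonneg_nonneg add_nonneg_nonneg) auto
    have Dq: "D q \<le> D p" if q: "p \<le> q" "q < 1" for q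
    proof -
      have "- D p \<le> - D q"
        by (rule mono[OF rp(1) q DERIV_minus[OF D]]) (use D'(1) Epos rp q in auto)
      then show ?thesis by simp
    qed
    have PP: "P p \<le> P q" if q: "p \<le> q" "q < 1" for q
      by (rule mono[OF rp(1) q P]) (use P' rp q in auto)
    have Eq: "E q \<le> E p + C / 2 * D p * (P q)\<^sup>2" if q: "p \<le> q" "q < 1" for q
    proof -
      have "C / 2 * D p * (P p)\<^sup>2 - E p \<le> C / 2 * D p * (P q)\<^sup>2 - E q"
      proof (rule mono[OF rp(1) q, of "\<lambda>r. C / 2 * D p * (P r)\<^sup>2 - E r" "\<lambda>r. C * D p * P r * P' r - E' r"])
        fix r assume "r0 < r" "r < 1"
        then show "((\<lambda>r. C / 2 * D p * (P r)\<^sup>2 - E r) has_real_derivative C * D p * P r * P' r - E' r) (at r)"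
          using DERIV_diff[OF DERIV_cmult[OF DERIV_power[OF P], of r "C / 2 * D p" 2] E] by (simp add: mult_ac)
      next
        fix r assume r: "p < r" "r < q"
        then have rr: "r0 < r" "r < 1" using rp q by auto
        have "C * P r * P' r * D r \<le> C * P r * P' r * D p"
          using Dq[of r] r q C Ppos[OF rr] P'[OF rr] by (intro mult_left_mono) auto
        then show "0 \<le> C * D p * P r * P' r - E' r" using E'(2)[OF rr] by (simp add: mult_ac)
      qed
      moreover have "0 \<le> C / 2 * D p * (P p)\<^sup>2" using C Dpos[of p] rp p by auto
      ultimately show ?thesis by simp
    qed
    have low: "- \<kappa> \<le> D' q" if q: "p < q" "q < 1" for q
    proof -
      have qq: "r0 < q" "s \<le> q" using q rp by auto
      have "C * E q / (P q)\<^sup>2 \<le> C * (E p + C / 2 * D p * (P q)\<^sup>2) / (P q)\<^sup>2"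
        using Eq[of q] q C by (intro divide_right_mono mult_left_mono) auto
      also have "\<dots> = C * (E p / (P q)\<^sup>2 + C / 2 * D p)"
        using Ppos[of q] qq q by (simp add: field_simps)
      also have "\<dots> \<le> \<kappa>"
        unfolding \<kappa>_def using C Epos[of p] rp p Ppos[of p] PP[of q] q
        by (intro mult_left_mono add_right_mono divide_left_mono power_mono) auto
      finally show ?thesis using D'(2)[of q] Epos[of q] qq q by linarith
    qed
    have "D p \<le> \<kappa> * (1 - p) + \<epsilon>" if \<epsilon>: "0 < \<epsilon>" for \<epsilon>
    proof -
      \<comment> \<open>The functions are controlled only below \<open>1\<close>, so the integration
        stops where the remaining lag is at most \<epsilon>.\<close>
      define q where "q = max p (1 - \<epsilon> / C)"
      have q: "p \<le> q" "q < 1" "1 - q \<le> \<epsilon> / C" using p \<epsilon> C by (auto simp: q_def)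
      have "D p + \<kappa> * p \<le> D q + \<kappa> * q"
      proof (rule mono[OF rp(1) q(1,2), of "\<lambda>r. D r + \<kappa> * r" "\<lambda>r. D' r + \<kappa>"])
        fix r assume "r0 < r" "r < 1"
        then show "((\<lambda>r. D r + \<kappa> * r) has_real_derivative D' r + \<kappa>) (at r)"
          using DERIV_add[OF D DERIV_cmult_Id] by simp
      next
        fix r assume "p < r" "r < q"
        then show "0 \<le> D' r + \<kappa>" using low[of r] q by auto
      qed
      moreover have "D q \<le> \<epsilon>"
      proof -
        have "D q \<le> C * (1 - q)" using Dle q rp by auto
        also have "\<dots> \<le> C * (\<epsilon> / C)" using q C by (intro mult_left_mono) auto
        finally show ?thesis using C by simp
      qed
      moreover have "\<kappa> * q \<le> \<kappa> * 1" using \<kappa>0 q by (intro mult_left_mono) auto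
      ultimately show ?thesis by (simp add: algebra_simps)
    qed
    then have "D p \<le> \<kappa> * (1 - p)" by (rule field_le_epsilon)
    also have "\<dots> = C * (1 - p) * E p / (P p)\<^sup>2 + C\<^sup>2 * (1 - p) / 2 * D p"
      by (simp add: \<kappa>_def power2_eq_square algebra_simps)
    also have "C\<^sup>2 * (1 - p) / 2 * D p \<le> 1 / 2 * D p"
    proof (rule mult_right_mono)
      have "C\<^sup>2 * (1 - p) \<le> C\<^sup>2 * (1 - s1)" using p by (intro mult_left_mono) auto
      then show "C\<^sup>2 * (1 - p) / 2 \<le> 1 / 2" using s1 by linarith
    qed (use Dpos[of p] rp p in auto)
    finally show ?thesis by simp
  qed
  define c0 where "c0 = E s1 / P s1"
  have c0: "0 < c0" using Epos[of s1] Ppos[of s1] s1 s by (simp add: c0_def)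
  have EP: "E r \<le> c0 * P r" if r: "s1 \<le> r" "r < 1" for r
  proof -
    have rs: "r0 < s1" using s s1 by auto
    have "- (E s1 / P s1) \<le> - (E r / P r)"
    proof (rule mono[OF rs r, of "\<lambda>r. - (E r / P r)" "\<lambda>r. - ((E' r * P r - E r * P' r) / (P r * P r))"])
      fix q assume q: "r0 < q" "q < 1"
      show "((\<lambda>r. - (E r / P r)) has_real_derivative - ((E' q * P q - E q * P' q) / (P q * P q))) (at q)"
        using DERIV_minus[OF DERIV_divide[OF E[OF q] P[OF q]]] Ppos[OF q] by simp
    next
      fix q assume "s1 < q" "q < r"
      then have q: "s1 \<le> q" "q < 1" "r0 < q" "s \<le> q" using r rs s1 by auto
      have "E' q * P q \<le> C * P q * P' q * D q * P q"
        using E'(2)[OF q(3,2)] Ppos[OF q(3,2)] by (intro mult_right_mono) auto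
      also have "\<dots> \<le> C * P q * P' q * (2 * C * (1 - q) * E q / (P q)\<^sup>2) * P q"
        using key[OF q(1,2)] C Ppos[OF q(3,2)] P'[OF q(3,2)] by (intro mult_right_mono mult_left_mono) auto
      also have "\<dots> = 2 * C\<^sup>2 * (1 - q) * (E q * P' q)"
        using Ppos[OF q(3,2)] by (simp add: power2_eq_square field_simps)
      also have "\<dots> \<le> 1 * (E q * P' q)"
      proof (rule mult_right_mono)
        have "2 * C\<^sup>2 * (1 - q) \<le> 2 * C\<^sup>2 * (1 - s1)" using q by (intro mult_left_mono) auto
        then show "2 * C\<^sup>2 * (1 - q) \<le> 1" using s1 by linarith
      qed (use Epos[OF q(4,2)] P'[OF q(3,2)] in auto)
      finally show "0 \<le> - ((E' q * P q - E q * P' q) / (P q * P q))"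
        by (simp add: divide_le_0_iff)
    qed
    then show ?thesis using Ppos[of r] r rs by (simp add: c0_def field_simps)
  qed
  show ?thesis
  proof (rule that[of "2 * C * c0" s1])
    show "0 \<le> 2 * C * c0" "r0 < s1" "s1 < 1" using c0 C s s1 by auto
    fix r assume r: "s1 \<le> r" "r < 1"
    have Pr: "0 < P r" using Ppos[of r] r s s1 by auto
    have "1 * c0 \<le> 2 * C * c0" using c0 C by (intro mult_right_mono) auto
    then have "c0 * P r \<le> 2 * C * c0 * P r" using Pr by (intro mult_right_mono) auto
    then show "E r \<le> 2 * C * c0 * P r" using EP[OF r] by simp
    have "D r * P r \<le> 2 * C * (1 - r) * E r / (P r)\<^sup>2 * P r"
      using key[OF r] Pr by (intro mult_right_mono) auto
    also have "\<dots> = 2 * C * (1 - r) * (E r / P r)" using Pr by (simp add: power2_eq_square)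
    also have "\<dots> \<le> 2 * C * (1 - r) * c0"
      using EP[OF r] Pr C r by (intro mult_left_mono) (auto simp: field_simps)
    finally show "D r * P r \<le> 2 * C * c0 * (1 - r)" by (simp add: mult_ac)
  qed
qed

section \<open>The gap between two radial large solutions\<close>

lemma radial_strict_mono:
  assumes rad: "radial n f X u h" and pos: "\<And>r. 0 < r \<Longrightarrow> r < X \<Longrightarrow> 0 < h r"
    and "0 \<le> r" "r < s" "s < X"
  shows "u r < u s"
proof (rule DERIV_pos_imp_increasing_open[OF assms(4)])
  fix x assume "r < x" "x < s"
  then have "0 < x" "x < X" using assms by auto
  then show "\<exists>y. (u has_real_derivative y) (at x) \<and> 0 < y"
    using radialD(3)[OF rad] pos by (intro exI[of _ "x * h x"]) auto
next
  show "continuous_on {r..s} u"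
    by (rule continuous_on_subset[OF radialD(1)[OF rad]]) (use assms in auto)
qed

text \<open>Let \<open>\<theta> r > r\<close> be the point where \<open>u\<close> reaches the level \<open>v r\<close>. The lag is measured in the
  variable \<open>s\<close> with \<open>ds = r\<^sup>-\<^sup>n dr\<close>, which removes the damping: with
  \<open>P = r\<^sup>n v'\<close> and \<open>E = (r\<^sup>n u')\<^sup>2(\<theta> r) - P\<^sup>2\<close> one gets \<open>E' = 2 f(v) P (\<theta>\<^sup>2\<^sup>n - r\<^sup>2\<^sup>n) / r\<^sup>n\<close>.\<close>

lemma radial_gap:
  assumes u: "radial n f 1 u h" and v: "radial n f 1 v k"
    and lt: "\<And>r. 0 \<le> r \<Longrightarrow> r < 1 \<Longrightarrow> u r < v r"
    and blow: "filterlim u at_top (at_left 1)"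
    and hpos: "\<And>r. 0 < r \<Longrightarrow> r < 1 \<Longrightarrow> 0 < h r" and kpos: "\<And>r. 0 < r \<Longrightarrow> r < 1 \<Longrightarrow> 0 < k r"
    and fposu: "\<And>r. 0 < r \<Longrightarrow> r < 1 \<Longrightarrow> 0 \<le> f (u r)"
    and fpos: "\<And>r. 0 < r \<Longrightarrow> r < 1 \<Longrightarrow> 0 \<le> f (v r)"
  obtains c r1 where "0 < r1" "r1 < 1" "\<And>r. r1 \<le> r \<Longrightarrow> r < 1 \<Longrightarrow> v r - u r \<le> c * (1 - r)"
proof -
  note u_strict = radial_strict_mono[OF u hpos]
  have isCont_u: "isCont u r" if "0 < r" "r < 1" for r
    using radialD(3)[OF u that] by (rule DERIV_isCont)
  \<comment> \<open>The local inverse of \<open>u\<close>. As \<open>u\<close> is strictly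
    increasing and unbounded, each level \<open>v r\<close> is attained at exactly one radius,
    beyond \<open>r\<close>.\<close>
  define g where "g = inv_into {0<..<1} u"
  have inj: "inj_on u {0<..<1}"
    by (rule strict_mono_on_imp_inj_on) (auto intro!: strict_mono_onI u_strict)
  have gu: "g (u s) = s" if "0 < s" "s < 1" for s
    unfolding g_def using inv_into_f_f[OF inj] that by auto
  define \<theta> where "\<theta> r = g (v r)" for r
  have \<theta>: "r < \<theta> r \<and> \<theta> r < 1 \<and> u (\<theta> r) = v r" if r: "0 < r" "r < 1" for r
  proof -
    have "eventually (\<lambda>s. v r \<le> u s) (at_left 1)"
      using blow by (simp add: filterlim_at_top)
    then obtain b where b: "b < 1" "\<And>s. b < s \<Longrightarrow> s < 1 \<Longrightarrow> v r \<le> u s"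
      unfolding eventually_at_left_field by auto
    define y where "y = (max b r + 1) / 2"
    have y: "b < y" "r < y" "y < 1" using b r by (auto simp: y_def)
    have "\<exists>s\<ge>r. s \<le> y \<and> u s = v r"
      by (rule IVT') (use lt[of r] r b(2)[OF y(1,3)] y in
          \<open>auto intro!: continuous_on_subset[OF radialD(1)[OF u]]\<close>)
    then obtain s where s: "r \<le> s" "s \<le> y" "u s = v r" by auto
    then have "\<theta> r = s" unfolding \<theta>_def using gu[of s] r y by auto
    moreover have "s \<noteq> r" using s lt[of r] r by auto
    ultimately show ?thesis using s y by auto
  qed
  define P where "P r = r ^ Suc n * k r" for r
  define Q where "Q r = r ^ Suc n * h r" for r
  have Ppos: "0 < P r" and Qpos: "0 < Q r" if "0 < r" "r < 1" for r
    using that hpos kpos by (auto simp: P_def Q_def)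
  have dP: "(P has_real_derivative r ^ n * f (v r)) (at r)" if "0 < r" "r < 1" for r
    unfolding P_def using radialD(4)[OF v that] .
  have dQ: "(Q has_real_derivative r ^ n * f (u r)) (at r)" if "0 < r" "r < 1" for r
    unfolding Q_def using radialD(4)[OF u that] .
  have du: "(u has_real_derivative Q r / r ^ n) (at r)" if "0 < r" "r < 1" for r
    using radialD(3)[OF u that] that by (simp add: Q_def)
  have dv: "(v has_real_derivative P r / r ^ n) (at r)" if "0 < r" "r < 1" for r
    using radialD(3)[OF v that] that by (simp add: P_def)
  have d\<theta>: "(\<theta> has_real_derivative (\<theta> r) ^ n / Q (\<theta> r) * (P r / r ^ n)) (at r)" if r: "0 < r" "r < 1" for r
  proof -
    define b where "b = (\<theta> r + 1) / 2"
    have b: "\<theta> r < b" "b < 1" using \<theta>[OF r] by (auto simp: b_def)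
    have t: "r < \<theta> r" "\<theta> r < 1" "u (\<theta> r) = v r" "0 < \<theta> r" using \<theta>[OF r] r by auto
    have "(g has_real_derivative inverse (Q (\<theta> r) / (\<theta> r) ^ n)) (at (v r))"
    proof (rule DERIV_inverse_function[where a = "u r" and b = "u b"])
      show "(u has_real_derivative Q (\<theta> r) / (\<theta> r) ^ n) (at (g (v r)))"
        using du[of "\<theta> r"] t r by (simp add: \<theta>_def)
      show "Q (\<theta> r) / (\<theta> r) ^ n \<noteq> 0" using Qpos[of "\<theta> r"] t r by auto
      show "u r < v r" using lt r by auto
      show "v r < u b" using u_strict[of "\<theta> r" b] t b r by auto
      show "u (g y) = y" if "u r < y" "y < u b" for y
      proof -
        have "\<exists>s\<ge>r. s \<le> b \<and> u s = y"
          by (rule IVT') (use that r b t in \<open>auto intro!: continuous_on_subset[OF radialD(1)[OF u]]\<close>)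
        then obtain s where "r \<le> s" "s \<le> b" "u s = y" by auto
        then show ?thesis using gu[of s] r b by auto
      qed
      have "isCont g (u (\<theta> r))"
        by (rule isCont_inverse_function2[of r _ b]) (use t b r gu isCont_u in auto)
      then show "isCont g (v r)" using t by simp
    qed
    from DERIV_chain2[OF this dv[OF r]] show ?thesis
      by (simp add: \<theta>_def[abs_def] divide_inverse mult_ac)
  qed
  \<comment> \<open>The primitive \<open>A\<close> is the undamped variable \<open>s\<close>; the
    interval holds the relevant radii, between \<open>1/2\<close> and \<open>1\<close>, in its
    interior.\<close>
  have "continuous_on {1/4..2::real} (\<lambda>s. 1 / s ^ n)" by (intro continuous_intros) auto
  then obtain A where A: "\<And>x. x \<in> {1/4..2} \<Longrightarrow> (A has_vector_derivative 1 / x ^ n) (at x within {1/4..2::real})"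
    using antiderivative_continuous by blast
  have dA: "(A has_real_derivative 1 / x ^ n) (at x)" if "1/4 < x" "x < 2" for x
    using A[of x] that at_within_Icc_at[of "1/4" x 2]
    by (simp add: has_real_derivative_iff_has_vector_derivative)
  have pow: "1 \<le> 1 / x ^ m" "1 / x ^ m \<le> 2 ^ m" if "1/2 \<le> x" "x \<le> 1" for x :: real and m
  proof -
    show "1 \<le> 1 / x ^ m" using that power_le_one[of x m] by (simp add: divide_simps)
    have "(1/2) ^ m \<le> x ^ m" using that by (intro power_mono) auto
    then show "1 / x ^ m \<le> 2 ^ m" using that by (simp add: divide_simps power_one_over mult.commute)
  qed
  have lag: "\<theta> r - r \<le> A (\<theta> r) - A r" "A (\<theta> r) - A r \<le> 2 ^ n * (\<theta> r - r)" if r: "1/2 < r" "r < 1" for r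
  proof -
    have t: "r < \<theta> r" "\<theta> r < 1" using \<theta>[of r] r by auto
    obtain z where z: "r < z" "z < \<theta> r" "A (\<theta> r) - A r = (\<theta> r - r) * (1 / z ^ n)"
      using MVT2[OF t(1), of A "\<lambda>x. 1 / x ^ n"] dA r t by auto
    have p: "1 \<le> 1 / z ^ n" "1 / z ^ n \<le> 2 ^ n" and d: "0 \<le> \<theta> r - r"
      using pow[of z n] z r t by linarith+
    have "(\<theta> r - r) * 1 \<le> (\<theta> r - r) * (1 / z ^ n)" "(\<theta> r - r) * (1 / z ^ n) \<le> (\<theta> r - r) * 2 ^ n"
      by (rule mult_left_mono[OF p(1) d] mult_left_mono[OF p(2) d])+
    then show "\<theta> r - r \<le> A (\<theta> r) - A r" "A (\<theta> r) - A r \<le> 2 ^ n * (\<theta> r - r)"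
      using z by (simp_all add: mult.commute)
  qed
  \<comment> \<open>One constant for three purposes: the ratio of the lag in \<open>A\<close> to the
    lag in \<open>r\<close>, the weight \<open>1 / r ^ n\<close> in the lag equation, and the factor
    \<open>4 * n * 4 ^ n\<close> in the energy inequality.\<close>
  define C where "C = 4 * real (Suc n) * 4 ^ n"
  have C: "1 \<le> C" "2 ^ n \<le> C" "4 * real n * 4 ^ n \<le> C"
  proof -
    have "(2::real) ^ n \<le> 4 ^ n" by (intro power_mono) auto
    moreover have "1 * 4 ^ n \<le> (4 * real (Suc n)) * (4::real) ^ n" by (intro mult_right_mono) auto
    ultimately show "2 ^ n \<le> C" unfolding C_def by linarith
    then show "1 \<le> C" using one_le_power[of "2::real" n] by linarith
  qed (simp add: C_def)
  have id1: "2 * q * (X * F * (X / q * (p / Y))) - 2 * p * (Y * F) = 2 * F * p * (X * X - Y * Y) / Y"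
    if "q \<noteq> 0" "Y \<noteq> 0" for q Y X F p :: real
    using that by (simp add: field_simps)
  have id2: "2 * F * p * (2 * m * d) / Y = (4 * m * (1 / (Y * Y))) * (p * (Y * F) * d)"
    if "Y \<noteq> 0" for Y F p m d :: real
    using that by (simp add: field_simps)
  have id3: "(1 - p / q) / Y = (q\<^sup>2 - p\<^sup>2) / (q * (q + p)) * (1 / Y)" if "0 < p" "0 < q" for p q Y :: real
  proof -
    have "q + p \<noteq> 0" using that by simp
    then have "1 - p / q = (q - p) * (q + p) / (q * (q + p))"
      using that nonzero_mult_divide_mult_cancel_right[of "q + p" "q - p" q] by (simp add: diff_divide_distrib)
    moreover have "(q - p) * (q + p) = q\<^sup>2 - p\<^sup>2" by (simp add: power2_eq_square algebra_simps)
    ultimately show ?thesis by simp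
  qed
  let ?E = "\<lambda>r. (Q (\<theta> r))\<^sup>2 - (P r)\<^sup>2"
  let ?D = "\<lambda>r. A (\<theta> r) - A r"
  obtain c r1 where c: "0 \<le> c" "1/2 < r1" "r1 < 1" "\<And>r. r1 \<le> r \<Longrightarrow> r < 1 \<Longrightarrow> ?E r \<le> c * P r"
    "\<And>r. r1 \<le> r \<Longrightarrow> r < 1 \<Longrightarrow> ?D r * P r \<le> c * (1 - r)"
  proof (rule lag_estimate[where ?r0.0 = "1/2" and C = C and P = P and P' = "\<lambda>r. r ^ n * f (v r)" and E = ?E
        and E' = "\<lambda>r. 2 * f (v r) * P r * (\<theta> r ^ (2 * n) - r ^ (2 * n)) / r ^ n"
        and D = ?D and D' = "\<lambda>r. (P r / Q (\<theta> r) - 1) / r ^ n"])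
    fix r :: real assume r2: "1/2 < r" "r < 1"
    then have r: "0 < r" by simp
    have t: "r < \<theta> r" "\<theta> r < 1" "u (\<theta> r) = v r" "0 < \<theta> r" using \<theta>[OF r r2(2)] r by auto
    have Q0: "0 < Q (\<theta> r)" using Qpos t by auto
    have P0: "0 < P r" using Ppos r r2 by auto
    show "(P has_real_derivative r ^ n * f (v r)) (at r)" by (rule dP[OF r r2(2)])
    show P'0: "0 \<le> r ^ n * f (v r)" using fpos[OF r r2(2)] r by simp
    show "0 < P r" by (rule P0)
    \<comment> \<open>At \<theta> and at \<open>r\<close> the right-hand side takes the same value
      \<open>f (v r)\<close>, so only the difference of the weights survives; it is of the size of
      the lag and vanishes for \<open>n = 0\<close>.\<close>
    have "(?E has_real_derivative 2 * Q (\<theta> r) * (\<theta> r ^ n * f (u (\<theta> r)) * (\<theta> r ^ n / Q (\<theta> r) * (P r / r ^ n)))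
        - 2 * P r * (r ^ n * f (v r))) (at r)"
      by (rule DERIV_cong[OF DERIV_diff[OF DERIV_power[OF DERIV_chain2[OF dQ[OF t(4,2)] d\<theta>[OF r r2(2)]], of 2]
          DERIV_power[OF dP[OF r r2(2)], of 2]]]) (use Q0 in simp)
    moreover have "2 * Q (\<theta> r) * (\<theta> r ^ n * f (u (\<theta> r)) * (\<theta> r ^ n / Q (\<theta> r) * (P r / r ^ n)))
        - 2 * P r * (r ^ n * f (v r)) = 2 * f (v r) * P r * (\<theta> r ^ (2 * n) - r ^ (2 * n)) / r ^ n"
      using id1[of "Q (\<theta> r)" "r ^ n" "\<theta> r ^ n" "f (v r)" "P r"] Q0 r
      unfolding t(3) mult_2 power_add by simp
    ultimately show "(?E has_real_derivative 2 * f (v r) * P r * (\<theta> r ^ (2 * n) - r ^ (2 * n)) / r ^ n) (at r)"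
      by simp
    have "r ^ (2 * n) \<le> \<theta> r ^ (2 * n)" using t r by (intro power_mono) auto
    then show "0 \<le> 2 * f (v r) * P r * (\<theta> r ^ (2 * n) - r ^ (2 * n)) / r ^ n"
      using fpos[OF r r2(2)] P0 r by simp
    have "\<theta> r ^ (2 * n) - r ^ (2 * n) \<le> real (2 * n) * (\<theta> r - r)"
      using norm_power_diff[of "\<theta> r" r "2 * n"] t r r2 by simp
    also have "\<dots> \<le> real (2 * n) * ?D r" using lag(1)[OF r2] by (intro mult_left_mono) auto
    finally have "2 * f (v r) * P r * (\<theta> r ^ (2 * n) - r ^ (2 * n)) / r ^ n
        \<le> 2 * f (v r) * P r * (real (2 * n) * ?D r) / r ^ n"
      using fpos[OF r r2(2)] P0 r by (intro divide_right_mono mult_left_mono) auto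
    also have "\<dots> = (4 * real n * (1 / r ^ (2 * n))) * (P r * (r ^ n * f (v r)) * ?D r)"
      using id2[of "r ^ n" "f (v r)" "P r" "real n" "?D r"] r
      unfolding mult_2[of n] power_add by simp
    also have "\<dots> \<le> C * (P r * (r ^ n * f (v r)) * ?D r)"
    proof (rule mult_right_mono)
      have "4 * real n * (1 / r ^ (2 * n)) \<le> 4 * real n * 2 ^ (2 * n)"
        using pow[of r "2 * n"] r2 by (intro mult_left_mono) auto
      also have "\<dots> \<le> C" using C by (simp add: power_mult)
      finally show "4 * real n * (1 / r ^ (2 * n)) \<le> C" .
    qed (use P0 P'0 lag(1)[OF r2] t in auto)
    finally show "2 * f (v r) * P r * (\<theta> r ^ (2 * n) - r ^ (2 * n)) / r ^ n \<le> C * P r * (r ^ n * f (v r)) * ?D r"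
      by (simp add: mult_ac)
    have "(?D has_real_derivative 1 / \<theta> r ^ n * (\<theta> r ^ n / Q (\<theta> r) * (P r / r ^ n)) - 1 / r ^ n) (at r)"
      using t r r2 by (intro DERIV_diff DERIV_chain2[OF dA d\<theta>[OF r r2(2)]] dA) auto
    then show "(?D has_real_derivative (P r / Q (\<theta> r) - 1) / r ^ n) (at r)"
      using t(4) by (simp add: diff_divide_distrib)
    show "0 \<le> (P r / Q (\<theta> r) - 1) / r ^ n" if "?E r \<le> 0"
    proof -
      have "Q (\<theta> r) \<le> P r" using that power2_le_imp_le[of "Q (\<theta> r)" "P r"] P0 by simp
      then show ?thesis using Q0 r by simp
    qed
    show "(P r / Q (\<theta> r) - 1) / r ^ n \<le> 0" "- (C * ?E r / (P r)\<^sup>2) \<le> (P r / Q (\<theta> r) - 1) / r ^ n" if E: "0 < ?E r"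
    proof -
      have QP: "P r \<le> Q (\<theta> r)" using E power2_le_imp_le[of "P r" "Q (\<theta> r)"] Q0 by simp
      then show "(P r / Q (\<theta> r) - 1) / r ^ n \<le> 0" using Q0 r by (simp add: divide_le_0_iff)
      have "(1 - P r / Q (\<theta> r)) / r ^ n = ?E r / (Q (\<theta> r) * (Q (\<theta> r) + P r)) * (1 / r ^ n)"
        using id3[of "P r" "Q (\<theta> r)" "r ^ n"] Q0 P0 by simp
      also have "\<dots> \<le> ?E r / (P r * P r) * C"
      proof (rule mult_mono)
        have "P r * P r \<le> Q (\<theta> r) * (Q (\<theta> r) + P r)" using QP P0 Q0 by (intro mult_mono) auto
        then show "?E r / (Q (\<theta> r) * (Q (\<theta> r) + P r)) \<le> ?E r / (P r * P r)"
          by (rule divide_left_mono) (use E P0 Q0 QP in auto)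
        show "1 / r ^ n \<le> C" using pow(2)[of r n] C r2 by auto
      qed (use E P0 r QP in auto)
      finally have "(1 - P r / Q (\<theta> r)) / r ^ n \<le> C * ?E r / (P r)\<^sup>2"
        by (simp add: power2_eq_square mult.commute)
      then show "- (C * ?E r / (P r)\<^sup>2) \<le> (P r / Q (\<theta> r) - 1) / r ^ n"
        by (simp add: diff_divide_distrib)
    qed
    show "0 < ?D r" using lag(1)[OF r2] t by simp
    have "?D r \<le> 2 ^ n * (\<theta> r - r)" by (rule lag(2)[OF r2])
    also have "\<dots> \<le> C * (1 - r)" using C t by (intro mult_mono) auto
    finally show "?D r \<le> C * (1 - r)" .
  qed (use C in auto)
  define p0 where "p0 = P r1"
  have p0: "0 < p0" using Ppos[of r1] c by (simp add: p0_def)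
  show ?thesis
  proof (rule that[of r1 "2 ^ n * (1 + c / p0) * c"])
    fix r assume r: "r1 \<le> r" "r < 1"
    then have r2: "1/2 < r" "0 < r" using c by auto
    have t: "r < \<theta> r" "\<theta> r < 1" "u (\<theta> r) = v r" "0 < \<theta> r" using \<theta>[OF r2(2) r(2)] r2 by auto
    have P0: "0 < P r" using Ppos r2 r by auto
    have Pmono: "p0 \<le> P r"
      unfolding p0_def
    proof (rule DERIV_nonneg_imp_nondecreasing[OF r(1)])
      fix x assume "r1 \<le> x" "x \<le> r"
      then have "0 < x" "x < 1" using c r by auto
      then show "\<exists>y. (P has_real_derivative y) (at x) \<and> 0 \<le> y"
        using dP[of x] fpos[of x] by (intro exI[of _ "x ^ n * f (v x)"]) auto
    qed
    \<comment> \<open>The flux of \<open>u\<close> at the common level exceeds that of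
      \<open>v\<close> by at most the constant \<open>c\<close>, hence by a bounded factor, since
      \<open>P\<close> stays above \<open>p0\<close>.\<close>
    have "(Q (\<theta> r))\<^sup>2 \<le> (P r)\<^sup>2 + c * P r" using c(4)[OF r] by simp
    also have "\<dots> \<le> (P r + c)\<^sup>2" using c(1) P0 by (simp add: power2_sum)
    finally have "Q (\<theta> r) \<le> P r + c" using P0 c(1) by (auto intro: power2_le_imp_le)
    also have "c \<le> c / p0 * P r" using Pmono p0 c(1) by (simp add: field_simps mult_left_mono)
    finally have QP: "Q (\<theta> r) \<le> (1 + c / p0) * P r" by (simp add: algebra_simps)
    \<comment> \<open>The gap \<open>v r - u r\<close> is the growth of \<open>u\<close> over the
      lag, thus at most lag times slope, and the slope is of order \<open>P\<close>; the product
      \<open>?D r * P r\<close> is what \<open>lag_estimate\<close> controls.\<close>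
    obtain z where z: "r < z" "z < \<theta> r" "u (\<theta> r) - u r = (\<theta> r - r) * (Q z / z ^ n)"
      using MVT2[OF t(1), of u "\<lambda>x. Q x / x ^ n"] du r2 t by auto
    have "Q z \<le> Q (\<theta> r)"
    proof (rule DERIV_nonneg_imp_nondecreasing[of z "\<theta> r" Q])
      fix x assume x: "z \<le> x" "x \<le> \<theta> r"
      then have x1: "0 < x" "x < 1" using z r2 t by auto
      have "0 \<le> f (u x)" by (rule fposu[OF x1])
      then show "\<exists>y. (Q has_real_derivative y) (at x) \<and> 0 \<le> y"
        using dQ[OF x1] x1 by (intro exI[of _ "x ^ n * f (u x)"]) auto
    qed (use z in auto)
    then have "Q z / z ^ n \<le> Q (\<theta> r) * 2 ^ n"
      using pow(2)[of z n] z r2 t Qpos[of z] mult_mono[of "Q z" "Q (\<theta> r)" "1 / z ^ n" "2 ^ n"] by auto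
    then have "(\<theta> r - r) * (Q z / z ^ n) \<le> (\<theta> r - r) * (Q (\<theta> r) * 2 ^ n)"
      by (rule mult_left_mono) (use t in simp)
    then have "v r - u r \<le> (\<theta> r - r) * (Q (\<theta> r) * 2 ^ n)"
      using z(3) t(3) by simp
    also have "\<dots> \<le> ?D r * ((1 + c / p0) * P r * 2 ^ n)"
      using lag(1)[OF r2(1) r(2)] QP t Qpos[of "\<theta> r"] by (intro mult_mono mult_right_mono) auto
    also have "\<dots> = 2 ^ n * (1 + c / p0) * (?D r * P r)" by (simp add: mult_ac)
    also have "\<dots> \<le> 2 ^ n * (1 + c / p0) * (c * (1 - r))"
      using c(5)[OF r] c(1) p0 by (intro mult_left_mono) auto
    finally show "v r - u r \<le> 2 ^ n * (1 + c / p0) * c * (1 - r)" by (simp add: mult_ac)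
  qed (use c in auto)
qed

section \<open>Uniqueness of radial large solutions\<close>

locale semilinear = dirichlet_profile +
  fixes f ft :: "real \<Rightarrow> real"
  assumes mono_ft: "mono ft" and f_eq: "\<And>t. f t = ft t - j\<^sup>2 * t" and f_cont: "continuous_on UNIV f"
begin

text \<open>With \<open>\<phi> r = J (j * r)\<close> and \<open>w' = r * p\<close> this is
  \<open>r\<^sup>n (\<phi> w' - w \<phi>')\<close>, in flux form so that it is regular and zero at
  the origin.\<close>

definition wronskian :: "(real \<Rightarrow> real) \<Rightarrow> (real \<Rightarrow> real) \<Rightarrow> real \<Rightarrow> real" where
  "wronskian w p r = J (j * r) * (r ^ Suc n * p r) - w r * (r ^ Suc n * (j\<^sup>2 * hJ (j * r)))"

lemmas radial_\<phi> = radial_J_scaled[OF j_pos]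

lemma J_j_pos: "0 \<le> r \<Longrightarrow> r < 1 \<Longrightarrow> 0 < J (j * r)"
  using j_pos by (intro J_pos) auto

lemma wronskian_deriv:
  assumes r: "0 < r"
    and w: "(w has_real_derivative r * p r) (at r)" "((\<lambda>s. s ^ Suc n * p s) has_real_derivative r ^ n * G) (at r)"
  shows "(wronskian w p has_real_derivative r ^ n * J (j * r) * (G + j\<^sup>2 * w r)) (at r)"
proof -
  note \<phi> = radialD(3,4)[OF radial_\<phi>[of "r + 1"] r]
  show ?thesis
    unfolding wronskian_def[abs_def]
    by (rule DERIV_cong[OF DERIV_diff[OF DERIV_mult[OF \<phi>(1) w(2)] DERIV_mult[OF w(1) \<phi>(2)]]])
       (simp_all add: algebra_simps)
qed

lemma wronskian_continuous:
  assumes "continuous_on A w" "continuous_on A p" "A \<subseteq> {0..}"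
  shows "continuous_on A (wronskian w p)"
proof -
  have "continuous_on A (\<lambda>r. J (j * r))" "continuous_on A (\<lambda>r. j\<^sup>2 * hJ (j * r))"
  proof -
    have c: "continuous_on {0..} g" if "\<And>X. continuous_on {0..<X} g" for g :: "real \<Rightarrow> real"
      unfolding continuous_on_eq_continuous_within
    proof
      fix x :: real assume "x \<in> {0..}"
      then have "continuous (at x within {0..<x+1}) g"
        using that[of "x + 1"] by (auto simp: continuous_on_eq_continuous_within)
      moreover have "at x within {0..<x+1} = at x within {0..}"
        by (rule at_within_nhd[of _ "{..<x+1}"]) auto
      ultimately show "continuous (at x within {0..}) g" by simp
    qed
    show "continuous_on A (\<lambda>r. J (j * r))" "continuous_on A (\<lambda>r. j\<^sup>2 * hJ (j * r))"
      using c[OF radialD(1)[OF radial_\<phi>]] c[OF radialD(2)[OF radial_\<phi>]] assms(3)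
      by (auto intro: continuous_on_subset)
  qed
  moreover have "continuous_on A (\<lambda>r. \<phi> r * (r ^ Suc n * p r) - w r * (r ^ Suc n * \<kappa> r))"
    if "continuous_on A \<phi>" "continuous_on A \<kappa>" for \<phi> \<kappa> :: "real \<Rightarrow> real"
    using that assms(1,2) by (intro continuous_intros)
  ultimately show ?thesis
    unfolding wronskian_def[abs_def] by blast
qed

text \<open>The eigenfunction contributes exactly the term \<open>j\<^sup>2 * (v r - u r)\<close>
  that turns \<open>f\<close> into the monotone \<open>ft\<close>, so an ordered pair has a
  nondecreasing Wronskian.\<close>

lemma wronskian_diff_deriv:
  assumes u: "radial n f X u h" and v: "radial n f X v k" and r: "0 < r" "r < X"
  shows "(wronskian (\<lambda>r. v r - u r) (\<lambda>r. k r - h r) has_real_derivative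
    r ^ n * J (j * r) * (ft (v r) - ft (u r))) (at r)"
proof -
  have "(wronskian (\<lambda>r. v r - u r) (\<lambda>r. k r - h r) has_real_derivative
    r ^ n * J (j * r) * ((f (v r) - f (u r)) + j\<^sup>2 * (v r - u r))) (at r)"
  proof (rule wronskian_deriv[OF r(1)])
    show "((\<lambda>r. v r - u r) has_real_derivative r * (k r - h r)) (at r)"
      using DERIV_diff[OF radialD(3)[OF v r] radialD(3)[OF u r]] by (simp add: algebra_simps)
    show "((\<lambda>s. s ^ Suc n * (k s - h s)) has_real_derivative r ^ n * (f (v r) - f (u r))) (at r)"
      using DERIV_diff[OF radialD(4)[OF v r] radialD(4)[OF u r]] by (simp add: algebra_simps)
  qed
  then show ?thesis by (simp add: f_eq algebra_simps)
qed

lemma wronskian_diff_mono: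
  assumes u: "radial n f X u h" and v: "radial n f X v k" and X: "X \<le> 1"
    and le: "\<And>r. 0 < r \<Longrightarrow> r < b \<Longrightarrow> u r \<le> v r" and rs: "0 \<le> r" "r \<le> s" "s \<le> b" "s < X"
  shows "wronskian (\<lambda>r. v r - u r) (\<lambda>r. k r - h r) r \<le> wronskian (\<lambda>r. v r - u r) (\<lambda>r. k r - h r) s"
proof (rule DERIV_nonneg_imp_increasing_open[OF rs(2)])
  fix x assume x: "r < x" "x < s"
  then have "0 < x" "x < X" "x < b" "x < 1" using rs X by auto
  then show "\<exists>y. (wronskian (\<lambda>r. v r - u r) (\<lambda>r. k r - h r) has_real_derivative y) (at x) \<and> 0 \<le> y"
    using wronskian_diff_deriv[OF u v, of x] monoD[OF mono_ft le[of x]] J_j_pos[of x]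
    by (intro exI conjI) auto
next
  show "continuous_on {r..s} (wronskian (\<lambda>r. v r - u r) (\<lambda>r. k r - h r))"
    by (intro wronskian_continuous continuous_intros continuous_on_subset[OF radialD(1)[OF u]]
        continuous_on_subset[OF radialD(2)[OF u]] continuous_on_subset[OF radialD(1)[OF v]]
        continuous_on_subset[OF radialD(2)[OF v]]) (use rs in auto)
qed

lemma wronskian_0 [simp]: "wronskian w p 0 = 0"
  by (simp add: wronskian_def)

text \<open>Up to a first contact the Wronskian is nondecreasing from \<open>0\<close>, hence
  nonnegative, which is the sign of the derivative of \<open>(v - u) / \<phi>\<close>. A quotient
  that starts positive and does not decrease cannot reach zero while \<phi> is positive, that is,
  before radius one.\<close>

lemma radial_ordered:
  assumes u: "radial n f X u h" and v: "radial n f X v k" and X: "X \<le> 1"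
    and lt: "u 0 < v 0" and r: "0 \<le> r" "r < X"
  shows "u r < v r"
proof (rule ccontr)
  assume neg: "\<not> u r < v r"
  have cont: "continuous_on {0..r} (\<lambda>r. v r - u r)"
    by (intro continuous_intros continuous_on_subset[OF radialD(1)[OF u]]
        continuous_on_subset[OF radialD(1)[OF v]]) (use r in auto)
  obtain s where s: "0 < s" "s \<le> r" "v s - u s = 0" and pos: "\<And>t. 0 \<le> t \<Longrightarrow> t < s \<Longrightarrow> 0 < v t - u t"
    by (rule first_zero[OF cont]) (use lt neg r in auto)
  have \<phi>pos: "0 < J (j * t)" if "0 \<le> t" "t \<le> s" for t using J_j_pos[of t] that s r X by auto
  have "(v 0 - u 0) / J (j * 0) \<le> (v s - u s) / J (j * s)"
  proof (rule DERIV_nonneg_imp_increasing_open[of 0 s "\<lambda>t. (v t - u t) / J (j * t)"])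
    fix t assume t: "0 < t" "t < s"
    then have tX: "t < X" using s r by auto
    let ?W = "wronskian (\<lambda>r. v r - u r) (\<lambda>r. k r - h r)"
    have "?W 0 \<le> ?W t"
      by (rule wronskian_diff_mono[OF u v X, of s]) (use pos t tX in \<open>auto simp: less_imp_le\<close>)
    then have "0 \<le> t ^ Suc n * (J (j * t) * (k t - h t) - (v t - u t) * (j\<^sup>2 * hJ (j * t)))"
      by (simp add: wronskian_def algebra_simps)
    then have nn: "0 \<le> J (j * t) * (k t - h t) - (v t - u t) * (j\<^sup>2 * hJ (j * t))"
      using zero_less_power[OF t(1), of "Suc n"] by (simp add: zero_le_mult_iff not_le[symmetric] del: power_Suc)
    have "((\<lambda>t. (v t - u t) / J (j * t)) has_real_derivative
        ((t * k t - t * h t) * J (j * t) - (v t - u t) * (t * (j\<^sup>2 * hJ (j * t)))) / (J (j * t) * J (j * t))) (at t)"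
      by (rule DERIV_divide[OF DERIV_diff[OF radialD(3)[OF v] radialD(3)[OF u]] radialD(3)[OF radial_\<phi>[of 1]]])
         (use t tX \<phi>pos[of t] X in auto)
    moreover have "(t * k t - t * h t) * J (j * t) - (v t - u t) * (t * (j\<^sup>2 * hJ (j * t)))
        = t * (J (j * t) * (k t - h t) - (v t - u t) * (j\<^sup>2 * hJ (j * t)))"
      by (simp add: algebra_simps)
    ultimately show "\<exists>y. ((\<lambda>t. (v t - u t) / J (j * t)) has_real_derivative y) (at t) \<and> 0 \<le> y"
      using nn t by (intro exI conjI) auto
  next
    show "continuous_on {0..s} (\<lambda>t. (v t - u t) / J (j * t))"
      by (intro continuous_on_divide continuous_on_subset[OF cont]
          continuous_on_subset[OF radialD(1)[OF radial_\<phi>[of "s + 1"]]]) (use s \<phi>pos in force)+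
  qed (use s in simp)
  then show False using lt s J0 by simp
qed

text \<open>The gap estimate forces the Wronskian of the difference with the eigenfunction to vanish, so
  \<open>ft\<close> takes equal values at \<open>u\<close> and \<open>v\<close>; this is absurd at the last point where \<open>ft\<close> is at most
  \<open>ft (u (1/2))\<close>.\<close>

lemma radial_large_unique:
  assumes u: "radial n f 1 u h" and v: "radial n f 1 v k" and lt: "u 0 < v 0"
    and blow: "filterlim u at_top (at_left 1)"
    and fpos: "\<And>t. u 0 \<le> t \<Longrightarrow> 0 < f t" and u0: "\<And>r. 0 \<le> r \<Longrightarrow> r < 1 \<Longrightarrow> u 0 \<le> u r"
  shows False
proof -
  have uv: "u r < v r" if "0 \<le> r" "r < 1" for r
    using radial_ordered[OF u v _ lt that] by simp
  have hpos: "0 < h r" if r: "0 < r" "r < 1" for r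
  proof -
    obtain \<xi> where "0 < \<xi>" "\<xi> < r" "h r = f (u \<xi>) / real (Suc n)" using radial_average[OF u r] by auto
    then show ?thesis using fpos u0 r by auto
  qed
  have kpos: "0 < k r" if r: "0 < r" "r < 1" for r
  proof -
    obtain \<xi> where "0 < \<xi>" "\<xi> < r" "k r = f (v \<xi>) / real (Suc n)" using radial_average[OF v r] by auto
    then show ?thesis using fpos[of "v \<xi>"] u0[of \<xi>] uv[of \<xi>] r by auto
  qed
  obtain c r1 where c: "0 < r1" "r1 < 1" "\<And>r. r1 \<le> r \<Longrightarrow> r < 1 \<Longrightarrow> v r - u r \<le> c * (1 - r)"
  proof (rule radial_gap[OF u v uv blow hpos kpos])
    show "0 \<le> f (u r)" "0 \<le> f (v r)" if "0 < r" "r < 1" for r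
      using fpos[of "u r"] fpos[of "v r"] u0[of r] uv[of r] that by auto
  qed auto
  have c0: "0 < c"
    using c(3)[of r1] uv[of r1] c by (smt (verit) mult_nonpos_nonneg)
  let ?W = "wronskian (\<lambda>r. v r - u r) (\<lambda>r. k r - h r)"
  have Wmono: "?W r \<le> ?W s" if "0 \<le> r" "r \<le> s" "s < 1" for r s
    using wronskian_diff_mono[OF u v _ _ that(1,2), of 1] uv that by (auto simp: less_imp_le)
  \<comment> \<open>A positive Wronskian stays positive, and near \<open>1\<close> the part
    containing \<open>v - u\<close> is too small to account for it. So \<open>k > h\<close> there
    and \<open>v - u\<close> increases, against \<open>v - u \<le> c * (1 - r)\<close>.\<close>
  have W0: "?W s = 0" if s: "0 < s" "s < 1" for s
  proof (rule ccontr)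
    assume "?W s \<noteq> 0"
    then have \<delta>: "0 < ?W s" using Wmono[of 0 s] s by simp
    have "compact ((\<lambda>r. j\<^sup>2 * hJ (j * r)) ` {0..1})"
      by (intro compact_continuous_image continuous_on_subset[OF radialD(2)[OF radial_\<phi>[of 2]]]) auto
    then have "bounded ((\<lambda>r. j\<^sup>2 * hJ (j * r)) ` {0..1})" by (rule compact_imp_bounded)
    then obtain M where M: "0 < M" "\<And>r. r \<in> {0..1} \<Longrightarrow> \<bar>j\<^sup>2 * hJ (j * r)\<bar> \<le> M"
      unfolding bounded_pos by auto
    \<comment> \<open>Chosen so that \<open>c * (1 - q) * M\<close> is at most half of
      \<open>?W s\<close>.\<close>
    define q where "q = max (max r1 s) (1 - ?W s / (2 * c * M))"
    have q: "r1 \<le> q" "s \<le> q" "q < 1" "1 - q \<le> ?W s / (2 * c * M)"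
      using c s \<delta> c0 M by (auto simp: q_def)
    have kh: "h r < k r" if r: "q \<le> r" "r < 1" for r
    proof -
      have r0: "0 < r" using r q s by auto
      have "(v r - u r) * (r ^ Suc n * \<bar>j\<^sup>2 * hJ (j * r)\<bar>) \<le> (c * (1 - r)) * (1 * M)"
        using c(3)[of r] M(2)[of r] uv[of r] r q r0 c0
        by (intro mult_mono) (auto intro!: power_le_one[of r "Suc n", simplified])
      also have "\<dots> \<le> (c * (?W s / (2 * c * M))) * (1 * M)"
        using q r c0 M by (intro mult_right_mono mult_left_mono) auto
      also have "\<dots> < ?W s" using c0 M \<delta> by (simp add: field_simps)
      also have "\<dots> \<le> ?W r" using Wmono[of s r] s q r by auto
      finally have "(v r - u r) * (r ^ Suc n * \<bar>j\<^sup>2 * hJ (j * r)\<bar>) < ?W r" .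
      moreover have "- ((v r - u r) * (r ^ Suc n * (j\<^sup>2 * hJ (j * r)))) \<le> (v r - u r) * (r ^ Suc n * \<bar>j\<^sup>2 * hJ (j * r)\<bar>)"
        using uv[of r] r r0 abs_ge_minus_self[of "j\<^sup>2 * hJ (j * r)"]
        by (simp only: mult_minus_right[symmetric]) (intro mult_left_mono, auto)
      ultimately have "0 < J (j * r) * (r ^ Suc n * (k r - h r))"
        by (simp add: wronskian_def)
      then show ?thesis
        using J_j_pos[of r] r r0 zero_less_power[OF r0, of "Suc n"]
        by (simp add: zero_less_mult_iff not_less[symmetric] del: power_Suc)
    qed
    have mono: "v q - u q \<le> v r - u r" if r: "q \<le> r" "r < 1" for r
    proof (rule DERIV_nonneg_imp_nondecreasing[OF r(1), of "\<lambda>r. v r - u r"])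
      fix x assume x: "q \<le> x" "x \<le> r"
      then have "0 < x" "x < 1" using q s r by auto
      then show "\<exists>y. ((\<lambda>r. v r - u r) has_real_derivative y) (at x) \<and> 0 \<le> y"
        using DERIV_diff[OF radialD(3)[OF v] radialD(3)[OF u], of x] kh[of x] x r
        by (intro exI[of _ "x * k x - x * h x"]) auto
    qed
    have wq: "0 < v q - u q" using uv[of q] q s by auto
    define r where "r = max q (1 - (v q - u q) / (2 * c))"
    have r: "q \<le> r" "r < 1" "1 - r \<le> (v q - u q) / (2 * c)" using q wq c0 by (auto simp: r_def)
    have "v q - u q \<le> c * (1 - r)" using mono[OF r(1,2)] c(3)[of r] r q by auto
    also have "\<dots> \<le> c * ((v q - u q) / (2 * c))" by (rule mult_left_mono[OF r(3)]) (use c0 in simp)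
    also have "\<dots> = (v q - u q) / 2" using c0 by simp
    finally show False using wq by simp
  qed
  have ft_eq: "ft (v r) = ft (u r)" if r: "0 < r" "r < 1" for r
  proof -
    have "((\<lambda>r. 0) has_real_derivative r ^ n * J (j * r) * (ft (v r) - ft (u r))) (at r)"
      by (rule has_field_derivative_transform_within_open[OF wronskian_diff_deriv[OF u v r], of "{0<..<1}"])
         (use r W0 in auto)
    then have "r ^ n * J (j * r) * (ft (v r) - ft (u r)) = 0"
      using DERIV_unique DERIV_const by blast
    then show ?thesis using r J_j_pos[of r] by simp
  qed
  \<comment> \<open>Starting from the level \<open>u (1/2)\<close> ensures that \<open>u\<close>
    attains \<open>Sup S\<close> at a radius of at least \<open>1/2\<close>, away from the origin,
    so that \<open>ft_eq\<close> applies there. The set is bounded because positivity of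
    \<open>f\<close> means \<open>ft t > j\<^sup>2 * t\<close>.\<close>
  define S where "S = {t. ft t \<le> ft (u (1/2))}"
  have ftc: "continuous_on UNIV ft"
  proof -
    have "continuous_on UNIV (\<lambda>t. f t + j\<^sup>2 * t)" by (intro continuous_intros f_cont)
    then show ?thesis by (simp add: f_eq)
  qed
  have "closed S" unfolding S_def by (intro closed_Collect_le ftc continuous_on_const)
  moreover have mem: "u (1/2) \<in> S" by (simp add: S_def)
  moreover have "bdd_above S"
  proof (rule bdd_aboveI)
    fix t assume "t \<in> S"
    show "t \<le> max (u 0) (ft (u (1/2)) / j\<^sup>2)"
    proof (cases "u 0 \<le> t")
      case True
      then have "j\<^sup>2 * t \<le> ft (u (1/2))" using fpos[OF True] \<open>t \<in> S\<close> by (simp add: S_def f_eq)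
      then show ?thesis using j_pos by (simp add: field_simps le_max_iff_disj)
    qed simp
  qed
  ultimately have \<tau>: "Sup S \<in> S" "u (1/2) \<le> Sup S" and above: "\<And>t. t \<in> S \<Longrightarrow> t \<le> Sup S"
    using closed_contains_Sup[of S] cSup_upper[of _ S] by auto
  have "eventually (\<lambda>s. Sup S \<le> u s) (at_left 1)"
    using blow by (simp add: filterlim_at_top)
  then obtain b where b: "b < 1" "\<And>s. b < s \<Longrightarrow> s < 1 \<Longrightarrow> Sup S \<le> u s"
    unfolding eventually_at_left_field by auto
  define y where "y = (max b (1/2) + 1) / 2"
  have y: "b < y" "1/2 < y" "y < 1" using b by (auto simp: y_def)
  have "\<exists>s\<ge>1/2. s \<le> y \<and> u s = Sup S"
    by (rule IVT') (use \<tau> b(2)[OF y(1,3)] y in \<open>auto intro!: continuous_on_subset[OF radialD(1)[OF u]]\<close>)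
  then obtain r where r: "1/2 \<le> r" "r \<le> y" "u r = Sup S" by auto
  have "v r \<in> S" using ft_eq[of r] r y \<tau>(1) by (simp add: S_def)
  then show False using above uv[of r] r y by fastforce
qed

end

section \<open>Solutions with very negative initial value\<close>

context dirichlet_profile
begin

lemma \<phi>_flux_neg:
  assumes "0 < r" "r \<le> 1"
  shows "j\<^sup>2 * hJ (j * r) < 0"
proof -
  obtain \<xi> where \<xi>: "0 < \<xi>" "\<xi> < r" "j\<^sup>2 * hJ (j * r) = - (j\<^sup>2 * J (j * \<xi>)) / real (Suc n)"
    using radial_average[OF radial_J_scaled[OF j_pos, of "r + 1"] assms(1)] by auto
  moreover have "0 < J (j * \<xi>)" using \<xi> assms j_pos by (intro J_pos) auto
  ultimately show ?thesis using j_pos by (simp add: divide_neg_pos)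
qed

lemma \<phi>_decreasing:
  assumes "0 \<le> r" "r \<le> s" "s \<le> 1"
  shows "J (j * s) \<le> J (j * r)"
proof -
  note rad = radial_J_scaled[OF j_pos, of 2]
  have "- J (j * r) \<le> - J (j * s)"
  proof (rule DERIV_nonneg_imp_increasing_open[OF assms(2), of "\<lambda>r. - J (j * r)"])
    fix x assume "r < x" "x < s"
    then have x: "0 < x" "x < 2" "x \<le> 1" using assms by auto
    show "\<exists>y. ((\<lambda>r. - J (j * r)) has_real_derivative y) (at x) \<and> 0 \<le> y"
      using DERIV_minus[OF radialD(3)[OF rad x(1,2)]] mult_pos_neg[OF x(1) \<phi>_flux_neg[OF x(1,3)]]
      by (intro exI conjI) (assumption, linarith)
  qed (intro continuous_on_minus continuous_on_subset[OF radialD(1)[OF rad]], use assms in auto)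
  then show ?thesis by simp
qed

text \<open>A quantitative Hopf lemma. \<open>Q\<close> is \<open>r\<^sup>n \<phi>'\<close>,
  nonincreasing because \<phi> is nonnegative, so beyond \<open>1/2\<close> the slope of \<phi> is
  at most the negative constant \<open>Q (1/2)\<close>; integrate back from the zero at
  \<open>1\<close>.\<close>

lemma \<phi>_hopf:
  obtains q where "0 < q" "\<And>r. 1 / 2 \<le> r \<Longrightarrow> r \<le> 1 \<Longrightarrow> q * (1 - r) \<le> J (j * r)"
proof -
  note rad = radial_J_scaled[OF j_pos, of 2]
  define Q where "Q r = r ^ Suc n * (j\<^sup>2 * hJ (j * r))" for r
  have dQ: "(Q has_real_derivative r ^ n * - (j\<^sup>2 * J (j * r))) (at r)" if "0 < r" "r < 2" for r
    unfolding Q_def using radialD(4)[OF rad that] .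
  have Qneg: "Q (1/2) < 0" using \<phi>_flux_neg[of "1/2"] by (simp add: Q_def mult_less_0_iff)
  have Qle: "Q r \<le> Q (1/2)" if r: "1/2 \<le> r" "r \<le> 1" for r
  proof -
    have "- Q (1/2) \<le> - Q r"
    proof (rule DERIV_nonneg_imp_nondecreasing[OF r(1), of "\<lambda>r. - Q r"])
      fix x assume x: "1/2 \<le> x" "x \<le> r"
      then have "0 \<le> J (j * x)"
        using J_pos[of "j * x"] J_j j_pos r by (cases "x = 1") (auto simp: less_imp_le)
      then show "\<exists>y. ((\<lambda>r. - Q r) has_real_derivative y) (at x) \<and> 0 \<le> y"
        using DERIV_minus[OF dQ[of x]] x r by (intro exI[of _ "x ^ n * (j\<^sup>2 * J (j * x))"]) auto
    qed
    then show ?thesis by simp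
  qed
  show ?thesis
  proof (rule that[of "- Q (1/2)"])
    fix r :: real assume r: "1/2 \<le> r" "r \<le> 1"
    have "- (J (j * r) - Q (1/2) * r) \<le> - (J (j * 1) - Q (1/2) * 1)"
    proof (rule DERIV_nonneg_imp_nondecreasing[OF r(2), of "\<lambda>r. - (J (j * r) - Q (1/2) * r)"])
      fix x assume x: "r \<le> x" "x \<le> 1"
      then have x1: "0 < x" "x < 2" using r by auto
      have "((\<lambda>r. - (J (j * r) - Q (1/2) * r)) has_real_derivative - (x * (j\<^sup>2 * hJ (j * x)) - Q (1/2))) (at x)"
        by (rule DERIV_minus[OF DERIV_diff[OF radialD(3)[OF rad x1] DERIV_cmult_Id]])
      moreover have "x * (j\<^sup>2 * hJ (j * x)) \<le> Q x"
      proof -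
        have "0 \<le> x * - (j\<^sup>2 * hJ (j * x))"
          using mult_pos_neg[OF x1(1) \<phi>_flux_neg[OF x1(1) x(2)]] by linarith
        then have "x ^ n * (x * - (j\<^sup>2 * hJ (j * x))) \<le> 1 * (x * - (j\<^sup>2 * hJ (j * x)))"
          using x x1 by (intro mult_right_mono power_le_one) auto
        then show ?thesis by (simp add: Q_def mult_ac)
      qed
      ultimately show "\<exists>y. ((\<lambda>r. - (J (j * r) - Q (1/2) * r)) has_real_derivative y) (at x) \<and> 0 \<le> y"
        using Qle[of x] x r by (intro exI conjI) (assumption, linarith)
    qed
    then show "- Q (1/2) * (1 - r) \<le> J (j * r)" using J_j by (simp add: algebra_simps)
  qed (use Qneg in simp)
qed

end

lemma radial_const:
  assumes "f z = 0"
  shows "radial n f X (\<lambda>_. z) (\<lambda>_. 0)"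
  using assms unfolding radial_def by simp

locale semilinear_C1 = semilinear +
  assumes f_lip: "\<And>p q. \<exists>L>0. \<forall>s\<in>{p..q}. \<forall>t\<in>{p..q}. \<bar>f s - f t\<bar> \<le> L * \<bar>s - t\<bar>"
begin

lemma truncation_lipschitz:
  fixes p q :: real
  assumes "p \<le> q"
  obtains L where "0 < L" "\<And>s t. \<bar>f (max p (min q s)) - f (max p (min q t))\<bar> \<le> L * \<bar>s - t\<bar>"
proof -
  obtain L where L: "L > 0" "\<And>s t. s \<in> {p..q} \<Longrightarrow> t \<in> {p..q} \<Longrightarrow> \<bar>f s - f t\<bar> \<le> L * \<bar>s - t\<bar>"
    using f_lip[of p q] by blast
  show ?thesis
  proof (rule that[OF L(1)])
    fix s t
    have "\<bar>f (max p (min q s)) - f (max p (min q t))\<bar> \<le> L * \<bar>max p (min q s) - max p (min q t)\<bar>"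
      by (rule L(2)) (use assms in auto)
    also have "\<dots> \<le> L * \<bar>s - t\<bar>" using L(1) by (intro mult_left_mono) auto
    finally show "\<bar>f (max p (min q s)) - f (max p (min q t))\<bar> \<le> L * \<bar>s - t\<bar>" .
  qed
qed

text \<open>The borderline case: starting from a very negative value \<open>b\<close>, the solution behaves like
  \<open>b \<phi>\<close> and reaches the level \<open>0\<close> at a distance \<open>d\<close> from the boundary with a slope of order at most
  \<open>1 / d\<close>, so that it grows only by a bounded amount on the remaining interval.\<close>

lemma radial_subsolution_start:
  assumes f_pos: "\<And>t. 0 < f t"
  obtains b X u h where "1 < X" "radial n f X u h" "u 0 = b" "\<And>r. 0 \<le> r \<Longrightarrow> r < X \<Longrightarrow> b \<le> u r"
proof -
  obtain q where q: "0 < q" "\<And>r. 1 / 2 \<le> r \<Longrightarrow> r \<le> 1 \<Longrightarrow> q * (1 - r) \<le> J (j * r)"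
    using \<phi>_hopf by blast
  define c where "c = f 0"
  have c: "0 < c" "c = ft 0" using f_pos[of 0] by (simp_all add: c_def f_eq)
  \<comment> \<open>One more than the bound on \<open>u 1\<close> obtained at the end, so that the
    truncation at \<open>K\<close> is never felt up to radius one.\<close>
  define K where "K = 2 ^ n * (c / q + 1) + 1"
  have K: "0 < K" using c q by (simp add: K_def add_pos_pos)
  have "compact (f ` {0..K})" by (intro compact_continuous_image continuous_on_subset[OF f_cont]) auto
  then have "bounded (f ` {0..K})" by (rule compact_imp_bounded)
  then obtain M where M: "0 < M" "\<And>t. t \<in> {0..K} \<Longrightarrow> f t \<le> M"
    unfolding bounded_pos by (auto simp: abs_le_iff)
  define d where "d = min (1/2) (1 / M)"
  have d: "0 < d" "d \<le> 1/2" "M * d \<le> 1" using M by (auto simp: d_def min_def field_simps)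
  define \<phi>0 where "\<phi>0 = J (j * (1 - d))"
  have \<phi>0: "0 < \<phi>0" unfolding \<phi>0_def using d by (intro J_j_pos) auto
  \<comment> \<open>If \<open>u\<close> crossed zero before \<open>1 - d\<close>, integrating
    \<open>(u / \<phi>)' \<le> c / \<phi>0\<^sup>2\<close> would give
    \<open>- b \<le> c / \<phi>0\<^sup>2\<close>; this choice excludes it.\<close>
  define b where "b = - (c / \<phi>0\<^sup>2) - 1"
  have "0 < c / \<phi>0\<^sup>2" using c \<phi>0 by (intro divide_pos_pos) auto
  then have b: "b < 0" unfolding b_def by linarith
  have bK: "b \<le> K" using b K by simp
  define g where "g t = f (max b (min K t))" for t
  obtain L where L: "0 < L" "\<And>s t. \<bar>g s - g t\<bar> \<le> L * \<bar>s - t\<bar>"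
    unfolding g_def using truncation_lipschitz[OF bK] by blast
  obtain u h where u0: "u 0 = b" and rad: "\<And>X. radial n g X u h"
    using radial_exists_lipschitz[OF L] by metis
  have h: "0 \<le> h r" if "0 < r" for r
    using radial_flux_nonneg[OF rad[of "r + 1"], of r] f_pos that unfolding g_def by (auto simp: less_imp_le)
  have mono: "u r \<le> u s" if "0 \<le> r" "r \<le> s" for r s
    by (rule radial_nondecreasing[OF rad[of "s + 1"]]) (use that h in auto)
  have ub: "b \<le> u r" if "0 \<le> r" for r using mono[of 0 r] that u0 by simp
  have cu: "continuous_on {0..X} u" and ch: "continuous_on {0..X} h" for X
    using radialD(1,2)[OF rad[of "X + 1"]] by (auto intro: continuous_on_subset)
  have dP: "((\<lambda>s. s ^ Suc n * h s) has_real_derivative r ^ n * g (u r)) (at r)" if "0 < r" for r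
    using radialD(4)[OF rad[of "r + 1"] that] by simp
  have du: "(u has_real_derivative r * h r) (at r)" if "0 < r" for r
    using radialD(3)[OF rad[of "r + 1"] that] by simp
  have "u 1 < K"
  proof (rule ccontr)
    assume "\<not> u 1 < K"
    then have u1: "0 < u 1" using K by simp
    have cm: "continuous_on {0..1} (\<lambda>r. - u r)" by (intro continuous_intros cu)
    obtain p where p: "0 < p" "p \<le> 1" "- u p = 0" and neg: "\<And>r. 0 \<le> r \<Longrightarrow> r < p \<Longrightarrow> 0 < - u r"
      by (rule first_zero[OF cm]) (use u0 b u1 in auto)
    have p1: "p < 1" using p u1 by (cases "p = 1") auto
    let ?W = "wronskian u h"
    \<comment> \<open>At nonpositive levels
      \<open>f t + j\<^sup>2 * t = ft t \<le> ft 0 = c\<close>, so the Wronskian grows at a rate of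
      at most \<open>c * r ^ n\<close>.\<close>
    have W: "?W r \<le> c * r ^ Suc n" if r: "0 < r" "r \<le> p" for r
    proof -
      have "c * 0 ^ Suc n - ?W 0 \<le> c * r ^ Suc n - ?W r"
      proof (rule DERIV_nonneg_imp_increasing_open[of 0 r "\<lambda>r. c * r ^ Suc n - ?W r"])
        fix x assume x: "0 < x" "x < r"
        have ux: "b \<le> u x" "u x < 0" using ub[of x] neg[of x] x r by auto
        then have gx: "g (u x) + j\<^sup>2 * u x = ft (u x)" using K by (simp add: g_def f_eq max_def min_def)
        have \<phi>x: "0 < J (j * x)" "J (j * x) \<le> 1"
          using J_j_pos[of x] \<phi>_decreasing[of 0 x] J0 x r p by auto
        have "ft (u x) \<le> c" using monoD[OF mono_ft, of "u x" 0] ux c by simp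
        then have "J (j * x) * ft (u x) \<le> J (j * x) * c" using \<phi>x by (intro mult_left_mono) auto
        also have "\<dots> \<le> 1 * c" using \<phi>x c by (intro mult_right_mono) auto
        finally have "x ^ n * (J (j * x) * ft (u x)) \<le> x ^ n * c" using x by (intro mult_left_mono) auto
        also have "\<dots> \<le> (1 + real n) * x ^ n * c" using x c by (intro mult_right_mono) (auto simp: mult_le_cancel_right1)
        finally have "0 \<le> c * (real (Suc n) * x ^ n) - x ^ n * J (j * x) * (g (u x) + j\<^sup>2 * u x)"
          unfolding gx by (simp add: algebra_simps)
        moreover have "((\<lambda>r. c * r ^ Suc n - ?W r) has_real_derivative
            c * (real (Suc n) * x ^ n) - x ^ n * J (j * x) * (g (u x) + j\<^sup>2 * u x)) (at x)"
          using DERIV_diff[OF DERIV_cmult[OF DERIV_pow[of "Suc n" x], of c] wronskian_deriv[OF x(1) du[OF x(1)] dP[OF x(1)]]]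
          by simp
        ultimately show "\<exists>y. ((\<lambda>r. c * r ^ Suc n - ?W r) has_real_derivative y) (at x) \<and> 0 \<le> y" by blast
      next
        show "continuous_on {0..r} (\<lambda>r. c * r ^ Suc n - ?W r)"
          by (intro continuous_on_diff continuous_on_mult continuous_on_const continuous_on_power continuous_on_id
              wronskian_continuous cu ch) auto
      qed (use r in simp)
      then show ?thesis by simp
    qed
    have p_large: "1 - d < p"
    proof (rule ccontr)
      assume "\<not> 1 - d < p"
      then have pd: "p \<le> 1 - d" by simp
      have \<phi>l: "\<phi>0 \<le> J (j * x)" if "0 \<le> x" "x \<le> p" for x
        unfolding \<phi>0_def using \<phi>_decreasing[of x "1 - d"] that pd d by auto
      have "c / \<phi>0\<^sup>2 * 0 - u 0 / J (j * 0) \<le> c / \<phi>0\<^sup>2 * p - u p / J (j * p)"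
      proof (rule DERIV_nonneg_imp_increasing_open[of 0 p "\<lambda>r. c / \<phi>0\<^sup>2 * r - u r / J (j * r)"])
        fix x assume x: "0 < x" "x < p"
        have \<phi>x: "0 < J (j * x)" using \<phi>l[of x] \<phi>0 x by auto
        have "((\<lambda>r. c / \<phi>0\<^sup>2 * r - u r / J (j * r)) has_real_derivative
            c / \<phi>0\<^sup>2 - ((x * h x) * J (j * x) - u x * (x * (j\<^sup>2 * hJ (j * x)))) / (J (j * x) * J (j * x))) (at x)"
          by (rule DERIV_diff[OF DERIV_cmult_Id DERIV_divide[OF du[OF x(1)] radialD(3)[OF radial_\<phi>[of 1] x(1)]]])
             (use x p1 \<phi>x in auto)
        moreover have "((x * h x) * J (j * x) - u x * (x * (j\<^sup>2 * hJ (j * x)))) / (J (j * x) * J (j * x)) \<le> c / \<phi>0\<^sup>2"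
        proof -
          have "x ^ n * ((x * h x) * J (j * x) - u x * (x * (j\<^sup>2 * hJ (j * x)))) = ?W x"
            by (simp add: wronskian_def algebra_simps)
          also have "\<dots> \<le> x ^ n * (c * x)" using W[of x] x by (simp add: mult_ac)
          finally have "(x * h x) * J (j * x) - u x * (x * (j\<^sup>2 * hJ (j * x))) \<le> c * x"
            using x by (simp add: mult_le_cancel_left_pos)
          also have "\<dots> \<le> c" using x p c by (simp add: mult_left_le)
          finally have "((x * h x) * J (j * x) - u x * (x * (j\<^sup>2 * hJ (j * x)))) / (J (j * x) * J (j * x))
              \<le> c / (J (j * x) * J (j * x))" by (intro divide_right_mono) auto
          also have "\<dots> \<le> c / \<phi>0\<^sup>2"
            unfolding power2_eq_square using c \<phi>0 \<phi>l[of x] x by (intro divide_left_mono mult_mono mult_pos_pos) auto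
          finally show ?thesis .
        qed
        ultimately show "\<exists>y. ((\<lambda>r. c / \<phi>0\<^sup>2 * r - u r / J (j * r)) has_real_derivative y) (at x) \<and> 0 \<le> y"
          by (intro exI conjI) (assumption, linarith)
      next
        have nz: "J (j * x) \<noteq> 0" if "x \<in> {0..p}" for x using \<phi>l[of x] \<phi>0 that by auto
        show "continuous_on {0..p} (\<lambda>r. c / \<phi>0\<^sup>2 * r - u r / J (j * r))"
          by (intro continuous_on_diff continuous_on_mult continuous_on_const continuous_on_id continuous_on_divide cu
              continuous_on_subset[OF radialD(1)[OF radial_\<phi>[of 1]]]) (use nz p1 in auto)
      qed (use p in simp)
      then have "- b \<le> c / \<phi>0\<^sup>2 * p" using u0 J0 p by simp
      also have "\<dots> \<le> c / \<phi>0\<^sup>2 * 1" using c p by (intro mult_left_mono) auto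
      finally show False by (simp add: b_def)
    qed
    define e where "e = 1 - p"
    have e: "0 < e" "e \<le> d" "1/2 \<le> p" using p1 p_large d by (auto simp: e_def)
    define B where "B = c / (q * e) + M * e"
    have B0: "0 \<le> B" using c q e M by (simp add: B_def)
    \<comment> \<open>At the zero of \<open>u\<close> the Wronskian is \<phi> times the flux, and
      the Hopf bound \<open>J (j * p) \<ge> q * e\<close> turns its estimate into a flux of order
      \<open>1 / e\<close>.\<close>
    have Pp: "p ^ Suc n * h p \<le> c / (q * e)"
    proof -
      have "J (j * p) * (p ^ Suc n * h p) \<le> c * p ^ Suc n" using W[of p] p by (simp add: wronskian_def)
      also have "\<dots> \<le> c * 1" using c p power_le_one[of p "Suc n"] by (intro mult_left_mono) auto
      finally have "J (j * p) * (p ^ Suc n * h p) \<le> c" by simp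
      moreover have "q * e * (p ^ Suc n * h p) \<le> J (j * p) * (p ^ Suc n * h p)"
        using q(2)[of p] e p h[of p] by (intro mult_right_mono) (auto simp: e_def)
      ultimately have "q * e * (p ^ Suc n * h p) \<le> c" by linarith
      then show ?thesis using q(1) e by (simp add: pos_le_divide_eq mult_ac)
    qed
    have PB: "r ^ Suc n * h r \<le> B" if r: "p \<le> r" "r \<le> 1" for r
    proof -
      have "M * p - p ^ Suc n * h p \<le> M * r - r ^ Suc n * h r"
      proof (rule DERIV_nonneg_imp_nondecreasing[OF r(1), of "\<lambda>r. M * r - r ^ Suc n * h r"])
        fix x assume x: "p \<le> x" "x \<le> r"
        then have x0: "0 < x" "x \<le> 1" using p r by auto
        have "0 \<le> u x" using mono[of p x] x p by auto
        then have "g (u x) \<le> M" unfolding g_def using b K by (intro M) (auto simp: max_def min_def)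
        moreover have "0 \<le> g (u x)" using f_pos by (simp add: g_def less_imp_le)
        ultimately have "x ^ n * g (u x) \<le> 1 * M"
          using x0 by (intro mult_mono) (auto intro: power_le_one)
        then show "\<exists>y. ((\<lambda>r. M * r - r ^ Suc n * h r) has_real_derivative y) (at x) \<and> 0 \<le> y"
          using DERIV_diff[OF DERIV_cmult_Id dP[OF x0(1)], of M] by (intro exI conjI) (assumption, linarith)
      qed
      moreover have "M * (r - p) \<le> M * e" using M r by (intro mult_left_mono) (auto simp: e_def)
      ultimately show ?thesis using Pp unfolding B_def by (simp add: algebra_simps)
    qed
    have "2 ^ n * B * p - u p \<le> 2 ^ n * B * 1 - u 1"
    proof (rule DERIV_nonneg_imp_nondecreasing[OF p(2), of "\<lambda>r. 2 ^ n * B * r - u r"])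
      fix x assume x: "p \<le> x" "x \<le> 1"
      then have x0: "0 < x" "1/2 \<le> x" using p e by auto
      have "(1/2) ^ n * (x * h x) \<le> x ^ n * (x * h x)"
        using x0 h[OF x0(1)] by (intro mult_right_mono power_mono) auto
      also have "\<dots> \<le> B" using PB[OF x] by (simp add: mult_ac)
      finally have "x * h x \<le> 2 ^ n * B" by (simp add: power_one_over field_simps)
      then show "\<exists>y. ((\<lambda>r. 2 ^ n * B * r - u r) has_real_derivative y) (at x) \<and> 0 \<le> y"
        using DERIV_diff[OF DERIV_cmult_Id du[OF x0(1)], of "2 ^ n * B"] by (intro exI conjI) (assumption, linarith)
    qed
    then have "u 1 \<le> 2 ^ n * (B * e)" using p by (simp add: e_def algebra_simps)
    \<comment> \<open>The factor \<open>1 / e\<close> in the flux is cancelled by the length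
      \<open>e\<close> of the remaining interval; linear vanishing of \<phi> is just enough for
      this.\<close>
    also have "B * e = c / q + M * e * e" using q e by (simp add: B_def field_simps)
    also have "M * e * e \<le> (M * d) * 1" using M e d by (intro mult_mono) auto
    also have "\<dots> \<le> 1" using d by simp
    finally have "u 1 \<le> 2 ^ n * (c / q + 1)" by simp
    then show False using \<open>\<not> u 1 < K\<close> by (simp add: K_def)
  qed
  have "continuous_on {0..2} u" by (rule cu)
  then have "isCont u 1" by (rule continuous_on_interior) simp
  then have "eventually (\<lambda>r. u r < K) (at 1)" using \<open>u 1 < K\<close> by (auto simp: isCont_def intro: order_tendstoD)
  then obtain s where s: "1 < s" "u s < K"
    unfolding eventually_at dist_real_def
    by (metis (no_types) add.commute add_diff_cancel_left' abs_of_pos dense less_add_same_cancel1 UNIV_I less_irrefl)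
  have "radial n f s u h"
  proof (rule radial_cong_rhs[OF rad])
    fix r assume "0 < r" "r < s"
    then have "b \<le> u r" "u r < K" using ub[of r] mono[of r s] s by auto
    then show "g (u r) = f (u r)" by (simp add: g_def max_def min_def)
  qed
  then show ?thesis by (intro that[of s u h b]) (use s u0 ub in auto)
qed

end

section \<open>The Keller--Osserman condition\<close>

locale keller = semilinear +
  fixes a :: real
  assumes f_a: "0 < f a" and f_nonneg: "\<And>t. a < t \<Longrightarrow> 0 \<le> f t" and KO: "keller_osserman a f"
begin

definition F where "F t = integral {a..t} f"

lemma F_deriv:
  assumes "a < t"
  shows "(F has_real_derivative f t) (at t)"
proof -
  have "((\<lambda>x. integral {a..x} f) has_real_derivative f t) (at t within {a..t + 1})"
    by (rule integral_has_real_derivative) (use assms in \<open>auto intro: continuous_on_subset[OF f_cont]\<close>)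
  then show ?thesis
    using assms at_within_Icc_at[of a t "t + 1"] by (simp add: F_def[abs_def])
qed

lemma F_continuous: "continuous_on {a..t} F"
  unfolding F_def[abs_def]
  by (intro indefinite_integral_continuous_1 integrable_continuous_real continuous_on_subset[OF f_cont]) simp

lemma F_mvt:
  assumes "a \<le> s" "s < t"
  obtains \<xi> where "s < \<xi>" "\<xi> < t" "F t - F s = (t - s) * f \<xi>"
proof -
  have "\<exists>l z. s < z \<and> z < t \<and> (F has_real_derivative l) (at z) \<and> F t - F s = (t - s) * l"
  proof (rule MVT[OF assms(2)])
    show "continuous_on {s..t} F" by (rule continuous_on_subset[OF F_continuous[of t]]) (use assms in auto)
    show "F differentiable (at x)" if "s < x" "x < t" for x
      using F_deriv[of x] that assms unfolding real_differentiable_def by auto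
  qed
  then obtain l z where z: "s < z" "z < t" "(F has_real_derivative l) (at z)" "F t - F s = (t - s) * l"
    by auto
  have "l = f z" using DERIV_unique[OF z(3) F_deriv] z assms by auto
  then show ?thesis using that z by auto
qed

lemma F_a: "F a = 0" by (simp add: F_def)

lemma F_mono:
  assumes "a \<le> s" "s \<le> t"
  shows "F s \<le> F t"
proof (cases "s = t")
  case False
  then obtain \<xi> where "s < \<xi>" "\<xi> < t" "F t - F s = (t - s) * f \<xi>" using F_mvt[of s t] assms by auto
  moreover have "0 \<le> (t - s) * f \<xi>" using f_nonneg[of \<xi>] calculation assms by auto
  ultimately show ?thesis by linarith
qed simp

lemma F_pos:
  assumes "a < t"
  shows "0 < F t"
proof -
  have "isCont f a" using f_cont by (simp add: continuous_on_eq_continuous_at)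
  then obtain d where d: "d > 0" "\<And>s. \<bar>s - a\<bar> < d \<Longrightarrow> \<bar>f s - f a\<bar> < f a"
    using f_a unfolding continuous_at_eps_delta dist_real_def by blast
  define s where "s = min t (a + d / 2)"
  have s: "a < s" "s \<le> t" "s < a + d" using assms d by (auto simp: s_def)
  obtain \<xi> where \<xi>: "a < \<xi>" "\<xi> < s" "F s - F a = (s - a) * f \<xi>" using F_mvt[of a s] s by auto
  have "0 < f \<xi>" using d(2)[of \<xi>] \<xi> s by auto
  then have "0 < F s" using \<xi> s F_a by simp
  then show ?thesis using F_mono[of s t] s by auto
qed

text \<open>Recasts the convergent integral as a primitive with a finite limit, which can be
  composed with a solution and differentiated along it.\<close>

lemma keller_osserman_primitive:
  obtains T L l where "a < T" "\<And>t. T < t \<Longrightarrow> (L has_real_derivative 1 / sqrt (F t)) (at t)" "(L \<longlongrightarrow> l) at_top"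
proof -
  obtain T where T: "a < T" "set_integrable lborel {T..} (\<lambda>t. 1 / sqrt (F t))"
    using KO unfolding keller_osserman_def F_def[symmetric] by auto
  define L where "L t = integral {T..t} (\<lambda>t. 1 / sqrt (F t))" for t
  have gc: "continuous_on {T..t} (\<lambda>t. 1 / sqrt (F t))" for t
  proof (intro continuous_intros continuous_on_subset[OF F_continuous[of t]] ballI)
    show "sqrt (F x) \<noteq> 0" if "x \<in> {T..t}" for x using F_pos[of x] T that by auto
  qed (use T in auto)
  show ?thesis
  proof (rule that[OF T(1)])
    fix t assume t: "T < t"
    have "(L has_real_derivative 1 / sqrt (F t)) (at t within {T..t + 1})"
      unfolding L_def[abs_def] by (rule integral_has_real_derivative[OF gc]) (use t in auto)
    then show "(L has_real_derivative 1 / sqrt (F t)) (at t)"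
      using t at_within_Icc_at[of T t "t + 1"] by simp
  next
    have "((\<lambda>b. set_lebesgue_integral lborel {T..b} (\<lambda>t. 1 / sqrt (F t))) \<longlongrightarrow>
        set_lebesgue_integral lborel {T..} (\<lambda>t. 1 / sqrt (F t))) at_top"
      by (rule tendsto_set_lebesgue_integral_at_top[OF _ T(2)]) simp
    moreover have "set_lebesgue_integral lborel {T..b} (\<lambda>t. 1 / sqrt (F t)) = L b" for b
      unfolding L_def by (rule set_borel_integral_eq_integral(2), rule set_integrable_subset[OF T(2)]) auto
    ultimately show "(L \<longlongrightarrow> set_lebesgue_integral lborel {T..} (\<lambda>t. 1 / sqrt (F t))) at_top" by simp
  qed
qed

lemma keller_osserman_tail:
  obtains L where "\<And>\<epsilon>. 0 < \<epsilon> \<Longrightarrow> \<exists>M>a. \<forall>t>M. (L has_real_derivative 1 / sqrt (F t)) (at t) \<and>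
    (\<forall>s>M. \<bar>L s - L t\<bar> < \<epsilon>)"
proof -
  obtain T L l where L: "a < T" "\<And>t. T < t \<Longrightarrow> (L has_real_derivative 1 / sqrt (F t)) (at t)" "(L \<longlongrightarrow> l) at_top"
    using keller_osserman_primitive by blast
  show ?thesis
  proof (rule that)
    fix \<epsilon> :: real assume "0 < \<epsilon>"
    then have "eventually (\<lambda>t. dist (L t) l < \<epsilon> / 2) at_top" using tendstoD[OF L(3), of "\<epsilon> / 2"] by simp
    then obtain M where M: "\<And>t. M \<le> t \<Longrightarrow> dist (L t) l < \<epsilon> / 2" by (auto simp: eventually_at_top_linorder)
    show "\<exists>M>a. \<forall>t>M. (L has_real_derivative 1 / sqrt (F t)) (at t) \<and> (\<forall>s>M. \<bar>L s - L t\<bar> < \<epsilon>)"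
    proof (intro exI[of _ "max M T"] conjI allI impI)
      fix t s assume "max M T < t" "max M T < s"
      then have "\<bar>L t - l\<bar> < \<epsilon> / 2" "\<bar>L s - l\<bar> < \<epsilon> / 2" using M[of t] M[of s] by (auto simp: dist_real_def)
      then show "\<bar>L s - L t\<bar> < \<epsilon>" by linarith
    qed (use L in auto)
  qed
qed

text \<open>A substitute for monotonicity of \<open>f\<close>: only \<open>ft\<close> is monotone,
  and above \<open>a\<close> the linear term costs at most
  \<open>j\<^sup>2 * \<bar>a\<bar>\<close>.\<close>

lemma f_le_ft:
  assumes "a < s" "s \<le> t"
  shows "f s \<le> ft t + j\<^sup>2 * \<bar>a\<bar>"
proof -
  have "f s \<le> ft t - j\<^sup>2 * s" using monoD[OF mono_ft assms(2)] by (simp add: f_eq)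
  moreover have "- (j\<^sup>2 * s) \<le> j\<^sup>2 * \<bar>a\<bar>"
    using mult_left_mono[of "- s" "\<bar>a\<bar>" "j\<^sup>2"] assms by auto
  ultimately show ?thesis by linarith
qed

text \<open>Over \<open>{t/2..t}\<close> the convergent integral contributes at least
  \<open>t / (2 * sqrt (F t))\<close>, which must be small, so \<open>F t\<close> exceeds every
  multiple of \<open>t\<^sup>2\<close>. Since \<open>F t\<close> is at most of order
  \<open>t * ft t\<close> up to a correction, \<open>ft\<close> and then \<open>f\<close> exceed
  every multiple of \<open>t\<close>.\<close>

lemma f_superlinear: "\<exists>M. \<forall>t\<ge>M. K * t \<le> f t"
proof -
  \<comment> \<open>The extra \<open>2 * j\<^sup>2\<close> pays for the linear term in
    \<open>f_eq\<close> and for the correction in \<open>f_le_ft\<close>.\<close>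
  define K' where "K' = \<bar>K\<bar> + 2 * j\<^sup>2 + 1"
  have K': "1 \<le> K'" "K + 2 * j\<^sup>2 \<le> K'" using j_pos by (auto simp: K'_def)
  define \<epsilon> where "\<epsilon> = 1 / (4 * K')"
  have "0 < \<epsilon>" using K' by (simp add: \<epsilon>_def)
  obtain L M where M: "a < M" "\<And>t. M < t \<Longrightarrow> (L has_real_derivative 1 / sqrt (F t)) (at t)"
    "\<And>t s. M < t \<Longrightarrow> M < s \<Longrightarrow> \<bar>L s - L t\<bar> < \<epsilon>"
    using keller_osserman_tail \<open>0 < \<epsilon>\<close> by (metis (no_types, lifting))
  show ?thesis
  proof (intro exI[of _ "2 * \<bar>M\<bar> + \<bar>a\<bar> + 1"] allI impI)
    fix t assume t: "2 * \<bar>M\<bar> + \<bar>a\<bar> + 1 \<le> t"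
    then have tM: "M < t / 2" "t / 2 < t" "0 < t" "\<bar>a\<bar> < t" "a < t" by auto
    obtain z where z: "t / 2 < z" "z < t" "L t - L (t / 2) = (t - t / 2) * (1 / sqrt (F z))"
      using MVT2[OF tM(2), of L "\<lambda>t. 1 / sqrt (F t)"] M(2) tM(1) by force
    have az: "a < z" using z tM M by linarith
    have Ft: "0 < F t" "0 < F z" "F z \<le> F t" using F_pos F_mono[of z t] az tM z by auto
    have "t / 2 / sqrt (F t) \<le> (t - t / 2) * (1 / sqrt (F z))"
      using Ft tM by (auto intro!: divide_left_mono)
    also have "\<dots> < \<epsilon>" using M(3)[of "t / 2" t] tM unfolding z(3)[symmetric] by linarith
    finally have "t / 2 < \<epsilon> * sqrt (F t)" using Ft by (simp add: field_simps)
    then have "2 * K' * t < sqrt (F t)" using K' by (simp add: \<epsilon>_def field_simps)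
    then have "(2 * K' * t)\<^sup>2 < (sqrt (F t))\<^sup>2" using K' tM by (intro power_strict_mono) auto
    then have F1: "4 * K'\<^sup>2 * t\<^sup>2 < F t" using Ft by (simp add: power_mult_distrib)
    obtain \<xi> where \<xi>: "a < \<xi>" "\<xi> < t" "F t - F a = (t - a) * f \<xi>" using F_mvt[of a t] tM by auto
    have f\<xi>: "f \<xi> \<le> ft t + j\<^sup>2 * \<bar>a\<bar>" using f_le_ft[of \<xi> t] \<xi> by auto
    have "F t \<le> (2 * t) * (ft t + j\<^sup>2 * \<bar>a\<bar>)"
      unfolding \<xi>(3)[unfolded F_a, simplified] using f\<xi> f_nonneg[of \<xi>] \<xi> tM by (intro mult_mono) auto
    with F1 have "(2 * t) * (2 * K'\<^sup>2 * t) < (2 * t) * (ft t + j\<^sup>2 * \<bar>a\<bar>)" by (simp add: power2_eq_square mult_ac)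
    then have "2 * K'\<^sup>2 * t < ft t + j\<^sup>2 * \<bar>a\<bar>" using tM by (simp only: mult_less_cancel_left_pos)
    moreover have "j\<^sup>2 * \<bar>a\<bar> \<le> j\<^sup>2 * t" using tM by (intro mult_left_mono) auto
    moreover have "K' * t \<le> 2 * K'\<^sup>2 * t"
      using K' tM by (intro mult_right_mono) (auto simp: power2_eq_square)
    ultimately have "K' * t - 2 * (j\<^sup>2 * t) \<le> f t" unfolding f_eq by linarith
    moreover have "(K + 2 * j\<^sup>2) * t \<le> K' * t" using K' tM by (intro mult_right_mono) auto
    ultimately show "K * t \<le> f t" by (simp add: algebra_simps)
  qed
qed

text \<open>Once the solution exceeds a large level \<open>m\<close> it reaches \<open>9 m\<close> quickly because \<open>f\<close> is
  superlinear, and from then on \<open>(u')\<^sup>2 \<ge> c (F u - F m) \<ge> c F u / 2\<close>, so that the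
  Keller--Osserman integral bounds the remaining lifetime.\<close>

lemma radial_blow_up:
  assumes r0: "0 < r0" "r0 < 1"
  obtains M where "\<And>u h X. radial n f X u h \<Longrightarrow> 1 < X \<Longrightarrow> (\<And>r. 0 < r \<Longrightarrow> r < X \<Longrightarrow> 0 \<le> h r) \<Longrightarrow> u r0 < M"
proof -
  define c where "c = r0 ^ n"
  have c: "0 < c" "c \<le> 1" using r0 by (auto simp: c_def intro: power_le_one)
  define \<epsilon> where "\<epsilon> = 1 - r0"
  have \<epsilon>: "0 < \<epsilon>" using r0 by (simp add: \<epsilon>_def)
  define r1 where "r1 = r0 + \<epsilon> / 2"
  have r1: "r0 < r1" "r1 < 1" "1 - r1 = \<epsilon> / 2" "r1 - r0 = \<epsilon> / 2"
    using r0 by (simp_all add: r1_def \<epsilon>_def field_simps)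
  \<comment> \<open>\<open>c * K * (\<epsilon> / 2)\<^sup>2 / 2 \<ge> 8\<close> makes the solution
    gain \<open>8 * m\<close> on the first half of the remaining interval, and
    \<open>K \<ge> j\<^sup>2\<close> yields \<open>ft t \<le> 2 * f t\<close> at high
    levels.\<close>
  define K where "K = 64 / (c * \<epsilon>\<^sup>2) + j\<^sup>2"
  have K0: "0 < K" using c \<epsilon> by (simp add: K_def add_pos_nonneg)
  obtain M1 where M1: "\<And>t. M1 \<le> t \<Longrightarrow> K * t \<le> f t" using f_superlinear by blast
  obtain L M2 where M2: "a < M2" "\<And>t. M2 < t \<Longrightarrow> (L has_real_derivative 1 / sqrt (F t)) (at t)"
    "\<And>t s. M2 < t \<Longrightarrow> M2 < s \<Longrightarrow> \<bar>L s - L t\<bar> < c * \<epsilon> / 2"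
    using keller_osserman_tail c \<epsilon> by (metis (no_types, lifting) half_gt_zero mult_pos_pos)
  define M where "M = \<bar>M1\<bar> + \<bar>M2\<bar> + \<bar>a\<bar> + 1"
  show ?thesis
  proof (rule that, rule ccontr)
    fix u h X assume u: "radial n f X u h" and X: "1 < X" and h: "\<And>r. 0 < r \<Longrightarrow> r < X \<Longrightarrow> 0 \<le> h r"
      and "\<not> u r0 < M"
    define m where "m = u r0"
    have m: "M1 \<le> m" "M2 < m" "\<bar>a\<bar> < m" "0 < m" "a < m"
      using \<open>\<not> u r0 < M\<close> unfolding M_def m_def by linarith+
    have um: "m \<le> u r" if "r0 \<le> r" "r < X" for r
      unfolding m_def by (rule radial_nondecreasing[OF u h]) (use that r0 in auto)
    have fK: "K * t \<le> f t" "0 < f t" if "m \<le> t" for t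
      using M1[of t] that m K0 mult_pos_pos[of K t] by linarith+
    define P where "P r = r ^ Suc n * h r" for r
    have dP: "(P has_real_derivative r ^ n * f (u r)) (at r)" if "0 < r" "r < X" for r
      unfolding P_def using radialD(4)[OF u that] .
    have du: "(u has_real_derivative r * h r) (at r)" if "0 < r" "r < X" for r
      using radialD(3)[OF u that] .
    have P_le: "P r \<le> r * h r" if "0 < r" "r \<le> 1" for r
    proof -
      have "r ^ n * (r * h r) \<le> 1 * (r * h r)"
        using that h[of r] X by (intro mult_right_mono) (auto intro: power_le_one)
      then show ?thesis by (simp add: P_def mult_ac)
    qed
    have cr: "c \<le> r ^ n" if "r0 \<le> r" for r unfolding c_def using r0 that by (intro power_mono) auto
    have P0: "0 \<le> P r0" using h[of r0] r0 X by (simp add: P_def)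
    have P1: "c * K * m * (r - r0) \<le> P r" if r: "r0 \<le> r" "r \<le> 1" for r
    proof -
      have "P r0 - c * K * m * (r0 - r0) \<le> P r - c * K * m * (r - r0)"
      proof (rule DERIV_nonneg_imp_nondecreasing[OF r(1), of "\<lambda>r. P r - c * K * m * (r - r0)"])
        fix x assume x: "r0 \<le> x" "x \<le> r"
        then have x1: "0 < x" "x < X" using r0 r X by auto
        have "K * m \<le> K * u x" using um[OF x(1) x1(2)] K0 by (intro mult_left_mono) auto
        then have "K * m \<le> f (u x)" using fK(1)[OF um[OF x(1) x1(2)]] by simp
        then have "c * (K * m) \<le> x ^ n * f (u x)"
          using cr[OF x(1)] c K0 m x1 by (intro mult_mono) auto
        moreover have "((\<lambda>r. P r - c * K * m * (r - r0)) has_real_derivative x ^ n * f (u x) - c * K * m) (at x)"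
          by (rule derivative_eq_intros dP[OF x1] refl | simp)+
        ultimately show "\<exists>y. ((\<lambda>r. P r - c * K * m * (r - r0)) has_real_derivative y) (at x) \<and> 0 \<le> y"
          by (intro exI conjI) auto
      qed
      then show ?thesis using P0 by simp
    qed
    have ur1: "9 * m \<le> u r1"
    proof -
      have "u r0 - c * K * m * (r0 - r0)\<^sup>2 / 2 \<le> u r1 - c * K * m * (r1 - r0)\<^sup>2 / 2"
      proof (rule DERIV_nonneg_imp_nondecreasing[of r0 r1 "\<lambda>r. u r - c * K * m * (r - r0)\<^sup>2 / 2"])
        fix x assume x: "r0 \<le> x" "x \<le> r1"
        then have x1: "0 < x" "x < X" "x \<le> 1" using r0 r1 X by auto
        have "((\<lambda>r. u r - c * K * m * (r - r0)\<^sup>2 / 2) has_real_derivative x * h x - c * K * m * (x - r0)) (at x)"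
          by (auto intro!: derivative_eq_intros du[OF x1(1,2)])
        moreover have "c * K * m * (x - r0) \<le> x * h x" using P1[OF x(1) x1(3)] P_le[OF x1(1,3)] by simp
        ultimately show "\<exists>y. ((\<lambda>r. u r - c * K * m * (r - r0)\<^sup>2 / 2) has_real_derivative y) (at x) \<and> 0 \<le> y"
          by (intro exI conjI) auto
      qed (use r1 in simp)
      moreover have "8 * m \<le> c * K * m * (r1 - r0)\<^sup>2 / 2"
      proof -
        have "64 \<le> c * K * \<epsilon>\<^sup>2" using c \<epsilon> by (simp add: K_def field_simps)
        then have "64 * m \<le> c * K * \<epsilon>\<^sup>2 * m" using m by (intro mult_right_mono) auto
        then show ?thesis unfolding r1(4) by (simp add: power_divide mult_ac)
      qed
      ultimately show ?thesis by (simp add: m_def)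
    qed
    have ur: "9 * m \<le> u r" if r: "r1 \<le> r" "r < X" for r
    proof -
      have "u r1 \<le> u r" by (rule radial_nondecreasing[OF u h]) (use r r1 r0 in auto)
      then show ?thesis using ur1 by simp
    qed
    \<comment> \<open>\<open>F m\<close> is at most \<open>4 * m * ft m\<close>, while
      \<open>F t - F m\<close> is at least \<open>8 * m\<close> times half of \<open>ft m\<close>;
      this is where \<open>9 * m\<close> comes from.\<close>
    have F2: "F t \<le> 2 * (F t - F m)" if t: "9 * m \<le> t" for t
    proof -
      have j_m: "j\<^sup>2 * \<bar>a\<bar> \<le> ft m"
      proof -
        have "j\<^sup>2 * \<bar>a\<bar> \<le> j\<^sup>2 * m" using m by (intro mult_left_mono) auto
        then show ?thesis using fK(2)[of m] by (simp add: f_eq)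
      qed
      obtain \<xi> where \<xi>: "a < \<xi>" "\<xi> < m" "F m - F a = (m - a) * f \<xi>" using F_mvt[of a m] m by auto
      have "F m \<le> (2 * m) * (2 * ft m)"
        unfolding \<xi>(3)[unfolded F_a, simplified]
        using f_le_ft[of \<xi> m] \<xi> j_m m f_nonneg[of \<xi>] by (intro mult_mono) auto
      obtain \<zeta> where \<zeta>: "m < \<zeta>" "\<zeta> < t" "F t - F m = (t - m) * f \<zeta>" using F_mvt[of m t] m t by auto
      have "j\<^sup>2 * \<zeta> \<le> K * \<zeta>" using c \<epsilon> \<zeta> m by (intro mult_right_mono) (auto simp: K_def)
      then have "j\<^sup>2 * \<zeta> \<le> f \<zeta>" using fK(1)[of \<zeta>] \<zeta> by simp
      moreover have "B \<le> 2 * (B - A)" if "A \<le> B - A" for A B :: real using that by simp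
      ultimately have "ft \<zeta> \<le> 2 * f \<zeta>" unfolding f_eq by blast
      then have "ft m \<le> 2 * f \<zeta>" using monoD[OF mono_ft, of m \<zeta>] \<zeta> by auto
      moreover have "0 \<le> ft m" by (rule order_trans[OF _ j_m]) simp
      ultimately have "(8 * m) * (ft m / 2) \<le> (t - m) * f \<zeta>"
        using t m by (intro mult_mono) auto
      then have "F m \<le> F t - F m" using \<open>F m \<le> (2 * m) * (2 * ft m)\<close> \<zeta>(3) by simp
      then show ?thesis by simp
    qed
    \<comment> \<open>\<open>P * P'\<close> is \<open>r ^ (2 * n)\<close> times the derivative of
      \<open>F (u r)\<close>, and \<open>r ^ n \<ge> c\<close>, so
      \<open>P\<^sup>2 - 2 c\<^sup>2 F(u)\<close> is nondecreasing: an energy inequality in place of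
      conservation.\<close>
    have PF: "c * sqrt (F (u r)) \<le> P r" if r: "r1 \<le> r" "r \<le> 1" for r
    proof -
      have "(P r0)\<^sup>2 - 2 * c\<^sup>2 * F (u r0) \<le> (P r)\<^sup>2 - 2 * c\<^sup>2 * F (u r)"
      proof (rule DERIV_nonneg_imp_nondecreasing[of r0 r "\<lambda>r. (P r)\<^sup>2 - 2 * c\<^sup>2 * F (u r)"])
        fix x assume x: "r0 \<le> x" "x \<le> r"
        then have x1: "0 < x" "x < X" using r0 r X by auto
        have ux: "m \<le> u x" "a < u x" using um[OF x(1) x1(2)] m by auto
        have "((\<lambda>r. (P r)\<^sup>2 - 2 * c\<^sup>2 * F (u r)) has_real_derivative
            2 * (x ^ n * f (u x)) * P x - 2 * c\<^sup>2 * (f (u x) * (x * h x))) (at x)"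
          by (rule DERIV_cong[OF DERIV_diff[OF DERIV_power[OF dP[OF x1], of 2]
                DERIV_cmult[OF DERIV_chain2[OF F_deriv[OF ux(2)] du[OF x1]]]]]) simp
        moreover have "c\<^sup>2 * (f (u x) * (x * h x)) \<le> (x ^ n)\<^sup>2 * (f (u x) * (x * h x))"
          using cr[OF x(1)] c fK(2)[OF ux(1)] h[OF x1] x1
          by (intro mult_right_mono power_mono) auto
        ultimately show "\<exists>y. ((\<lambda>r. (P r)\<^sup>2 - 2 * c\<^sup>2 * F (u r)) has_real_derivative y) (at x) \<and> 0 \<le> y"
          by (intro exI conjI) (auto simp: P_def power2_eq_square mult_ac)
      qed (use r r1 in auto)
      then have "c\<^sup>2 * (2 * (F (u r) - F m)) \<le> (P r)\<^sup>2"
        unfolding m_def[symmetric] right_diff_distrib using zero_le_power2[of "P r0"] by linarith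
      moreover have "c\<^sup>2 * F (u r) \<le> c\<^sup>2 * (2 * (F (u r) - F m))"
        using F2[OF ur] r X by (intro mult_left_mono) auto
      ultimately have "(c * sqrt (F (u r)))\<^sup>2 \<le> (P r)\<^sup>2"
        using F_pos[of "u r"] ur[of r] r X m by (simp add: power_mult_distrib)
      moreover have "0 \<le> P r" using h[of r] r r1 r0 X by (simp add: P_def)
      ultimately show ?thesis by (rule power2_le_imp_le)
    qed
    \<comment> \<open>\<open>L (u r)\<close> grows at a rate of at least \<open>c\<close>, hence by
      at least \<open>c * \<epsilon> / 2\<close> on \<open>{r1..1}\<close>, which the tail bound
      forbids.\<close>
    have "L (u r1) - c * r1 \<le> L (u 1) - c * 1"
    proof (rule DERIV_nonneg_imp_nondecreasing[of r1 1 "\<lambda>r. L (u r) - c * r"])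
      fix x assume x: "r1 \<le> x" "x \<le> 1"
      then have x1: "0 < x" "x < X" using r0 r1 X by auto
      have ux: "M2 < u x" "a < u x" using ur[OF x(1) x1(2)] m by auto
      have "((\<lambda>r. L (u r) - c * r) has_real_derivative 1 / sqrt (F (u x)) * (x * h x) - c) (at x)"
        by (rule DERIV_cong[OF DERIV_diff[OF DERIV_chain2[OF M2(2)[OF ux(1)] du[OF x1]] DERIV_cmult_Id]]) simp
      moreover have "c \<le> 1 / sqrt (F (u x)) * (x * h x)"
        using PF[OF x] P_le[OF x1(1) x(2)] F_pos[OF ux(2)] by (simp add: field_simps)
      ultimately show "\<exists>y. ((\<lambda>r. L (u r) - c * r) has_real_derivative y) (at x) \<and> 0 \<le> y"
        by (intro exI conjI) auto
    qed (use r1 in auto)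
    then have "c * (1 - r1) \<le> L (u 1) - L (u r1)" unfolding right_diff_distrib by linarith
    then have "c * \<epsilon> / 2 \<le> L (u 1) - L (u r1)" unfolding r1(3) by simp
    moreover have "M2 < u r1" "M2 < u 1" using ur[of r1] ur[of 1] r1 X m by auto
    ultimately show False
      using M2(3)[of "u r1" "u 1"] abs_ge_self[of "L (u 1) - L (u r1)"] by linarith
  qed
qed

end

section \<open>The maximal solutions\<close>

locale ball_problem = keller + semilinear_C1
begin

text \<open>If \<open>f\<close> takes a nonpositive value, superlinearity bounds the set of such
  points above, continuity forces \<open>f = 0\<close> at its supremum, and that point is a constant
  solution. Otherwise \<open>f\<close> is positive everywhere and the borderline construction
  applies.\<close>

lemma radial_start:
  obtains l X u h where "1 < X" "radial n f X u h" "u 0 = l" "\<And>r. 0 \<le> r \<Longrightarrow> r < X \<Longrightarrow> l \<le> u r"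
    "\<And>t. l < t \<Longrightarrow> 0 < f t" "0 \<le> f l"
proof (cases "\<exists>t. f t \<le> 0")
  case False
  then have "\<And>t. 0 < f t" by (simp add: not_le)
  then show ?thesis
    using radial_subsolution_start that by (metis less_imp_le)
next
  case True
  define S where "S = {t. f t \<le> 0}"
  have "closed S" unfolding S_def by (intro closed_Collect_le f_cont continuous_on_const)
  moreover have "S \<noteq> {}" using True by (auto simp: S_def)
  moreover have bdd: "bdd_above S"
  proof -
    obtain M where M: "\<And>t. M \<le> t \<Longrightarrow> 1 * t \<le> f t" using f_superlinear by blast
    show ?thesis
    proof (rule bdd_aboveI)
      fix t assume t: "t \<in> S"
      show "t \<le> max M 0"
      proof (rule ccontr)
        assume "\<not> t \<le> max M 0"
        then have "M \<le> t" "0 < t" by auto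
        then have "0 < f t" using M[of t] by simp
        then show False using t by (simp add: S_def)
      qed
    qed
  qed
  ultimately have mem: "Sup S \<in> S" using closed_contains_Sup by blast
  have pos: "0 < f t" if "Sup S < t" for t
    using cSup_upper[OF _ bdd, of t] that by (force simp: S_def)
  have "0 \<le> f (Sup S)"
  proof (rule ccontr)
    assume "\<not> 0 \<le> f (Sup S)"
    moreover have "(f \<longlongrightarrow> f (Sup S)) (at (Sup S))"
      using f_cont by (simp add: continuous_on_eq_continuous_at flip: isCont_def)
    ultimately have "eventually (\<lambda>t. f t < 0) (at (Sup S))" by (intro order_tendstoD(2)) auto
    then obtain d where d: "0 < d" "\<And>t. t \<noteq> Sup S \<Longrightarrow> dist t (Sup S) < d \<Longrightarrow> f t < 0"
      unfolding eventually_at by auto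
    then have "f (Sup S + d / 2) < 0" by (intro d(2)) (auto simp: dist_real_def)
    then show False using pos[of "Sup S + d / 2"] d(1) by simp
  qed
  moreover have "f (Sup S) = 0" using calculation mem by (simp add: S_def)
  ultimately show ?thesis using that[of 2 "\<lambda>_. Sup S" "\<lambda>_. 0" "Sup S"] radial_const[of f "Sup S"] pos by auto
qed

end

section \<open>Truncated problems and continuation in the initial value\<close>

locale started_problem = ball_problem +
  fixes l Xl :: real and ul hl :: "real \<Rightarrow> real"
  assumes Xl: "1 < Xl" and radial_ul: "radial n f Xl ul hl" and ul_0: "ul 0 = l"
    and ul_ge: "\<And>r. 0 \<le> r \<Longrightarrow> r < Xl \<Longrightarrow> l \<le> ul r"
    and f_pos: "\<And>t. l < t \<Longrightarrow> 0 < f t" and f_l: "0 \<le> f l"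
begin

text \<open>Cutting the argument off at \<open>l\<close> and \<open>m\<close> makes the right-hand
  side globally Lipschitz and nonnegative: solutions exist for all radii, are nondecreasing, and
  solve the original equation as long as they stay in \<open>{l..m}\<close>.\<close>

definition g where "g m t = f (max l (min m t))"

lemma g_nonneg: "0 \<le> g m t"
proof -
  have "0 \<le> f s" if "l \<le> s" for s using f_pos[of s] f_l that by (cases "s = l") auto
  then show ?thesis by (simp add: g_def)
qed

lemma g_eq: "l \<le> t \<Longrightarrow> t \<le> m \<Longrightarrow> g m t = f t"
  by (simp add: g_def max_def min_def)

lemma g_lipschitz:
  assumes "l \<le> m"
  obtains L where "0 < L" "\<And>s t. \<bar>g m s - g m t\<bar> \<le> L * \<bar>s - t\<bar>"
  using truncation_lipschitz[OF assms] unfolding g_def by blast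

lemma g_continuous: "continuous_on UNIV (g m)"
  unfolding g_def[abs_def]
  by (intro continuous_on_compose2[OF f_cont] continuous_intros) auto

definition sol where
  "sol m b = (SOME p. fst p 0 = b \<and> (\<forall>X. radial n (g m) X (fst p) (snd p)))"

definition U where "U m b = fst (sol m b)"
definition V where "V m b = snd (sol m b)"

lemma
  assumes "l \<le> m"
  shows U_0: "U m b 0 = b" and radial_U: "radial n (g m) X (U m b) (V m b)"
proof -
  obtain L where "0 < L" "\<And>s t. \<bar>g m s - g m t\<bar> \<le> L * \<bar>s - t\<bar>" using g_lipschitz[OF assms] by blast
  then obtain u h where "u 0 = b \<and> (\<forall>X. radial n (g m) X u h)"
    using radial_exists_lipschitz by metis
  then have "\<exists>p. fst p 0 = b \<and> (\<forall>X. radial n (g m) X (fst p) (snd p))" by (metis fst_conv snd_conv)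
  from someI_ex[OF this] show "U m b 0 = b" "radial n (g m) X (U m b) (V m b)"
    unfolding U_def V_def sol_def by auto
qed

lemma V_nonneg: "l \<le> m \<Longrightarrow> 0 < r \<Longrightarrow> 0 \<le> V m b r"
  using radial_flux_nonneg[OF radial_U[of m "r + 1"] g_nonneg] by simp

lemma U_mono:
  assumes "l \<le> m" "0 \<le> r" "r \<le> s"
  shows "U m b r \<le> U m b s"
  by (rule radial_nondecreasing[OF radial_U[OF assms(1), of "s + 1"]]) (use assms V_nonneg in auto)

lemma U_ge: "l \<le> m \<Longrightarrow> 0 \<le> r \<Longrightarrow> b \<le> U m b r"
  using U_mono[of m 0 r b] U_0 by simp

lemma U_continuous:
  assumes "l \<le> m"
  shows "continuous_on {0..} (U m b)"
  unfolding continuous_on_eq_continuous_within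
proof
  fix x :: real assume "x \<in> {0..}"
  then have "continuous (at x within {0..<x+1}) (U m b)"
    using radialD(1)[OF radial_U[OF assms, of "x + 1"]] by (auto simp: continuous_on_eq_continuous_within)
  moreover have "at x within {0..<x+1} = at x within {0..}"
    by (rule at_within_nhd[of _ "{..<x+1}"]) auto
  ultimately show "continuous (at x within {0..}) (U m b)" by simp
qed

lemma U_extend:
  assumes "l \<le> m" "0 \<le> X" "U m b X < k"
  obtains Y where "X < Y" "U m b Y < k"
proof -
  have "(U m b \<longlongrightarrow> U m b X) (at X within {0..})"
    using U_continuous[OF assms(1)] assms(2) by (simp add: continuous_on_def)
  then have "(U m b \<longlongrightarrow> U m b X) (at_right X)"
    by (rule tendsto_within_subset) (use assms(2) in auto)
  then have "eventually (\<lambda>r. U m b r < k) (at_right X)" using assms(3) by (rule order_tendstoD)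
  then obtain c where "X < c" "\<And>r. X < r \<Longrightarrow> r < c \<Longrightarrow> U m b r < k"
    unfolding eventually_at_right_field by auto
  then show ?thesis using that[of "(X + c) / 2"] by auto
qed

lemma U_isCont_initial:
  assumes m: "l \<le> m" and r: "0 \<le> r"
  shows "isCont (\<lambda>b. U m b r) b"
proof -
  obtain L where L: "0 < L" "\<And>s t. \<bar>g m s - g m t\<bar> \<le> L * \<bar>s - t\<bar>" using g_lipschitz[OF m] by blast
  have "\<bar>U m b' r - U m b r\<bar> \<le> 2 * exp (L * r\<^sup>2) * \<bar>b' - b\<bar>" for b'
    using radial_dependence[OF radial_U[OF m, of "r + 1" b'] radial_U[OF m, of "r + 1" b] L r] U_0[OF m] by simp
  then have bound: "eventually (\<lambda>b'. norm (U m b' r - U m b r) \<le> 2 * exp (L * r\<^sup>2) * \<bar>b' - b\<bar>) (at b)"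
    by simp
  have lim: "((\<lambda>b'. 2 * exp (L * r\<^sup>2) * \<bar>b' - b\<bar>) \<longlongrightarrow> 2 * exp (L * r\<^sup>2) * \<bar>b - b\<bar>) (at b)"
    by (intro tendsto_intros)
  have "((\<lambda>b'. U m b' r - U m b r) \<longlongrightarrow> 0) (at b)"
    by (rule Lim_null_comparison[OF bound]) (use lim in simp)
  then show ?thesis by (simp add: isCont_def LIM_zero_iff)
qed

lemma radial_f_U:
  assumes m: "l \<le> m" and b: "l \<le> b" and X: "0 \<le> X" "U m b X < m"
  shows "radial n f X (U m b) (V m b)"
proof (rule radial_cong_rhs[OF radial_U[OF m]])
  fix r assume "0 < r" "r < X"
  then show "g m (U m b r) = f (U m b r)"
    using U_ge[OF m, of r b] U_mono[OF m, of r X b] X b by (intro g_eq) auto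
qed

text \<open>Continuous dependence with equal initial values identifies \<open>u\<close>; then
  \<open>h\<close> is read off from the derivative, and at the origin from
  \<open>radial_at_0\<close>.\<close>

lemma radial_eq_U:
  assumes rad: "radial n f X u h" and m: "l \<le> m" and bounds: "\<And>r. 0 \<le> r \<Longrightarrow> r < X \<Longrightarrow> l \<le> u r \<and> u r \<le> m"
    and r: "0 \<le> r" "r < X"
  and b: "u 0 = b"
  shows "u r = U m b r" "h r = V m b r"
proof -
  obtain L where L: "0 < L" "\<And>s t. \<bar>g m s - g m t\<bar> \<le> L * \<bar>s - t\<bar>" using g_lipschitz[OF m] by blast
  have radg: "radial n (g m) X u h"
    by (rule radial_cong_rhs[OF rad]) (use bounds g_eq in auto)
  have eq: "u s = U m b s" if "0 \<le> s" "s < X" for s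
    using radial_dependence[OF radg radial_U[OF m, of X b] L that] U_0[OF m] b by simp
  show "u r = U m b r" using eq r .
  show "h r = V m b r"
  proof (cases "r = 0")
    case True
    then show ?thesis
      using radial_at_0[OF radg _ g_continuous] radial_at_0[OF radial_U[OF m, of X b] _ g_continuous] r U_0[OF m] b
      by simp
  next
    case False
    then have r0: "0 < r" using r by simp
    have "(U m b has_real_derivative r * h r) (at r)"
      by (rule has_field_derivative_transform_within_open[OF radialD(3)[OF rad r0 r(2)], of "{0<..<X}"])
         (use eq r r0 in auto)
    from DERIV_unique[OF this radialD(3)[OF radial_U[OF m] r0 r(2)]] show ?thesis using r0 by simp
  qed
qed

lemma U_consistent:
  assumes m: "l \<le> m" "l \<le> m'" and b: "l \<le> b" and X: "0 \<le> X" "U m b X < m" "U m b X < m'" and r: "0 \<le> r" "r \<le> X"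
  shows "U m b r = U m' b r" "V m b r = V m' b r"
proof -
  \<comment> \<open>\<open>radial\<close> speaks of half-open intervals, so agreement at
    \<open>X\<close> itself needs a slightly longer one.\<close>
  obtain Y where Y: "X < Y" "U m b Y < min m m'" using U_extend[OF m(1) X(1), of b "min m m'"] X by auto
  have rad: "radial n f Y (U m b) (V m b)" by (rule radial_f_U[OF m(1) b]) (use X Y in auto)
  have bounds: "l \<le> U m b s \<and> U m b s \<le> m'" if "0 \<le> s" "s < Y" for s
    using U_ge[OF m(1), of s b] U_mono[OF m(1), of s Y b] that b Y by auto
  show "U m b r = U m' b r" "V m b r = V m' b r"
    using radial_eq_U[OF rad m(2) bounds _ _ U_0[OF m(1)], of r] r Y by auto
qed

text \<open>For \<open>b \<ge> l\<close> and \<open>r \<ge> 0\<close> this says that the untruncated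
  solution starting at \<open>b\<close> exists up to and including \<open>r\<close>: some truncation
  level is not reached.\<close>

definition alive where "alive b r \<longleftrightarrow> (\<exists>m\<ge>l. U m b r < m)"

lemma alive_mono: "alive b r \<Longrightarrow> 0 \<le> s \<Longrightarrow> s \<le> r \<Longrightarrow> alive b s"
  unfolding alive_def using U_mono by (meson order_le_less_trans)

lemma alive_extend:
  assumes "alive b r" "0 \<le> r"
  obtains s where "r < s" "alive b s"
  using assms U_extend unfolding alive_def by metis

text \<open>\<open>radial_blow_up\<close> bounds the value at \<open>r\<close> independently of
  \<open>b\<close>, provided the solution reaches radius one; the bound therefore passes to limits
  of initial values.\<close>

lemma alive_bound:
  assumes r: "0 < r" "r < 1"
  obtains M where "l \<le> M" "\<And>b m. l \<le> b \<Longrightarrow> alive b 1 \<Longrightarrow> M \<le> m \<Longrightarrow> U m b r < M"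
proof -
  obtain M0 where M0: "\<And>u h X. radial n f X u h \<Longrightarrow> 1 < X \<Longrightarrow> (\<And>r. 0 < r \<Longrightarrow> r < X \<Longrightarrow> 0 \<le> h r) \<Longrightarrow> u r < M0"
    using radial_blow_up[OF r] by blast
  define M where "M = max l M0"
  show ?thesis
  proof (rule that[of M])
    fix b m assume b: "l \<le> b" "alive b 1" and m: "M \<le> m"
    obtain k where k: "l \<le> k" "U k b 1 < k" using b(2) unfolding alive_def by auto
    obtain Y where Y: "1 < Y" "U k b Y < k" using U_extend[OF k(1) _ k(2)] by auto
    have "U k b r < M0"
      by (rule M0[OF radial_f_U[OF k(1) b(1) _ Y(2)] Y(1)]) (use Y V_nonneg[OF k(1)] in auto)
    then have "U k b r < M" by (simp add: M_def)
    moreover have "U k b r < k" using U_mono[OF k(1), of r 1 b] k(2) r by simp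
    ultimately show "U m b r < M"
      using U_consistent(1)[OF k(1) _ b(1), of m r r] m r by (auto simp: M_def)
  qed (simp add: M_def)
qed

text \<open>Truncated solutions agree while they are below both levels, so they glue up to the
  supremum \<rho> of the living radii. That set is open to the right, so at \<rho> every truncation
  level has been reached, and monotonicity turns this into blow-up.\<close>

lemma maximal_solution:
  assumes b: "l \<le> b" and dead: "\<not> alive b 1"
  obtains \<rho> u h where "0 < \<rho>" "\<rho> \<le> 1" "radial n f \<rho> u h" "u 0 = b" "filterlim u at_top (at_left \<rho>)"
    "\<And>r. 0 \<le> r \<Longrightarrow> r < \<rho> \<Longrightarrow> b \<le> u r"
    "\<And>m r. l \<le> m \<Longrightarrow> 0 \<le> r \<Longrightarrow> U m b r < m \<Longrightarrow> r < \<rho> \<and> u r = U m b r"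
proof -
  define A where "A = {r. 0 \<le> r \<and> alive b r}"
  define \<rho> where "\<rho> = Sup A"
  have lt1: "r < 1" if "r \<in> A" for r
    using that dead alive_mono[of b r 1] unfolding A_def by force
  have bdd: "bdd_above A" using lt1 by (intro bdd_aboveI[of _ 1]) (auto simp: less_imp_le)
  have A0: "0 \<in> A" using b U_0[of "b + 1" b] unfolding A_def alive_def by (auto intro!: exI[of _ "b + 1"])
  have A_lt: "r < \<rho>" if r: "r \<in> A" for r
  proof -
    obtain s where "r < s" "alive b s" using alive_extend[of b r] r unfolding A_def by auto
    then have "s \<in> A" using r by (auto simp: A_def)
    then show ?thesis using cSup_upper[OF _ bdd, of s] \<open>r < s\<close> by (simp add: \<rho>_def)
  qed
  have lt_A: "r \<in> A" if r: "0 \<le> r" "r < \<rho>" for r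
  proof -
    obtain s where "s \<in> A" "r < s" using r(2) less_cSup_iff[OF _ bdd] A0 unfolding \<rho>_def by auto
    then show ?thesis using alive_mono[of b s r] r unfolding A_def by auto
  qed
  have \<rho>: "0 < \<rho>" "\<rho> \<le> 1" using A_lt[OF A0] cSup_least[of A 1] A0 lt1 by (auto simp: \<rho>_def less_imp_le)
  define mm where "mm r = (SOME m. l \<le> m \<and> U m b r < m)" for r
  define u where "u r = U (mm r) b r" for r
  define h where "h r = V (mm r) b r" for r
  have u_eq: "u r = U m b r \<and> h r = V m b r" if m: "l \<le> m" "U m b r < m" and r: "0 \<le> r" for m r
  proof -
    have mm: "l \<le> mm r \<and> U (mm r) b r < mm r" unfolding mm_def by (rule someI[of _ m]) (use m in auto)
    show ?thesis
    proof (cases "m \<le> mm r")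
      case True
      then show ?thesis
        unfolding u_def h_def using U_consistent[OF m(1) _ b r m(2), of "mm r" r] mm m r by auto
    next
      case False
      then show ?thesis
        unfolding u_def h_def using U_consistent[of "mm r" m b r r] b mm m r by auto
    qed
  qed
  have rad: "radial n f \<rho> u h"
  proof (rule radial_locally)
    fix Y assume Y: "0 < Y" "Y < \<rho>"
    then obtain m where m: "l \<le> m" "U m b Y < m" using lt_A[of Y] unfolding A_def alive_def by auto
    have "U m b r < m" if "0 \<le> r" "r < Y" for r using U_mono[OF m(1), of r Y b] that m(2) by simp
    then show "radial n f Y u h"
      using u_eq[OF m(1)] by (intro radial_transfer[OF radial_f_U[OF m(1) b _ m(2)]]) (use Y in auto)
  qed
  have h0: "0 \<le> h r" if r: "0 < r" "r < \<rho>" for r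
  proof -
    obtain m where m: "l \<le> m" "U m b r < m" using lt_A[of r] r unfolding A_def alive_def by auto
    then show ?thesis using u_eq[OF m, of] V_nonneg[OF m(1) r(1)] r by simp
  qed
  have u0: "u 0 = b" using u_eq[of "b + 1" 0] b U_0[of "b + 1" b] by simp
  have mono: "u r \<le> u s" if "0 \<le> r" "r \<le> s" "s < \<rho>" for r s
    by (rule radial_nondecreasing[OF rad h0]) (use that in auto)
  show ?thesis
  proof (rule that[OF \<rho> rad u0])
    show "b \<le> u r" if "0 \<le> r" "r < \<rho>" for r using mono[of 0 r] that u0 by simp
    show "r < \<rho> \<and> u r = U m b r" if "l \<le> m" "0 \<le> r" "U m b r < m" for m r
      using A_lt[of r] u_eq[of m r] that unfolding A_def alive_def by auto
    show "filterlim u at_top (at_left \<rho>)"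
      unfolding filterlim_at_top
    proof
      fix K
      define m where "m = max K b + 1"
      have m: "l \<le> m" "b < m" using b by (auto simp: m_def)
      have "m \<le> U m b \<rho>"
      proof (rule ccontr)
        assume "\<not> m \<le> U m b \<rho>"
        then have "\<rho> \<in> A" using m \<rho> unfolding A_def alive_def by (auto simp: not_le)
        then show False using A_lt by blast
      qed
      \<comment> \<open>The level lies above \<open>b\<close>, so it is attained, and below
        \<open>m\<close>, so that \<open>u\<close> coincides with \<open>U m b\<close>
        there.\<close>
      then have "\<exists>r\<ge>0. r \<le> \<rho> \<and> U m b r = max K b + 1/2"
        by (intro IVT') (use m \<rho> U_0[OF m(1)] in \<open>auto simp: m_def intro!: continuous_on_subset[OF U_continuous]\<close>)
      then obtain r where r: "0 \<le> r" "r \<le> \<rho>" "U m b r = max K b + 1/2" by auto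
      have "r \<noteq> \<rho>" using r(3) \<open>m \<le> U m b \<rho>\<close> by (auto simp: m_def)
      then have r\<rho>: "r < \<rho>" using r by simp
      have "U m b r < m" using r(3) by (simp add: m_def)
      then have ur: "K \<le> u r" using u_eq[OF m(1) _ r(1)] r(3) by simp
      have "K \<le> u s" if "r < s" "s < \<rho>" for s
        using mono[OF r(1) less_imp_le[OF that(1)] that(2)] ur by simp
      then show "eventually (\<lambda>s. K \<le> u s) (at_left \<rho>)"
        unfolding eventually_at_left_field by (intro exI[of _ r]) (use r\<rho> in auto)
    qed
  qed
qed

lemma alive_l: "alive l 1"
proof -
  define Y where "Y = (1 + Xl) / 2"
  have Y: "1 < Y" "Y < Xl" using Xl by (auto simp: Y_def)
  have "compact (ul ` {0..Y})"
    by (intro compact_continuous_image continuous_on_subset[OF radialD(1)[OF radial_ul]]) (use Y in auto)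
  then have "bounded (ul ` {0..Y})" by (rule compact_imp_bounded)
  then obtain M where M: "\<And>r. r \<in> {0..Y} \<Longrightarrow> \<bar>ul r\<bar> \<le> M" unfolding bounded_iff by fastforce
  define m where "m = max l M + 1"
  have m: "l \<le> m" by (simp add: m_def)
  have um: "ul r < m" if "0 \<le> r" "r < Y" for r using M[of r] that by (auto simp: m_def)
  have "ul 1 = U m l 1"
    by (rule radial_eq_U(1)[OF radial_mono[OF radial_ul less_imp_le[OF Y(2)]] m _ _ _ ul_0])
       (use um ul_ge Y in \<open>auto simp: less_imp_le\<close>)
  then show ?thesis unfolding alive_def using m um[of 1] Y by (intro exI[of _ m]) auto
qed

text \<open>The initial values alive at radius one form a set open to the right by continuous
  dependence, so the supremum \<open>b0\<close> is not among them. \<open>alive_bound\<close> makes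
  \<open>b0\<close> finite and, applied to nearby living values, keeps the solution from
  \<open>b0\<close> finite at each radius below one.\<close>

lemma threshold:
  obtains b0 where "l < b0" "\<not> alive b0 1" "\<And>r. 0 \<le> r \<Longrightarrow> r < 1 \<Longrightarrow> alive b0 r"
    "\<And>b. b0 < b \<Longrightarrow> \<not> alive b 1" "\<And>\<delta>. 0 < \<delta> \<Longrightarrow> \<exists>b. l \<le> b \<and> alive b 1 \<and> \<bar>b - b0\<bar> < \<delta>"
proof -
  define S where "S = {b. l \<le> b \<and> alive b 1}"
  define b0 where "b0 = Sup S"
  have S0: "l \<in> S" using alive_l by (simp add: S_def)
  have bdd: "bdd_above S"
  proof -
    obtain M where M: "l \<le> M" "\<And>b m. l \<le> b \<Longrightarrow> alive b 1 \<Longrightarrow> M \<le> m \<Longrightarrow> U m b (1/2) < M"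
      using alive_bound[of "1/2"] by auto
    show ?thesis
    proof (rule bdd_aboveI)
      fix b assume "b \<in> S"
      then show "b \<le> M" using M(2)[of b M] U_ge[OF M(1), of "1/2" b] unfolding S_def by auto
    qed
  qed
  have S_lt: "b < b0" if b: "b \<in> S" for b
  proof -
    obtain m where m: "l \<le> m" "U m b 1 < m" using b unfolding S_def alive_def by auto
    have "eventually (\<lambda>b'. U m b' 1 < m) (at b)"
      using U_isCont_initial[OF m(1), of 1 b] m(2) unfolding isCont_def by (auto intro: order_tendstoD)
    then obtain d where d: "0 < d" "\<And>b'. b' \<noteq> b \<Longrightarrow> dist b' b < d \<Longrightarrow> U m b' 1 < m"
      unfolding eventually_at by auto
    have "b + d / 2 \<in> S" using d(2)[of "b + d / 2"] d(1) b m unfolding S_def alive_def by (auto simp: dist_real_def)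
    then show ?thesis using cSup_upper[OF _ bdd, of "b + d / 2"] d by (simp add: b0_def)
  qed
  have close: "\<exists>b. l \<le> b \<and> alive b 1 \<and> \<bar>b - b0\<bar> < \<delta>" if \<delta>: "0 < \<delta>" for \<delta>
  proof -
    have "S \<noteq> {}" using S0 by auto
    then obtain b where "b \<in> S" "b0 - \<delta> < b"
      using \<delta> less_cSup_iff[OF _ bdd, of "b0 - \<delta>"] unfolding b0_def by auto
    then show ?thesis using S_lt[of b] unfolding S_def by (intro exI[of _ b]) auto
  qed
  have dead: "\<not> alive b 1" if "b0 \<le> b" for b
  proof
    assume "alive b 1"
    then have "b \<in> S" using that S_lt[OF S0] by (auto simp: S_def)
    then show False using S_lt that by force
  qed
  show ?thesis
  proof (rule that[OF S_lt[OF S0] dead _ _ close])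
    fix r :: real assume r: "0 \<le> r" "r < 1"
    define s where "s = (r + 1) / 2"
    have s: "0 < s" "s < 1" "r \<le> s" using r by (auto simp: s_def)
    obtain M where M: "l \<le> M" "\<And>b m. l \<le> b \<Longrightarrow> alive b 1 \<Longrightarrow> M \<le> m \<Longrightarrow> U m b s < M"
      using alive_bound[OF s(1,2)] by blast
    \<comment> \<open>Truncating at \<open>M + 1\<close> leaves a gap above the bound
      \<open>M\<close> for nearby living values, which continuity in \<open>b\<close> cannot
      jump.\<close>
    have "U (M + 1) b0 s < M + 1"
    proof (rule ccontr)
      assume "\<not> U (M + 1) b0 s < M + 1"
      then have "M < U (M + 1) b0 s" by simp
      moreover have "((\<lambda>b. U (M + 1) b s) \<longlongrightarrow> U (M + 1) b0 s) (at b0)"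
        using U_isCont_initial[of "M + 1" s b0] M(1) s unfolding isCont_def by auto
      ultimately have "eventually (\<lambda>b. M < U (M + 1) b s) (at b0)" by (rule order_tendstoD(1)[rotated])
      then obtain d where d: "0 < d" "\<And>b. b \<noteq> b0 \<Longrightarrow> dist b b0 < d \<Longrightarrow> M < U (M + 1) b s"
        unfolding eventually_at by auto
      obtain b where b: "l \<le> b" "alive b 1" "\<bar>b - b0\<bar> < d" using close d(1) by blast
      have "b \<noteq> b0" using dead[of b0] b(2) by auto
      then show False using d(2)[of b] M(2)[OF b(1,2), of "M + 1"] b(3) by (simp add: dist_real_def)
    qed
    then have "alive b0 s" unfolding alive_def using M(1) by (intro exI[of _ "M + 1"]) auto
    then show "alive b0 r" using alive_mono r s by blast
  qed (use dead in auto)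
qed

end

section \<open>The large solution\<close>

text \<open>Compactness makes the blow-up uniform: points approaching the sphere with
  \<open>v < K\<close> would accumulate at a boundary point where \<open>v\<close> tends to
  infinity.\<close>

lemma large_near_boundary:
  fixes v :: "'a::euclidean_space \<Rightarrow> real"
  assumes v: "\<And>x0. norm x0 = 1 \<Longrightarrow> filterlim v at_top (at x0 within ball 0 1)"
  obtains \<sigma> where "\<sigma> < 1" "\<And>x. \<sigma> \<le> norm x \<Longrightarrow> norm x < 1 \<Longrightarrow> K \<le> v x"
proof (rule ccontr)
  assume neg: "\<not> thesis"
  have "\<exists>x. 1 - 1 / real (Suc k) \<le> norm x \<and> norm x < 1 \<and> v x < K" for k
  proof (rule ccontr)
    assume "\<not> ?thesis"
    then have "K \<le> v x" if "1 - 1 / real (Suc k) \<le> norm x" "norm x < 1" for x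
      using that not_less by blast
    then show False using neg that[of "1 - 1 / real (Suc k)"] by (simp del: of_nat_Suc)
  qed
  then obtain X where X: "\<And>k. 1 - 1 / real (Suc k) \<le> norm (X k)" "\<And>k. norm (X k) < 1" "\<And>k. v (X k) < K"
    by metis
  have "\<forall>k. X k \<in> cball 0 1" using X(2) by (auto simp: less_imp_le)
  then obtain x0 r where r: "strict_mono (r :: nat \<Rightarrow> nat)" "(X \<circ> r) \<longlonglongrightarrow> x0"
    using compact_cball[of 0 1] unfolding compact_def by metis
  have lim: "(\<lambda>k. X (r k)) \<longlonglongrightarrow> x0" using r(2) by (simp add: o_def)
  have "(\<lambda>k. norm (X k)) \<longlonglongrightarrow> 1"
  proof (rule tendsto_sandwich[OF _ _ _ tendsto_const])
    show "(\<lambda>k. 1 - 1 / real (Suc k)) \<longlonglongrightarrow> 1" by real_asymp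
  qed (use X in \<open>auto intro!: always_eventually less_imp_le\<close>)
  from LIMSEQ_subseq_LIMSEQ[OF this r(1)] have "(\<lambda>k. norm (X (r k))) \<longlonglongrightarrow> 1" by (simp add: o_def)
  then have n: "norm x0 = 1" using LIMSEQ_unique tendsto_norm[OF lim] by blast
  have "filterlim (\<lambda>k. X (r k)) (at x0 within ball 0 1) sequentially"
    unfolding filterlim_at using lim X(2) n by (auto intro!: always_eventually simp: dist_norm) (metis less_irrefl)
  from filterlim_compose[OF v[OF n] this]
  have "eventually (\<lambda>k. K \<le> v (X (r k))) sequentially" by (simp add: filterlim_at_top)
  then show False using X(3) by (auto simp: eventually_sequentially not_le[symmetric])
qed

context started_problem
begin

lemma unique_large_solution:
  assumes dim: "DIM('a::euclidean_space) = Suc n"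
  shows "\<exists>u. large_solution (ball (0::'a) 1) f u \<and>
    (\<forall>v. large_solution (ball 0 1) f v \<longrightarrow> (\<forall>x\<in>ball 0 1. v x = u x))"
proof -
  obtain b0 where b0: "l < b0" "\<not> alive b0 1" "\<And>r. 0 \<le> r \<Longrightarrow> r < 1 \<Longrightarrow> alive b0 r"
    "\<And>b. b0 < b \<Longrightarrow> \<not> alive b 1" and close: "\<And>\<delta>. 0 < \<delta> \<Longrightarrow> \<exists>b. l \<le> b \<and> alive b 1 \<and> \<bar>b - b0\<bar> < \<delta>"
    using threshold by blast
  obtain \<rho>0 u0 h0 where \<rho>0: "0 < \<rho>0" "\<rho>0 \<le> 1" "radial n f \<rho>0 u0 h0" "u0 0 = b0"
    "filterlim u0 at_top (at_left \<rho>0)" "\<And>r. 0 \<le> r \<Longrightarrow> r < \<rho>0 \<Longrightarrow> b0 \<le> u0 r"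
    and u0U: "\<And>m r. l \<le> m \<Longrightarrow> 0 \<le> r \<Longrightarrow> U m b0 r < m \<Longrightarrow> r < \<rho>0 \<and> u0 r = U m b0 r"
    using maximal_solution[OF less_imp_le[OF b0(1)] b0(2)] by blast
  have "\<rho>0 = 1"
  proof (rule ccontr)
    assume "\<rho>0 \<noteq> 1"
    then have "alive b0 \<rho>0" using b0(3) \<rho>0 by auto
    then show False using u0U[of _ \<rho>0] \<rho>0(1) unfolding alive_def by auto
  qed
  note \<rho>0 = \<rho>0[unfolded this] and u0U = u0U[unfolded this]
  let ?u = "\<lambda>x::'a. u0 (norm x)"
  have fin: "\<exists>m\<ge>l. U m b0 (norm x) < m \<and> u0 (norm x) = U m b0 (norm x)" if "norm x < 1" for x :: 'a
    using b0(3)[of "norm x"] u0U[of _ "norm x"] that unfolding alive_def by auto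
  have large: "large_solution (ball 0 1) f ?u"
    unfolding large_solution_def
  proof (intro conjI ballI)
    show "C2_on (ball 0 1) ?u" by (rule radial_C2(1)[OF \<rho>0(3) f_cont dim])
    show "laplacian ?u x = f (?u x)" if "x \<in> ball 0 1" for x
      using radial_C2(2)[OF \<rho>0(3) f_cont dim, of x] that by simp
    fix x0 :: 'a assume "x0 \<in> frontier (ball 0 1)"
    then have n: "norm x0 = 1" by simp
    have "filterlim norm (at_left 1) (at x0 within ball 0 1)"
      unfolding filterlim_at
    proof
      show "eventually (\<lambda>x::'a. norm x \<in> {..<1} \<and> norm x \<noteq> 1) (at x0 within ball 0 1)"
        by (auto simp: eventually_at_filter)
      show "(norm \<longlongrightarrow> 1) (at x0 within ball 0 1)"        using tendsto_norm[OF tendsto_ident_at[of x0 "ball 0 1"]] n by simp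
    qed
    then show "filterlim ?u at_top (at x0 within ball 0 1)" by (rule filterlim_compose[OF \<rho>0(5)])
  qed
  have eq: "v x = u0 (norm x)" if v: "large_solution (ball 0 1) f v" and x: "norm x < 1" for v :: "'a \<Rightarrow> real" and x
  proof (rule antisym)
    have v2: "C2_on (ball 0 1) v" "\<And>x. norm x < 1 \<Longrightarrow> laplacian v x = f (v x)"
      "\<And>x0. norm x0 = 1 \<Longrightarrow> filterlim v at_top (at x0 within ball 0 1)"
      using v unfolding large_solution_def by auto
    obtain m where m: "l \<le> m" "U m b0 (norm x) < m" "u0 (norm x) = U m b0 (norm x)" using fin[OF x] by auto
    have lim: "((\<lambda>b. U m b (norm x)) \<longlongrightarrow> U m b0 (norm x)) (at b0)"
      using U_isCont_initial[OF m(1), of "norm x" b0] by (simp add: isCont_def)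
    have near: "eventually (\<lambda>b. U m b (norm x) < m) (at b0)" by (rule order_tendstoD(2)[OF lim m(2)])
    show "u0 (norm x) \<le> v x"
    proof (rule ccontr)
      assume "\<not> u0 (norm x) \<le> v x"
      then have "eventually (\<lambda>b. v x < U m b (norm x)) (at b0)" using m(3) by (intro order_tendstoD(1)[OF lim]) simp
      from eventually_conj[OF this near] obtain d where d: "0 < d"
        "\<And>b. b \<noteq> b0 \<Longrightarrow> dist b b0 < d \<Longrightarrow> v x < U m b (norm x) \<and> U m b (norm x) < m"
        unfolding eventually_at by auto
      obtain b where b: "l \<le> b" "alive b 1" "\<bar>b - b0\<bar> < d" using close[OF d(1)] by blast
      then have bd: "v x < U m b (norm x)" "U m b (norm x) < m" using d(2)[of b] b0(2) by (auto simp: dist_real_def)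
      obtain k where k: "l \<le> k" "U k b 1 < k" using b(2) unfolding alive_def by auto
      have rad: "radial n f 1 (U k b) (V k b)" by (rule radial_f_U[OF k(1) b(1) _ k(2)]) simp
      obtain \<sigma> where \<sigma>: "\<sigma> < 1" "\<And>y. \<sigma> \<le> norm y \<Longrightarrow> norm y < 1 \<Longrightarrow> k \<le> v y"
        using large_near_boundary[OF v2(3)] by blast
      \<comment> \<open>\<open>U k b\<close> stays below \<open>k\<close> on the unit ball while
        \<open>v\<close> exceeds \<open>k\<close> near the sphere, so the order there is
        known.\<close>
      have "U k b (norm x) \<le> v x"
      proof (rule comparison[OF dim _ _ v2(1,2) _ _ mono_ft f_eq \<sigma>(1) _ x])
        show "C2_on (ball 0 1) (\<lambda>x::'a. U k b (norm x))" by (rule radial_C2(1)[OF rad f_cont dim])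
        show "laplacian (\<lambda>x::'a. U k b (norm x)) y = f (U k b (norm y))" if "norm y < 1" for y :: 'a
          by (rule radial_C2(2)[OF rad f_cont dim that])
        show "U k b (norm y) \<le> v y" if "\<sigma> \<le> norm y" "norm y < 1" for y
          using U_mono[OF k(1), of "norm y" 1 b] \<sigma>(2)[OF that] that k(2) by simp
      qed auto
      \<comment> \<open>The limit in \<open>b\<close> is taken at the fixed truncation
        \<open>m\<close>, the comparison at a level \<open>k\<close> depending on
        \<open>b\<close>.\<close>
      moreover have "U m b (norm x) = U k b (norm x)"
        using U_consistent(1)[OF k(1) m(1) b(1), of "norm x" "norm x"]
          U_consistent(1)[OF m(1) k(1) b(1), of "norm x" "norm x"] bd
          U_mono[OF k(1), of "norm x" 1 b] k(2) x by (cases "m \<le> k") auto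
      ultimately show False using bd by simp
    qed
    show "v x \<le> u0 (norm x)"
    proof (rule ccontr)
      assume "\<not> v x \<le> u0 (norm x)"
      then have "eventually (\<lambda>b. U m b (norm x) < v x) (at b0)" using m(3) by (intro order_tendstoD(2)[OF lim]) simp
      from eventually_conj[OF this near] obtain d where d: "0 < d"
        "\<And>b. b \<noteq> b0 \<Longrightarrow> dist b b0 < d \<Longrightarrow> U m b (norm x) < v x \<and> U m b (norm x) < m"
        unfolding eventually_at by auto
      define b where "b = b0 + d / 2"
      have b: "b0 < b" "l \<le> b" using d(1) b0(1) by (auto simp: b_def)
      have bd: "U m b (norm x) < v x" "U m b (norm x) < m" using d(2)[of b] d(1) by (auto simp: b_def dist_real_def)
      obtain \<rho> ub hb where \<rho>: "0 < \<rho>" "\<rho> \<le> 1" "radial n f \<rho> ub hb" "ub 0 = b" "filterlim ub at_top (at_left \<rho>)"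
        "\<And>r. 0 \<le> r \<Longrightarrow> r < \<rho> \<Longrightarrow> b \<le> ub r"
        and ubU: "\<And>m r. l \<le> m \<Longrightarrow> 0 \<le> r \<Longrightarrow> U m b r < m \<Longrightarrow> r < \<rho> \<and> ub r = U m b r"
        using maximal_solution[OF b(2) b0(4)[OF b(1)]] by blast
      \<comment> \<open>Blow-up exactly at radius one is ruled out by uniqueness among radial large
        solutions. Hence \<open>\<rho> < 1\<close>, and \<open>v\<close> is bounded on
        \<open>cball 0 \<rho>\<close>, where the radial solution is infinite at the
        boundary.\<close>
      have "\<rho> \<noteq> 1"
      proof
        assume "\<rho> = 1"
        show False
        proof (rule radial_large_unique[OF \<rho>0(3) _ _ \<rho>0(5)])
          show "radial n f 1 ub hb" using \<rho>(3) \<open>\<rho> = 1\<close> by simp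
          show "u0 0 < ub 0" using \<rho>(4) \<rho>0(4) b(1) by simp
          show "0 < f t" if "u0 0 \<le> t" for t using f_pos[of t] that \<rho>0(4) b0(1) by simp
          show "u0 0 \<le> u0 r" if "0 \<le> r" "r < 1" for r using \<rho>0(6)[OF that] \<rho>0(4) by simp
        qed
      qed
      then have \<rho>1: "\<rho> < 1" using \<rho>(2) by simp
      have xr: "norm x < \<rho>" "ub (norm x) = U m b (norm x)" using ubU[OF m(1), of "norm x"] bd by auto
      have "compact (v ` cball 0 \<rho>)"
        by (intro compact_continuous_image continuous_on_subset[OF C2_on_imp_continuous_on[OF v2(1)]]) (use \<rho>1 in auto)
      then have "bounded (v ` cball 0 \<rho>)" by (rule compact_imp_bounded)
      then obtain K where "\<forall>y\<in>cball 0 \<rho>. \<bar>v y\<bar> \<le> K"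
        unfolding bounded_iff by auto
      then have K: "v y \<le> K" if "norm y \<le> \<rho>" for y
        using that abs_le_D1[of "v y" K] by simp
      have "eventually (\<lambda>s. K \<le> ub s) (at_left \<rho>)" using \<rho>(5) by (simp add: filterlim_at_top)
      then obtain c where c: "c < \<rho>" "\<And>s. c < s \<Longrightarrow> s < \<rho> \<Longrightarrow> K \<le> ub s"
        unfolding eventually_at_left_field by auto
      have "v x \<le> ub (norm x)"
      proof (rule comparison[OF dim \<rho>(1,2) _ _ _ _ mono_ft f_eq _ _ xr(1), where \<sigma> = "(c + \<rho>) / 2"])
        show "C2_on (ball 0 \<rho>) (\<lambda>x::'a. ub (norm x))" by (rule radial_C2(1)[OF \<rho>(3) f_cont dim])
        show "laplacian (\<lambda>x::'a. ub (norm x)) y = f (ub (norm y))" if "norm y < \<rho>" for y :: 'a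
          by (rule radial_C2(2)[OF \<rho>(3) f_cont dim that])
        show "C2_on (ball 0 \<rho>) v" by (rule C2_on_subset[OF v2(1)]) (use \<rho>1 in auto)
        show "laplacian v y = f (v y)" if "norm y < \<rho>" for y using v2(2) that \<rho>1 by simp
        show "v y \<le> ub (norm y)" if "(c + \<rho>) / 2 \<le> norm y" "norm y < \<rho>" for y
          using c(2)[of "norm y"] K[of y] that c(1) by auto
      qed (use c(1) in simp)
      then show False using xr bd by simp
    qed
  qed
  show ?thesis
  proof (intro exI[of _ ?u] conjI allI impI ballI large)
    show "v x = u0 (norm x)" if "large_solution (ball 0 1) f v" "x \<in> ball 0 1"
      for v :: "'a \<Rightarrow> real" and x
      using eq[OF that(1), of x] that(2) by simp
  qed
qed

end

lemma C1_lipschitz_interval: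
  fixes f :: "real \<Rightarrow> real"
  assumes "f C1_differentiable_on UNIV"
  shows "\<exists>L>0. \<forall>s\<in>{p..q}. \<forall>t\<in>{p..q}. \<bar>f s - f t\<bar> \<le> L * \<bar>s - t\<bar>"
proof -
  obtain D where D: "\<And>x. (f has_vector_derivative D x) (at x)" "continuous_on UNIV D"
    using assms unfolding C1_differentiable_on_def by auto
  have "compact (D ` {p..q})" by (intro compact_continuous_image continuous_on_subset[OF D(2)]) auto
  then have "bounded (D ` {p..q})" by (rule compact_imp_bounded)
  then obtain L where L: "L > 0" "\<And>x. x \<in> {p..q} \<Longrightarrow> norm (D x) \<le> L" unfolding bounded_pos by auto
  have "norm (f s - f t) \<le> L * norm (s - t)" if "s \<in> {p..q}" "t \<in> {p..q}" for s t
    by (rule field_differentiable_bound[of "{p..q}" f D])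
       (use that L D(1) in \<open>auto simp: has_real_derivative_iff_has_vector_derivative intro: has_vector_derivative_at_within\<close>)
  then show ?thesis using L(1) by auto
qed

theorem corollary1p4:
  fixes f ftilde :: "real \<Rightarrow> real" and a :: real
    and B :: "(real ^ 'n) set"
  assumes "B = ball 0 1"
    and "f C1_differentiable_on UNIV"
    and "f a > 0"
    and "\<And>t. t > a \<Longrightarrow> f t \<ge> 0"
    and "keller_osserman a f"
    and "\<And>t. f t = ftilde t - principal_eigenvalue B * t"
    and "mono ftilde"
  shows "\<exists>u. large_solution B f u \<and>
           (\<forall>v. large_solution B f v \<longrightarrow> (\<forall>x\<in>B. v x = u x))"
proof -
  define n where "n = CARD('n) - 1"
  have dim: "DIM(real ^ 'n) = Suc n" using zero_less_card_finite[where 'a = 'n] by (simp add: n_def)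
  obtain J h j where J: "J 0 = 1" "\<And>X. radial n (\<lambda>t. - t) X J h" "0 < j" "J j = 0"
    "\<And>r. 0 \<le> r \<Longrightarrow> r < j \<Longrightarrow> 0 < J r"
    using radial_eigenfunction[of n] by blast
  interpret dirichlet_profile n J h j by unfold_locales (use J in auto)
  have \<lambda>: "principal_eigenvalue B = j\<^sup>2" unfolding assms(1) by (rule principal_eigenvalue_ball[OF dim])
  interpret ball_problem n J h j f ftilde a
  proof unfold_locales
    show "continuous_on UNIV f" by (rule C1_differentiable_imp_continuous_on[OF assms(2)])
    show "\<exists>L>0. \<forall>s\<in>{p..q}. \<forall>t\<in>{p..q}. \<bar>f s - f t\<bar> \<le> L * \<bar>s - t\<bar>" for p q
      by (rule C1_lipschitz_interval[OF assms(2)])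
    show "mono ftilde" "0 < f a" "keller_osserman a f" by fact+
    show "f t = ftilde t - j\<^sup>2 * t" for t unfolding \<lambda>[symmetric] by (rule assms(6))
    show "0 \<le> f t" if "a < t" for t by (rule assms(4)[OF that])
  qed
  show ?thesis
  proof (rule radial_start)
    fix l X u k
    assume start: "1 < X" "radial n f X u k" "u 0 = l" "\<And>r. 0 \<le> r \<Longrightarrow> r < X \<Longrightarrow> l \<le> u r"
      "\<And>t. l < t \<Longrightarrow> 0 < f t" "0 \<le> f l"
    interpret started_problem n J h j f ftilde a l X u k by unfold_locales (fact start)+
    show ?thesis unfolding assms(1) by (rule unique_large_solution[OF dim])
  qed
qed

end
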